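(* Let $G$ be a cyclically connected graph (possibly infinite, with at least two vertices). The following are equivalent: (1) $G$ is $4$-ac; (2) no two vertices cut $G$ into $4$ or more components, i.e. for any two vertices $v,w$ of $G$ the space $|G|\setminus\{v,w\}$ has at most $3$ components; (3) any four edges of $G$ are contained in a basic $4$-ac subgraph of $G$.
   Context: A graph $G=(V,E)$ consists of a (possibly infinite) vertex set $V$ and a set $E\subseteq[V]^2$ of edges (vertex degrees may be infinite). $|G|$ denotes the $1$-complex of $G$: the quotient of $V\oplus\bigoplus_{e\in E}[0,1]_e$ ($V$ discrete) in which, for each edge $e=\{v,w\}$, $0\in[0,1]_e$ is identified with $v$ and $1\in[0,1]_e$ with $w$. An arc is a homeomorphic copy of $[0,1]$. $G$ is $n$-ac if for any choice of at most $n$ points of $|G|$ there is an arc in $|G|$ containing them. $G$ is cyclically connected if every two vertices lie on a (finite) cycle of $G$. A connected graph is a cycle graph with links $L_0,\dots,L_{n-1}$ if it is the union of the graphs $L_0,\dots,L_{n-1}$, where $L_i\cap L_j=\emptyset$ if $|i-j|>1 \bmod n$, and $L_i$ meets $L_j$ in a single vertex if $|i-j|=1\bmod n$. A graph is a basic $4$-ac graph if it is (a subdivision of) one of the following: - a circle (a cycle); - a $\theta$-curve (two vertices joined by three internally disjoint paths); - a happy-face curve: a cycle graph of three links, two of which are circles and one of which is an arc (two circles $C_1,C_2$ meeting in exactly one vertex $a$, together with an arc joining a vertex of $C_1\setminus\{a\}$ to a vertex of $C_2\setminus\{a\}$ and otherwise disjoint from $C_1\cup C_2$); - a baguette curve: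 a cycle graph of four links which are alternately circles and arcs (two disjoint circles $C_1,C_2$ together with two disjoint arcs, each joining $C_1$ to $C_2$ and otherwise disjoint from $C_1\cup C_2$). *)

theory Defs
  imports "HOL-Analysis.Analysis"
begin

section \<open>Graphs\<close>

record 'a ugraph =
  verts :: "'a set"
  edges :: "'a set set"

definition is_graph :: "'a ugraph \<Rightarrow> bool" where
  "is_graph G \<longleftrightarrow> (\<forall>e\<in>edges G. e \<subseteq> verts G \<and> card e = 2)"

definition subgraph :: "'a ugraph \<Rightarrow> 'a ugraph \<Rightarrow> bool" where
  "subgraph H G \<longleftrightarrow> is_graph H \<and> is_graph G \<and> verts H \<subseteq> verts G \<and> edges H \<subseteq> edges G"

definition graph_Union :: "'a ugraph list \<Rightarrow> 'a ugraph" where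
  "graph_Union Ls = \<lparr>verts = (\<Union>L\<in>set Ls. verts L), edges = (\<Union>L\<in>set Ls. edges L)\<rparr>"

text \<open>
  A path has at least one vertex and no repeated vertices; \<^term>\<open>a = b\<close> gives the
  one-vertex path. Paths and cycles may have any length, so graphs assembled from them
  are automatically closed under subdivision.
\<close>

definition path_graph :: "'a list \<Rightarrow> 'a ugraph" where
  "path_graph vs = \<lparr>verts = set vs, edges = {{vs ! i, vs ! Suc i} |i. Suc i < length vs}\<rparr>"

definition is_path :: "'a ugraph \<Rightarrow> 'a \<Rightarrow> 'a \<Rightarrow> bool" where
  "is_path P a b \<longleftrightarrow>
     (\<exists>vs. vs \<noteq> [] \<and> distinct vs \<and> hd vs = a \<and> last vs = b \<and> P = path_graph vs)"

definition cycle_graph :: "'a list \<Rightarrow> 'a ugraph" where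
  "cycle_graph vs =
     \<lparr>verts = set vs, edges = {{vs ! i, vs ! (Suc i mod length vs)} |i. i < length vs}\<rparr>"

definition is_cycle :: "'a ugraph \<Rightarrow> bool" where
  "is_cycle C \<longleftrightarrow> (\<exists>vs. 3 \<le> length vs \<and> distinct vs \<and> C = cycle_graph vs)"

definition connected_graph :: "'a ugraph \<Rightarrow> bool" where
  "connected_graph G \<longleftrightarrow> (\<forall>v\<in>verts G. \<forall>w\<in>verts G. \<exists>P. is_path P v w \<and> subgraph P G)"

definition cyclically_connected :: "'a ugraph \<Rightarrow> bool" where
  "cyclically_connected G \<longleftrightarrow>
     (\<forall>v\<in>verts G. \<forall>w\<in>verts G. v \<noteq> w \<longrightarrow>
        (\<exists>C. is_cycle C \<and> subgraph C G \<and> v \<in> verts C \<and> w \<in> verts C))"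


section \<open>Basic 4-ac graphs\<close>

text \<open>Indices of links are compared cyclically: \<open>i\<close> and \<open>j\<close> are adjacent iff they
  differ by 1 modulo the number of links.\<close>

definition cyclically_adjacent :: "nat \<Rightarrow> nat \<Rightarrow> nat \<Rightarrow> bool" where
  "cyclically_adjacent n i j \<longleftrightarrow> Suc i mod n = j \<or> Suc j mod n = i"

definition cycle_graph_with_links :: "'a ugraph \<Rightarrow> 'a ugraph list \<Rightarrow> bool" where
  "cycle_graph_with_links G Ls \<longleftrightarrow>
     connected_graph G \<and> (\<forall>L\<in>set Ls. is_graph L) \<and> G = graph_Union Ls \<and>
     (\<forall>i<length Ls. \<forall>j<length Ls. i \<noteq> j \<longrightarrow>
        (if cyclically_adjacent (length Ls) i j
         then \<exists>x. verts (Ls ! i) \<inter> verts (Ls ! j) = {x}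
         else verts (Ls ! i) \<inter> verts (Ls ! j) = {}))"

definition is_theta :: "'a ugraph \<Rightarrow> bool" where
  "is_theta G \<longleftrightarrow>
     (\<exists>a b P Q R. a \<noteq> b \<and> is_path P a b \<and> is_path Q a b \<and> is_path R a b \<and>
        P \<noteq> Q \<and> P \<noteq> R \<and> Q \<noteq> R \<and>
        verts P \<inter> verts Q = {a, b} \<and> verts P \<inter> verts R = {a, b} \<and> verts Q \<inter> verts R = {a, b} \<and>
        G = graph_Union [P, Q, R])"

text \<open>With three links, being a cycle graph with links does not by itself prevent the three
  links from sharing one vertex, nor does it force the arc to meet the circles at its end
  points only. The conditions on \<open>b\<close> and \<open>c\<close> do; as the links meet pairwise in single
  vertices, the arc then meets the circles in \<open>b\<close> and \<open>c\<close> only. The same holds for the arcs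
  of a baguette curve, which are non-trivial because the circles are disjoint.\<close>

definition is_happy_face :: "'a ugraph \<Rightarrow> bool" where
  "is_happy_face G \<longleftrightarrow>
     (\<exists>C1 C2 P a b c. is_cycle C1 \<and> is_cycle C2 \<and> verts C1 \<inter> verts C2 = {a} \<and>
        is_path P b c \<and> b \<in> verts C1 - {a} \<and> c \<in> verts C2 - {a} \<and>
        cycle_graph_with_links G [C1, P, C2])"

definition is_baguette :: "'a ugraph \<Rightarrow> bool" where
  "is_baguette G \<longleftrightarrow>
     (\<exists>C1 C2 P Q b c b' c'. is_cycle C1 \<and> is_cycle C2 \<and>
        is_path P b c \<and> b \<in> verts C1 \<and> c \<in> verts C2 \<and>
        is_path Q b' c' \<and> b' \<in> verts C1 \<and> c' \<in> verts C2 \<and>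
        cycle_graph_with_links G [C1, P, C2, Q])"

definition basic_4ac :: "'a ugraph \<Rightarrow> bool" where
  "basic_4ac G \<longleftrightarrow> is_cycle G \<or> is_theta G \<or> is_happy_face G \<or> is_baguette G"


section \<open>The 1-complex of a graph\<close>

text \<open>An orientation of the edges: an edge \<^term>\<open>e\<close> is \<open>{fst (ends e), snd (ends e)}\<close>.
  The choice does not matter up to homeomorphism.\<close>

definition ends :: "'a set \<Rightarrow> 'a \<times> 'a" where
  "ends e = (SOME p. e = {fst p, snd p})"

text \<open>The disjoint sum of the discrete space of vertices (as a sum of one-point spaces)
  and one copy of the unit interval for each edge.\<close>

definition pre_complex :: "'a ugraph \<Rightarrow> (('a + 'a set) \<times> real) topology" where
  "pre_complex G =
     sum_topology (\<lambda>i. case i of Inl v \<Rightarrow> top_of_set {0} | Inr e \<Rightarrow> top_of_set {0..1})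
       (verts G <+> edges G)"

text \<open>The identification of the end points of the intervals with vertices is carried out by
  sending each point to a canonical representative of its class.\<close>

datatype 'a point = Vertex 'a | Inner "'a set" real

definition glue :: "('a + 'a set) \<times> real \<Rightarrow> 'a point" where
  "glue x = (case x of
      (Inl v, t) \<Rightarrow> Vertex v
    | (Inr e, t) \<Rightarrow> if t = 0 then Vertex (fst (ends e))
                   else if t = 1 then Vertex (snd (ends e))
                   else Inner e t)"

definition one_complex :: "'a ugraph \<Rightarrow> 'a point topology" where
  "one_complex G = topology (\<lambda>U. U \<subseteq> glue ` topspace (pre_complex G) \<and>
     openin (pre_complex G) {x \<in> topspace (pre_complex G). glue x \<in> U})"

lemma openin_one_complex:
  "openin (one_complex G) U \<longleftrightarrow> U \<subseteq> glue ` topspace (pre_complex G) \<and>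
     openin (pre_complex G) {x \<in> topspace (pre_complex G). glue x \<in> U}"
proof -
  let ?X = "pre_complex G"
  let ?pre = "\<lambda>U. {x \<in> topspace ?X. glue x \<in> U}"
  have "?pre (S \<inter> T) = ?pre S \<inter> ?pre T" for S T
    by auto
  moreover have "?pre (\<Union>\<K>) = (\<Union>K\<in>\<K>. ?pre K)" for \<K>
    by auto
  ultimately have "istopology (\<lambda>U. U \<subseteq> glue ` topspace ?X \<and> openin ?X (?pre U))"
    unfolding istopology_def by (auto intro!: openin_Union openin_Int)
  then show ?thesis
    by (simp add: one_complex_def)
qed

lemma topspace_one_complex: "topspace (one_complex G) = glue ` topspace (pre_complex G)"
proof
  show "topspace (one_complex G) \<subseteq> glue ` topspace (pre_complex G)"
    using openin_one_complex openin_topspace by blast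
  have "{x \<in> topspace (pre_complex G). glue x \<in> glue ` topspace (pre_complex G)}
        = topspace (pre_complex G)"
    by auto
  then have "openin (one_complex G) (glue ` topspace (pre_complex G))"
    by (simp only: openin_one_complex) simp
  then show "glue ` topspace (pre_complex G) \<subseteq> topspace (one_complex G)"
    by (rule openin_subset)
qed

lemma quotient_map_glue: "quotient_map (pre_complex G) (one_complex G) glue"
  by (auto simp: quotient_map_def topspace_one_complex openin_one_complex)


section \<open>Arc connectedness\<close>

definition is_arc_in :: "'b topology \<Rightarrow> 'b set \<Rightarrow> bool" where
  "is_arc_in X A \<longleftrightarrow>
     A \<subseteq> topspace X \<and> subtopology X A homeomorphic_space top_of_set {0..1::real}"

definition n_ac :: "nat \<Rightarrow> 'a ugraph \<Rightarrow> bool" where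
  "n_ac n G \<longleftrightarrow>
     (\<forall>S. S \<subseteq> topspace (one_complex G) \<and> finite S \<and> card S \<le> n \<longrightarrow>
        (\<exists>A. is_arc_in (one_complex G) A \<and> S \<subseteq> A))"

definition complement_components :: "'a ugraph \<Rightarrow> 'a \<Rightarrow> 'a \<Rightarrow> 'a point set set" where
  "complement_components G v w =
     connected_components_of
       (subtopology (one_complex G) (topspace (one_complex G) - {Vertex v, Vertex w}))"

end

theory Submission
  imports Defs
begin

text \<open>
  (1) \<open>\<Longrightarrow>\<close> (2): an arc minus two points has at most three pieces, so it cannot meet four
  components of the complement of two vertices.

  (2) \<open>\<Longrightarrow>\<close> (3): any three edges of a cyclically connected graph lie on a cycle or a theta
  curve. Attach an ear through the fourth edge. If its ends lie on different arcs of the theta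
  curve, the result is a subdivided \<open>K\<^sub>4\<close>, and deleting an arc without a given edge leaves a theta
  curve; if they lie on a common arc, the result is a baguette or a happy-face curve, or four
  parallel paths between two vertices \<open>a\<close> and \<open>b\<close>. Only the last case needs (2): if each of the
  four paths carries a given edge, then two of them are joined by a path \<open>E\<close> avoiding \<open>a\<close> and \<open>b\<close>,
  and deleting one of the two halves into which the end of \<open>E\<close> cuts its path (one half has no given
  edge) leaves a happy-face curve.

  (3) \<open>\<Longrightarrow>\<close> (1): choose edges containing the points. A cycle or a theta curve is an arc up to
  arbitrarily small open pieces. A happy-face or baguette curve is composed of more than four paths,
  so one of them carries no chosen edge, and without it the curve is again an arc up to small pieces.
\<close>

section \<open>Paths and cycles\<close>

text \<open>The deletions rest on one count: four edges cannot hit five edge-disjoint paths, so one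
  of the five is free to go. An ear through a prescribed edge comes from local exchanges instead of
  Menger's theorem, so infinite degrees cause no trouble: the vertices on \<open>H\<close> or on
  some ear of \<open>H\<close> form a set closed under adjacency. Condition (2) is topological, but
  it enters the graph argument only through \<open>linked\<close>, a statement about four paths
  between two vertices. On the way back to (1) the obstacle is that no arc contains a circle; as
  only finitely many points must be met, the arc may stop after the last of them, just before the
  circle closes. Condition (3) is silent about fewer than four edges, and a triangle has only three.
  Hence points on at most three edges are treated separately, by the cycle or theta curve that
  cyclic connectivity provides.\<close>

definition graph_un :: "'a ugraph \<Rightarrow> 'a ugraph \<Rightarrow> 'a ugraph" (infixl "\<squnion>" 65) where
  "P \<squnion> Q = \<lparr>verts = verts P \<union> verts Q, edges = edges P \<union> edges Q\<rparr>"

text \<open>\<open>subgraph\<close> without its well-formedness clauses, so that inclusions of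
  unions split by \<open>simp\<close>; \<open>subgraph_iff\<close> restores them.\<close>

definition graph_le :: "'a ugraph \<Rightarrow> 'a ugraph \<Rightarrow> bool" (infix "\<sqsubseteq>" 50) where
  "P \<sqsubseteq> Q \<longleftrightarrow> verts P \<subseteq> verts Q \<and> edges P \<subseteq> edges Q"

lemma verts_un [simp]: "verts (P \<squnion> Q) = verts P \<union> verts Q"
  and edges_un [simp]: "edges (P \<squnion> Q) = edges P \<union> edges Q"
  by (simp_all add: graph_un_def)

lemma graph_eqI: "verts P = verts Q \<Longrightarrow> edges P = edges Q \<Longrightarrow> P = (Q :: 'a ugraph)"
  by simp

lemma graph_un_commute: "P \<squnion> Q = Q \<squnion> P"
  by (auto intro: graph_eqI)

lemma graph_le_trans: "P \<sqsubseteq> Q \<Longrightarrow> Q \<sqsubseteq> R \<Longrightarrow> P \<sqsubseteq> R"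
  by (auto simp: graph_le_def)

lemma graph_le_un1: "P \<sqsubseteq> P \<squnion> Q"
  and graph_le_un2: "Q \<sqsubseteq> P \<squnion> Q"
  by (auto simp: graph_le_def)

lemma graph_un_le_iff [simp]: "P \<squnion> Q \<sqsubseteq> R \<longleftrightarrow> P \<sqsubseteq> R \<and> Q \<sqsubseteq> R"
  by (auto simp: graph_le_def)

lemma is_graph_un: "is_graph P \<Longrightarrow> is_graph Q \<Longrightarrow> is_graph (P \<squnion> Q)"
  by (auto simp: is_graph_def)

lemma subgraph_iff: "subgraph H G \<longleftrightarrow> is_graph H \<and> is_graph G \<and> H \<sqsubseteq> G"
  by (simp add: subgraph_def graph_le_def)

lemma verts_path_graph [simp]: "verts (path_graph vs) = set vs"
  by (simp add: path_graph_def)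

lemma edges_path_graph_simps [simp]:
  "edges (path_graph []) = {}"
  "edges (path_graph [x]) = {}"
  "edges (path_graph (x # y # zs)) = insert {x, y} (edges (path_graph (y # zs)))"
proof -
  show "edges (path_graph (x # y # zs)) = insert {x, y} (edges (path_graph (y # zs)))"
    (is "?L = ?R")
  proof
    show "?L \<subseteq> ?R"
    proof
      fix e assume "e \<in> ?L"
      then obtain i where "Suc i < length (x # y # zs)"
        and "e = {(x # y # zs) ! i, (x # y # zs) ! Suc i}"
        by (auto simp: path_graph_def)
      then show "e \<in> ?R"
        by (cases i) (auto simp: path_graph_def)
    qed
    show "?R \<subseteq> ?L"
    proof
      fix e assume "e \<in> ?R"
      then consider "e = {x, y}"
        | i where "Suc i < length (y # zs)" "e = {(y # zs) ! i, (y # zs) ! Suc i}"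
        by (auto simp: path_graph_def)
      then show "e \<in> ?L"
      proof cases
        case 1
        then show ?thesis
          by (auto simp: path_graph_def intro!: exI[of _ 0])
      next
        case 2
        then show ?thesis
          by (auto simp: path_graph_def intro!: exI[of _ "Suc i"])
      qed
    qed
  qed
qed (simp_all add: path_graph_def)

lemma edges_path_graph_append:
  "edges (path_graph (xs @ v # ys)) = edges (path_graph (xs @ [v])) \<union> edges (path_graph (v # ys))"
proof (induction xs)
  case (Cons x xs)
  then show ?case
    by (cases xs) auto
qed simp

lemma edges_path_graph_snoc:
  "edges (path_graph (xs @ [x, y])) = insert {x, y} (edges (path_graph (xs @ [x])))"
  using edges_path_graph_append[of xs x "[y]"] by auto

lemma edges_path_graph_rev: "edges (path_graph (rev xs)) = edges (path_graph xs)"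
proof (induction xs)
  case (Cons x xs)
  then show ?case
    by (cases xs) (auto simp: edges_path_graph_snoc insert_commute)
qed simp

lemma edges_path_graph_subset: "e \<in> edges (path_graph vs) \<Longrightarrow> e \<subseteq> set vs"
  by (auto simp: path_graph_def)

lemma is_graph_path_graph: "distinct vs \<Longrightarrow> is_graph (path_graph vs)"
proof (induction vs)
  case (Cons x xs)
  then show ?case
    by (cases xs) (auto simp: is_graph_def card_insert_if)
qed (simp add: is_graph_def)

lemma is_pathI: "vs \<noteq> [] \<Longrightarrow> distinct vs \<Longrightarrow> is_path (path_graph vs) (hd vs) (last vs)"
  by (auto simp: is_path_def)

lemma is_path_is_graph: "is_path P a b \<Longrightarrow> is_graph P"
  by (auto simp: is_path_def is_graph_path_graph)

lemma is_path_ends: "is_path P a b \<Longrightarrow> a \<in> verts P" "is_path P a b \<Longrightarrow> b \<in> verts P"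
  by (auto simp: is_path_def)

lemma path_graph_rev: "path_graph (rev vs) = path_graph vs"
  by (auto intro!: graph_eqI simp: edges_path_graph_rev)

lemma is_path_rev: "is_path P a b \<Longrightarrow> is_path P b a"
  using is_pathI[of "rev vs" for vs] by (fastforce simp: is_path_def path_graph_rev hd_rev last_rev)

lemma is_path_refl: "is_path (path_graph [a]) a a"
  using is_pathI[of "[a]"] by simp

lemma is_path_edge: "a \<noteq> b \<Longrightarrow> is_path (path_graph [a, b]) a b"
  using is_pathI[of "[a, b]"] by simp

lemma is_path_same:
  assumes "is_path P a a"
  shows "P = path_graph [a]"
proof -
  obtain vs where vs: "vs \<noteq> []" "distinct vs" "hd vs = a" "last vs = a" "P = path_graph vs"
    using assms by (auto simp: is_path_def)
  then show ?thesis
    by (cases vs) (auto split: if_splits)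
qed

lemma is_path_Cons_snoc:
  assumes "is_path P a b" "a \<noteq> b"
  obtains ps where "distinct (a # ps @ [b])" "P = path_graph (a # ps @ [b])"
proof -
  obtain vs where vs: "vs \<noteq> []" "distinct vs" "hd vs = a" "last vs = b" "P = path_graph vs"
    using assms by (auto simp: is_path_def)
  obtain us where us: "vs = a # us"
    using vs by (cases vs) auto
  with vs assms have "us \<noteq> []" by auto
  then obtain ps where "us = ps @ [b]"
    using vs us by (metis append_butlast_last_id last_ConsR)
  then show thesis
    using that us vs by blast
qed

lemma is_path_edge_ends:
  assumes "is_path P a b" "{a, b} \<in> edges P"
  shows "P = path_graph [a, b]"
proof (cases "a = b")
  case True
  then show ?thesis
    using assms is_path_same[of P a] by auto
next
  case False
  then obtain ps where ps: "distinct (a # ps @ [b])" "P = path_graph (a # ps @ [b])"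
    using is_path_Cons_snoc[OF assms(1)] by blast
  then show ?thesis
    using assms edges_path_graph_subset by (cases ps) (fastforce simp: doubleton_eq_iff)+
qed

lemma is_path_join:
  assumes "is_path P a b" "is_path Q b c" "verts P \<inter> verts Q = {b}"
  shows "is_path (P \<squnion> Q) a c"
proof -
  obtain ps where ps: "ps \<noteq> []" "distinct ps" "hd ps = a" "last ps = b" "P = path_graph ps"
    using assms(1) by (auto simp: is_path_def)
  obtain qs where qs: "qs \<noteq> []" "distinct qs" "hd qs = b" "last qs = c" "Q = path_graph qs"
    using assms(2) by (auto simp: is_path_def)
  obtain us where us: "ps = us @ [b]"
    using ps by (metis append_butlast_last_id)
  obtain ws where ws: "qs = b # ws"
    using qs by (cases qs) auto
  have eq: "P \<squnion> Q = path_graph (us @ b # ws)"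
    using us ws ps qs by (auto intro!: graph_eqI simp: edges_path_graph_append[of us b ws])
  have "distinct (us @ b # ws)"
    using assms(3) us ws ps qs by auto
  moreover have "hd (us @ b # ws) = a" "last (us @ b # ws) = c"
    using us ws ps qs by (cases us; auto)+
  ultimately show ?thesis
    unfolding eq using is_pathI[of "us @ b # ws"] by simp
qed

lemma is_path_split:
  assumes "is_path P a b" "x \<in> verts P"
  obtains P1 P2 where "is_path P1 a x" "is_path P2 x b" "P = P1 \<squnion> P2" "verts P1 \<inter> verts P2 = {x}"
proof -
  obtain ps where ps: "ps \<noteq> []" "distinct ps" "hd ps = a" "last ps = b" "P = path_graph ps"
    using assms(1) by (auto simp: is_path_def)
  obtain us ws where uw: "ps = us @ x # ws"
    using assms(2) ps split_list[of x ps] by auto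
  have "is_path (path_graph (us @ [x])) a x"
    using ps uw is_pathI[of "us @ [x]"] by (cases us) auto
  moreover have "is_path (path_graph (x # ws)) x b"
    using ps uw is_pathI[of "x # ws"] by auto
  moreover have "P = path_graph (us @ [x]) \<squnion> path_graph (x # ws)"
    using ps uw edges_path_graph_append[of us x ws] by (auto intro!: graph_eqI)
  moreover have "verts (path_graph (us @ [x])) \<inter> verts (path_graph (x # ws)) = {x}"
    using ps uw by auto
  ultimately show thesis
    using that by blast
qed

lemma is_path_first_hit:
  assumes "is_path P a b" "b \<in> X"
  obtains P' w where "is_path P' a w" "verts P' \<inter> X = {w}" "P' \<sqsubseteq> P"
proof -
  obtain ps where ps: "ps \<noteq> []" "distinct ps" "hd ps = a" "last ps = b" "P = path_graph ps"
    using assms(1) by (auto simp: is_path_def)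
  have "\<exists>x\<in>set ps. x \<in> X"
    using assms ps by auto
  then obtain us x ws where uw: "ps = us @ x # ws" "x \<in> X" "\<forall>u\<in>set us. u \<notin> X"
    using split_list_first_prop[of ps "\<lambda>x. x \<in> X"] by blast
  have "is_path (path_graph (us @ [x])) a x"
    using ps uw is_pathI[of "us @ [x]"] by (cases us) auto
  moreover have "verts (path_graph (us @ [x])) \<inter> X = {x}"
    using uw by auto
  moreover have "path_graph (us @ [x]) \<sqsubseteq> P"
    using ps uw edges_path_graph_append[of us x ws] by (auto simp: graph_le_def)
  ultimately show thesis
    using that by blast
qed

text \<open>Follow \<open>P\<close> up to its first vertex on \<open>Q\<close> and then
  \<open>Q\<close> from there on: these two pieces meet in that vertex only.\<close>

lemma is_path_trans:
  assumes "is_path P a b" "is_path Q b c"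
  obtains R where "is_path R a c" "R \<sqsubseteq> P \<squnion> Q"
proof -
  obtain P' w where P': "is_path P' a w" "verts P' \<inter> verts Q = {w}" "P' \<sqsubseteq> P"
    using is_path_first_hit[OF assms(1), of "verts Q"] is_path_ends assms by metis
  then have "w \<in> verts Q" by blast
  then obtain Q1 Q2 where Q: "is_path Q1 b w" "is_path Q2 w c" "Q = Q1 \<squnion> Q2" "verts Q1 \<inter> verts Q2 = {w}"
    using is_path_split assms by metis
  have "verts P' \<inter> verts Q2 = {w}"
    using P' Q by auto
  then have "is_path (P' \<squnion> Q2) a c"
    using is_path_join P' Q by metis
  moreover have "P' \<squnion> Q2 \<sqsubseteq> P \<squnion> Q"
    using P' Q by (auto simp: graph_le_def)
  ultimately show thesis
    using that by blast
qed

text \<open>Cut \<open>W\<close> at its last vertex in \<open>X\<close>, and the rest at its first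
  vertex in \<open>Y\<close>. Shortening a second time keeps the single contact with
  \<open>X\<close>.\<close>

lemma is_path_link:
  assumes "is_path W u w" "u \<in> X" "w \<in> Y" "verts W \<inter> X \<inter> Y = {}"
  obtains E p q where "is_path E p q" "verts E \<inter> X = {p}" "verts E \<inter> Y = {q}" "E \<sqsubseteq> W"
proof -
  obtain W' p where W': "is_path W' w p" "verts W' \<inter> X = {p}" "W' \<sqsubseteq> W"
    using is_path_first_hit[OF is_path_rev] assms by metis
  obtain E q where E: "is_path E p q" "verts E \<inter> Y = {q}" "E \<sqsubseteq> W'"
    using is_path_first_hit[OF is_path_rev] W' assms by metis
  have "verts E \<inter> X = {p}"
    using E W' is_path_ends(1)[OF E(1)] by (auto simp: graph_le_def)
  then show thesis
    using that E W' graph_le_trans by metis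
qed

text \<open>Repeating the head at the end of the list removes the modular index, so that the lemmas
  on \<open>path_graph\<close> apply to cycles.\<close>

lemma edges_cycle_graph:
  assumes "vs \<noteq> []"
  shows "edges (cycle_graph vs) = edges (path_graph (vs @ [hd vs]))"
proof -
  have "(vs @ [hd vs]) ! Suc i = vs ! (Suc i mod length vs)" if "i < length vs" for i
    using that assms by (cases "Suc i = length vs") (auto simp: nth_append hd_conv_nth)
  moreover have "(vs @ [hd vs]) ! i = vs ! i" if "i < length vs" for i
    using that by (auto simp: nth_append)
  ultimately have "(\<lambda>i. {vs ! i, vs ! (Suc i mod length vs)}) ` {..<length vs} =
      (\<lambda>i. {(vs @ [hd vs]) ! i, (vs @ [hd vs]) ! Suc i}) ` {..<length vs}"
    by (intro image_cong) auto
  then show ?thesis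
    by (simp add: cycle_graph_def path_graph_def setcompr_eq_image lessThan_def)
qed

lemma verts_cycle_graph [simp]: "verts (cycle_graph vs) = set vs"
  by (simp add: cycle_graph_def)

lemma cycle_graph_rotate: "cycle_graph (xs @ a # ys) = cycle_graph (a # ys @ xs)"
proof (cases xs)
  case (Cons x us)
  have "edges (path_graph (x # us @ a # ys @ [x])) =
    edges (path_graph (x # us @ [a])) \<union> edges (path_graph (a # ys @ [x]))"
    using edges_path_graph_append[of "x # us" a "ys @ [x]"] by simp
  moreover have "edges (path_graph (a # ys @ x # us @ [a])) =
    edges (path_graph (a # ys @ [x])) \<union> edges (path_graph (x # us @ [a]))"
    using edges_path_graph_append[of "a # ys" x "us @ [a]"] by simp
  ultimately show ?thesis
    using Cons by (auto intro!: graph_eqI simp: edges_cycle_graph)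
qed simp

text \<open>\<open>P \<noteq> Q\<close> excludes that both paths are the single edge between
  \<open>a\<close> and \<open>b\<close>. So one of them has an inner vertex, and the closed list has
  length at least 3.\<close>

lemma is_cycle_join:
  assumes "is_path P a b" "is_path Q a b" "verts P \<inter> verts Q = {a, b}" "a \<noteq> b" "P \<noteq> Q"
  shows "is_cycle (P \<squnion> Q)"
proof -
  obtain ps where ps: "distinct (a # ps @ [b])" "P = path_graph (a # ps @ [b])"
    using is_path_Cons_snoc[OF assms(1,4)] by blast
  obtain qs where qs: "distinct (b # qs @ [a])" "Q = path_graph (b # qs @ [a])"
    using is_path_Cons_snoc[OF is_path_rev[OF assms(2)]] assms(4) by blast
  let ?vs = "a # ps @ b # qs"
  have "\<not> (ps = [] \<and> qs = [])"
    using assms(5) ps qs by (auto simp: insert_commute intro: graph_eqI)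
  then have "3 \<le> length ?vs"
    by (cases ps; cases qs) auto
  moreover have "distinct ?vs"
    using ps qs assms(3) by auto
  moreover have "P \<squnion> Q = cycle_graph ?vs"
    using ps qs edges_path_graph_append[of "a # ps" b "qs @ [a]"]
    by (auto intro!: graph_eqI simp: edges_cycle_graph)
  ultimately show ?thesis
    unfolding is_cycle_def by blast
qed

lemma is_cycle_split:
  assumes "is_cycle C" "a \<in> verts C" "b \<in> verts C" "a \<noteq> b"
  obtains P Q where "is_path P a b" "is_path Q a b" "verts P \<inter> verts Q = {a, b}" "P \<noteq> Q"
    "C = P \<squnion> Q"
proof -
  obtain vs where vs: "3 \<le> length vs" "distinct vs" "C = cycle_graph vs"
    using assms(1) by (auto simp: is_cycle_def)
  obtain xs ys where xy: "vs = xs @ a # ys"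
    using assms vs split_list[of a vs] by auto
  obtain ps qs where pq: "ys @ xs = ps @ b # qs"
    using assms vs xy split_list[of b "ys @ xs"] by auto
  have C: "C = cycle_graph (a # ps @ b # qs)"
    using vs xy pq by (simp add: cycle_graph_rotate)
  have "distinct (a # (ys @ xs))" "3 \<le> length (a # (ys @ xs))"
    using vs xy by auto
  then have d: "distinct (a # ps @ b # qs)" "3 \<le> length (a # ps @ b # qs)"
    unfolding pq by simp_all
  let ?P = "path_graph (a # ps @ [b])" and ?Q = "path_graph (b # qs @ [a])"
  have *: "verts ?P \<inter> verts ?Q = {a, b}"
    using d by auto
  show thesis
  proof (rule that)
    show "is_path ?P a b"
      using d is_pathI[of "a # ps @ [b]"] by auto
    show "is_path ?Q a b"
      using d is_pathI[of "b # qs @ [a]"] by (auto intro: is_path_rev)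
    show "verts ?P \<inter> verts ?Q = {a, b}" by fact
    show "?P \<noteq> ?Q"
    proof
      assume "?P = ?Q"
      then have "set (a # ps @ [b]) = {a, b}" "set (b # qs @ [a]) = {a, b}"
        using * by (metis Int_absorb verts_path_graph)+
      then have "set ps \<subseteq> {a, b}" "set qs \<subseteq> {a, b}"
        by auto
      moreover have "a \<notin> set ps" "b \<notin> set ps" "a \<notin> set qs" "b \<notin> set qs"
        using d(1) by auto
      ultimately have "set ps = {}" "set qs = {}"
        by (simp_all add: subset_insert)
      with d(2) show False
        by simp
    qed
    show "C = ?P \<squnion> ?Q"
      unfolding C using edges_path_graph_append[of "a # ps" b "qs @ [a]"]
      by (auto intro!: graph_eqI simp: edges_cycle_graph)
  qed
qed

text \<open>A common edge can only be \<open>{a, b}\<close>, and a path from \<open>a\<close> to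
  \<open>b\<close> containing this edge consists of it alone; the two paths would then
  coincide.\<close>

lemma edges_disjoint_parallel:
  assumes "is_path P a b" "is_path Q a b" "verts P \<inter> verts Q = {a, b}" "P \<noteq> Q"
  shows "edges P \<inter> edges Q = {}"
proof (rule ccontr)
  assume "edges P \<inter> edges Q \<noteq> {}"
  then obtain e where e: "e \<in> edges P" "e \<in> edges Q" by blast
  then have "e \<subseteq> {a, b}" "card e = 2"
    using assms(3) is_path_is_graph[OF assms(1)] is_path_is_graph[OF assms(2)]
    unfolding is_graph_def by blast+
  then have "e = {a, b}"
    by (auto simp: card_2_iff)
  then show False
    using e assms is_path_edge_ends by metis
qed

lemma edges_disjoint_single:
  assumes "is_graph P" "is_graph Q" "verts P \<inter> verts Q \<subseteq> {a}"
  shows "edges P \<inter> edges Q = {}"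
proof (rule ccontr)
  assume "edges P \<inter> edges Q \<noteq> {}"
  then obtain e where e: "e \<in> edges P" "e \<in> edges Q" by blast
  then have "e \<subseteq> {a}" "card e = 2"
    using assms unfolding is_graph_def by blast+
  then show False
    using card_mono[of "{a}" e] by auto
qed

section \<open>Ears\<close>

lemma is_path_closed:
  assumes "is_path P a b" "P \<sqsubseteq> G" "S a" "\<And>y z. S y \<Longrightarrow> {y, z} \<in> edges G \<Longrightarrow> S z"
  shows "S b"
proof -
  obtain vs where vs: "vs \<noteq> []" "hd vs = a" "last vs = b" "P = path_graph vs"
    using assms(1) by (auto simp: is_path_def)
  have "S (last vs)"
    if "vs \<noteq> []" "edges (path_graph vs) \<subseteq> edges G" "S (hd vs)" for vs
    using that
  proof (induction vs)
    case (Cons x xs)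
    then show ?case
      using assms(4)[of x "hd xs"] by (cases xs) auto
  qed simp
  then show ?thesis
    using vs assms(2,3) by (auto simp: graph_le_def)
qed

lemma edge_cases:
  assumes "is_graph G" "e \<in> edges G"
  obtains x y where "e = {x, y}" "x \<noteq> y" "x \<in> verts G" "y \<in> verts G"
  using assms by (auto simp: is_graph_def card_2_iff)

lemma edge_path_le: "is_graph G \<Longrightarrow> {x, y} \<in> edges G \<Longrightarrow> path_graph [x, y] \<sqsubseteq> G"
  by (auto simp: is_graph_def graph_le_def)

text \<open>A cycle cut at two of its vertices (\<open>is_cycle_iff_parallel\<close>). Cycles are
  handled in this form because everything else is attached to them at \<open>a\<close> and
  \<open>b\<close>.\<close>

definition parallel :: "'a \<Rightarrow> 'a \<Rightarrow> 'a ugraph \<Rightarrow> 'a ugraph \<Rightarrow> bool" where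
  "parallel a b P Q \<longleftrightarrow>
     a \<noteq> b \<and> is_path P a b \<and> is_path Q a b \<and> P \<noteq> Q \<and> verts P \<inter> verts Q = {a, b}"

lemma parallel_commute: "parallel a b P Q \<Longrightarrow> parallel a b Q P"
  and parallel_rev: "parallel a b P Q \<Longrightarrow> parallel b a P Q"
  by (auto simp: parallel_def is_path_rev)

lemma parallelD:
  assumes "parallel a b P Q"
  shows "a \<noteq> b" "is_path P a b" "is_path Q a b" "P \<noteq> Q" "verts P \<inter> verts Q = {a, b}"
  using assms by (auto simp: parallel_def)

lemma parallel_edges: "parallel a b P Q \<Longrightarrow> edges P \<inter> edges Q = {}"
  unfolding parallel_def using edges_disjoint_parallel by metis

lemma is_cycle_iff_parallel:
  "is_cycle C \<longleftrightarrow> (\<exists>a b P Q. parallel a b P Q \<and> C = P \<squnion> Q)"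
proof
  assume C: "is_cycle C"
  then obtain vs where vs: "3 \<le> length vs" "distinct vs" "C = cycle_graph vs"
    by (auto simp: is_cycle_def)
  then obtain x y zs where "vs = x # y # zs"
    by (cases vs; cases "tl vs") auto
  with vs have "x \<in> verts C" "y \<in> verts C" "x \<noteq> y"
    by auto
  from is_cycle_split[OF C this] show "\<exists>a b P Q. parallel a b P Q \<and> C = P \<squnion> Q"
    unfolding parallel_def using \<open>x \<noteq> y\<close> by metis
next
  assume "\<exists>a b P Q. parallel a b P Q \<and> C = P \<squnion> Q"
  then show "is_cycle C"
    unfolding parallel_def using is_cycle_join by metis
qed

lemma cycle_join: "parallel a b P Q \<Longrightarrow> is_cycle (P \<squnion> Q)"
  using is_cycle_iff_parallel by blast

lemma cycle_split:
  assumes "is_cycle C" "a \<in> verts C" "b \<in> verts C" "a \<noteq> b"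
  obtains P Q where "parallel a b P Q" "C = P \<squnion> Q"
  using is_cycle_split[OF assms] assms(4) unfolding parallel_def by metis

lemma cyclically_connected_cycle:
  assumes "cyclically_connected G" "v \<in> verts G" "w \<in> verts G" "v \<noteq> w"
  obtains P Q where "parallel v w P Q" "P \<sqsubseteq> G" "Q \<sqsubseteq> G"
proof -
  obtain C where C: "is_cycle C" "subgraph C G" "v \<in> verts C" "w \<in> verts C"
    using assms by (auto simp: cyclically_connected_def)
  obtain P Q where "parallel v w P Q" "C = P \<squnion> Q"
    using cycle_split[OF C(1,3,4) assms(4)] .
  then show thesis
    using that C(2) by (auto simp: subgraph_iff)
qed

text \<open>A cycle through \<open>z\<close> and \<open>x\<close> splits into two paths sharing only
  these two vertices, so \<open>y\<close> lies on at most one of them. The other one is stopped at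
  its first vertex in \<open>X\<close>.\<close>

lemma avoiding_path:
  assumes "cyclically_connected G" "z \<in> verts G" "z \<noteq> y" "X \<subseteq> verts G" "x \<in> X" "x \<noteq> y"
  obtains W w where "is_path W z w" "W \<sqsubseteq> G" "y \<notin> verts W" "verts W \<inter> X = {w}"
proof -
  have "\<exists>P. is_path P z x \<and> P \<sqsubseteq> G \<and> y \<notin> verts P"
  proof (cases "z = x")
    case True
    then show ?thesis
      using is_path_refl[of z] assms by (auto simp: graph_le_def)
  next
    case False
    have "x \<in> verts G"
      using assms by blast
    from cyclically_connected_cycle[OF assms(1,2) this False] obtain P Q
      where "parallel z x P Q" "P \<sqsubseteq> G" "Q \<sqsubseteq> G" .
    moreover from this(1) have "y \<notin> verts P \<or> y \<notin> verts Q"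
      using assms by (auto dest!: parallelD(5))
    ultimately show ?thesis
      unfolding parallel_def by metis
  qed
  then obtain P where P: "is_path P z x" "P \<sqsubseteq> G" "y \<notin> verts P" by blast
  obtain W w where "is_path W z w" "verts W \<inter> X = {w}" "W \<sqsubseteq> P"
    using is_path_first_hit[OF P(1) assms(5)] .
  moreover from this have "W \<sqsubseteq> G" "y \<notin> verts W"
    using P by (auto simp: graph_le_def)
  ultimately show thesis
    using that by blast
qed

text \<open>Only vertices are constrained, so an edge of \<open>H\<close> counts as an ear too. This
  saves a case distinction in \<open>ear_adjacent\<close>; where the ear must be new, it is required
  to contain an edge outside \<open>H\<close>.\<close>

definition ear :: "'a ugraph \<Rightarrow> 'a ugraph \<Rightarrow> 'a ugraph \<Rightarrow> 'a \<Rightarrow> 'a \<Rightarrow> bool" where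
  "ear G H E p q \<longleftrightarrow> p \<noteq> q \<and> is_path E p q \<and> E \<sqsubseteq> G \<and> verts E \<inter> verts H = {p, q}"

lemma ear_rev: "ear G H E p q \<Longrightarrow> ear G H E q p"
  by (auto simp: ear_def is_path_rev)

text \<open>\<open>D\<close> is a bypass that leaves the ear at \<open>y\<close> and returns to its
  first half at \<open>w\<close>. Replacing the stretch \<open>M\<close> between \<open>w\<close>
  and \<open>y\<close> by \<open>D\<close> keeps the ends of the ear and takes in the edges of
  \<open>D\<close>.\<close>

lemma ear_detour:
  assumes E: "p \<noteq> q" "is_path E1 p y" "is_path E2 y q" "verts E1 \<inter> verts E2 = {y}" "E1 \<squnion> E2 \<sqsubseteq> G"
    and H: "verts (E1 \<squnion> E2) \<inter> verts H = {p, q}" "y \<notin> verts H"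
    and D: "is_path D y w" "w \<noteq> y" "D \<sqsubseteq> G"
      "verts D \<inter> (verts H \<union> verts (E1 \<squnion> E2)) = {y, w}" "w \<in> verts E1"
  shows "\<exists>E' p' q'. ear G H E' p' q' \<and> edges D \<subseteq> edges E'"
proof -
  obtain L M where LM: "is_path L p w" "is_path M w y" "E1 = L \<squnion> M" "verts L \<inter> verts M = {w}"
    using is_path_split[OF E(2) D(5)] .
  have y: "y \<in> verts M" "y \<in> verts D" "y \<in> verts E2" "q \<in> verts E2" "p \<in> verts L" "w \<in> verts L"
    "w \<in> verts D"
    using LM E D is_path_ends by metis+
  then have yL: "y \<notin> verts L"
    using LM(4) D(2) by (metis IntI singletonD)
  have "verts L \<inter> verts D = {w}"
    using D y yL LM by auto
  then have "is_path (L \<squnion> D) p y"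
    using is_path_join LM(1) is_path_rev[OF D(1)] by metis
  moreover have "verts (L \<squnion> D) \<inter> verts E2 = {y}"
    using E(4) yL y D(2,4,5) LM by auto
  ultimately have "is_path (L \<squnion> D \<squnion> E2) p q"
    using is_path_join E(3) by metis
  moreover have "verts (L \<squnion> D \<squnion> E2) \<inter> verts H = {p, q}"
    using H D(4) y LM(3) by auto
  ultimately have "ear G H (L \<squnion> D \<squnion> E2) p q"
    using E D LM by (auto simp: ear_def)
  then show ?thesis
    by (intro exI conjI) auto
qed

text \<open>Walk along the edge to \<open>z\<close> and onwards without meeting \<open>y\<close>
  again, until \<open>H\<close> or the ear through \<open>y\<close> is reached. The place of arrival
  decides how the ear is rerouted.\<close>

lemma ear_adjacent:
  assumes G: "cyclically_connected G" "is_graph G"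
    and H: "H \<sqsubseteq> G" "h1 \<in> verts H" "h2 \<in> verts H" "h1 \<noteq> h2"
    and y: "y \<in> verts H \<or> (\<exists>E p q. ear G H E p q \<and> y \<in> verts E)"
    and e: "{y, z} \<in> edges G"
  shows "\<exists>E p q. ear G H E p q \<and> {y, z} \<in> edges E"
proof -
  have yz: "y \<noteq> z" "y \<in> verts G" "z \<in> verts G"
    using G(2) e by (fastforce simp: is_graph_def)+
  \<comment> \<open>\<open>X\<close> will be \<open>H\<close> if \<open>y\<close> lies on
    \<open>H\<close>, and otherwise \<open>H\<close> together with the ear through \<open>y\<close>.
    If \<open>z\<close> is already in \<open>X\<close>, the continuation \<open>W\<close> is the
    single vertex \<open>z\<close>.\<close>
  have detour: "\<exists>D w. is_path D y w \<and> w \<noteq> y \<and> D \<sqsubseteq> G \<and> verts D \<inter> X = {y, w} \<and> {y, z} \<in> edges D"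
    if X: "X \<subseteq> verts G" "verts H \<subseteq> X" "y \<in> X" for X
  proof -
    obtain x where "x \<in> X" "x \<noteq> y"
      using H X by blast
    with avoiding_path[OF G(1) yz(3) yz(1)[symmetric] X(1)] obtain W w
      where W: "is_path W z w" "W \<sqsubseteq> G" "y \<notin> verts W" "verts W \<inter> X = {w}"
      by metis
    have "is_path (path_graph [y, z] \<squnion> W) y w"
      using is_path_join[OF is_path_edge[OF yz(1)] W(1)] W is_path_ends(1)[OF W(1)] by auto
    moreover have "verts (path_graph [y, z] \<squnion> W) \<inter> X = {y, w}"
      using W X is_path_ends(1)[OF W(1)] by auto
    moreover have "w \<noteq> y"
      using W by auto
    moreover have "path_graph [y, z] \<squnion> W \<sqsubseteq> G"
      using W edge_path_le[OF G(2) e] by simp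
    ultimately show ?thesis
      by (intro exI[of _ "path_graph [y, z] \<squnion> W"] exI[of _ w]) auto
  qed
  show ?thesis
  proof (cases "y \<in> verts H")
    case True
    then show ?thesis
      using detour[of "verts H"] H(1) unfolding ear_def by (metis graph_le_def order_refl)
  next
    case False
    then obtain E p q where E: "ear G H E p q" "y \<in> verts E"
      using y by blast
    then obtain E1 E2 where E12: "is_path E1 p y" "is_path E2 y q" "E = E1 \<squnion> E2"
      "verts E1 \<inter> verts E2 = {y}"
      using is_path_split unfolding ear_def by metis
    have ear: "p \<noteq> q" "E \<sqsubseteq> G" "verts E \<inter> verts H = {p, q}"
      using E by (auto simp: ear_def)
    have "verts H \<union> verts E \<subseteq> verts G"
      using H(1) E(1) by (auto simp: ear_def graph_le_def)
    then obtain D w where D: "is_path D y w" "w \<noteq> y" "D \<sqsubseteq> G"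
      "verts D \<inter> (verts H \<union> verts E) = {y, w}" "{y, z} \<in> edges D"
      using detour[of "verts H \<union> verts E"] E(2) by auto
    consider "w \<in> verts E1" | "w \<in> verts E2" | "w \<notin> verts E"
      using E12 by auto
    then show ?thesis
    proof cases
      case 1
      then show ?thesis
        using ear_detour[of p q E1 y E2 G H D w] E12 D ear False by blast
    next
      case 2
      have "verts E2 \<inter> verts E1 = {y}" "E2 \<squnion> E1 = E"
        using E12 graph_un_commute by (metis Int_commute)+
      then show ?thesis
        using ear_detour[of q p E2 y E1 G H D w] E12(1,2) D ear False 2 is_path_rev
        by (metis insert_commute subsetD)
    next
      \<comment> \<open>The walk arrives on \<open>H\<close> away from the ear: the half
        \<open>E2\<close> is given up, and \<open>E1\<close> followed by \<open>D\<close> is an ear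
        from \<open>p\<close> to \<open>w\<close>.\<close>
      case 3
      have "q \<in> verts E2" "p \<in> verts E1" "y \<in> verts D" "y \<in> verts E1" "w \<in> verts D"
        using E12 D is_path_ends by metis+
      moreover have "p \<noteq> w"
        using 3 calculation E12 by auto
      moreover have "w \<in> verts H"
        using D(4) 3 by blast
      moreover have "verts E1 \<inter> verts D = {y}"
        using D(4) 3 E12(3) calculation by auto
      moreover from this have "is_path (E1 \<squnion> D) p w"
        using is_path_join E12 D by metis
      moreover have "verts (E1 \<squnion> D) \<inter> verts H = {p, w}"
      proof -
        have "q \<in> verts H" "p \<in> verts H"
          using ear by auto
        then have "q \<notin> verts E1"
          using E12(4) False calculation(1) by (metis IntI singletonD)
        then have "verts E1 \<inter> verts H = {p}"
          using E12(3) ear(3) calculation(2) \<open>p \<in> verts H\<close> by auto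
        moreover have "verts D \<inter> verts H = {w}"
          using D(4) False \<open>w \<in> verts H\<close> by auto
        ultimately show ?thesis
          by auto
      qed
      ultimately have "ear G H (E1 \<squnion> D) p w"
        using D E12 ear by (auto simp: ear_def)
      then show ?thesis
        using D(5) by (metis UnI2 edges_un)
    qed
  qed
qed

text \<open>By \<open>ear_adjacent\<close> the property \<open>?S\<close> passes from a vertex to
  its neighbours, so along a path from \<open>h1\<close> it reaches an end of \<open>e\<close>; one
  more application captures \<open>e\<close> itself.\<close>

lemma ear_exists:
  assumes G: "cyclically_connected G" "is_graph G"
    and H: "H \<sqsubseteq> G" "h1 \<in> verts H" "h2 \<in> verts H" "h1 \<noteq> h2"
    and e: "e \<in> edges G"
  obtains E p q where "ear G H E p q" "e \<in> edges E"
proof -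
  obtain x y where xy: "e = {x, y}" "x \<noteq> y" "x \<in> verts G" "y \<in> verts G"
    using edge_cases[OF G(2) e] .
  let ?S = "\<lambda>y. y \<in> verts H \<or> (\<exists>E p q. ear G H E p q \<and> y \<in> verts E)"
  have "?S x"
  proof (cases "h1 = x")
    case False
    have "h1 \<in> verts G"
      using H by (auto simp: graph_le_def)
    from cyclically_connected_cycle[OF G(1) this xy(3) False] obtain P Q
      where P: "parallel h1 x P Q" "P \<sqsubseteq> G" .
    show ?thesis
    proof (rule is_path_closed[OF parallelD(2)[OF P(1)] P(2)])
      show "?S h1" using H by blast
      show "?S z" if yz: "?S y" "{y, z} \<in> edges G" for y z
      proof -
        obtain E p q where E: "ear G H E p q" "{y, z} \<in> edges E"
          using ear_adjacent[OF G H yz] by blast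
        then have "is_graph E"
          using is_path_is_graph unfolding ear_def by metis
        with E show ?thesis
          unfolding is_graph_def by blast
      qed
    qed
  qed (use H in blast)
  from ear_adjacent[OF G H this, of y] show thesis
    using that e xy by blast
qed

section \<open>Basic 4-ac graphs as unions of paths\<close>

lemma connected_graphI:
  assumes "is_graph G" "\<And>v. v \<in> verts G \<Longrightarrow> \<exists>P. is_path P x v \<and> P \<sqsubseteq> G"
  shows "connected_graph G"
  unfolding connected_graph_def
proof (intro ballI)
  fix v w assume "v \<in> verts G" "w \<in> verts G"
  then obtain P Q where "is_path P x v" "P \<sqsubseteq> G" "is_path Q x w" "Q \<sqsubseteq> G"
    using assms(2) by metis
  moreover from this obtain R where R: "is_path R v w" "R \<sqsubseteq> P \<squnion> Q"
    using is_path_trans is_path_rev by metis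
  ultimately have "is_path R v w" "R \<sqsubseteq> G" "is_graph R"
    using is_path_is_graph[of R v w] by (auto simp: graph_le_def)
  then show "\<exists>R. is_path R v w \<and> subgraph R G"
    using assms(1) unfolding subgraph_iff by blast
qed

lemma connected_path:
  assumes "is_path P a b"
  shows "connected_graph P"
proof (rule connected_graphI)
  show "\<exists>Q. is_path Q a v \<and> Q \<sqsubseteq> P" if "v \<in> verts P" for v
    using is_path_split[OF assms that] graph_le_un1 by metis
qed (rule is_path_is_graph[OF assms])

lemma connected_un:
  assumes "connected_graph P" "connected_graph Q" "is_graph P" "is_graph Q" "x \<in> verts P" "x \<in> verts Q"
  shows "connected_graph (P \<squnion> Q)"
proof (rule connected_graphI[of _ x])
  fix v assume "v \<in> verts (P \<squnion> Q)"
  then obtain R where "is_path R x v" "R \<sqsubseteq> P \<or> R \<sqsubseteq> Q"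
    using assms unfolding connected_graph_def subgraph_iff by (metis UnE verts_un)
  then show "\<exists>R. is_path R x v \<and> R \<sqsubseteq> P \<squnion> Q"
    using graph_le_trans graph_le_un1 graph_le_un2 by metis
qed (use assms is_graph_un in blast)

lemma parallel_is_graph: "parallel a b P Q \<Longrightarrow> is_graph (P \<squnion> Q)"
  using is_graph_un is_path_is_graph unfolding parallel_def by metis

lemma parallel_connected:
  assumes "parallel a b P Q"
  shows "connected_graph (P \<squnion> Q)"
proof -
  have P: "is_path P a b" and Q: "is_path Q a b"
    using assms by (auto simp: parallel_def)
  show ?thesis
    using connected_un[OF connected_path[OF P] connected_path[OF Q] is_path_is_graph[OF P]
        is_path_is_graph[OF Q] is_path_ends(1)[OF P] is_path_ends(1)[OF Q]] .
qed

definition theta_segments where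
  "theta_segments a b P Q R \<longleftrightarrow> parallel a b P Q \<and> parallel a b P R \<and> parallel a b Q R"

text \<open>Each circle is cut at the common vertex \<open>a\<close> and at the end of the arc on
  it, so that the curve consists of five paths.\<close>

definition happy_segments where
  "happy_segments a b c A1 A2 B1 B2 P \<longleftrightarrow>
     parallel a b A1 A2 \<and> parallel a c B1 B2 \<and> is_path P b c \<and>
     verts (A1 \<squnion> A2) \<inter> verts (B1 \<squnion> B2) = {a} \<and>
     verts (A1 \<squnion> A2) \<inter> verts P = {b} \<and> verts P \<inter> verts (B1 \<squnion> B2) = {c}"

text \<open>Each circle is cut at the two ends of arcs on it, so that the curve consists of six
  paths.\<close>

definition baguette_segments where
  "baguette_segments b b' c c' A1 A2 B1 B2 P Q \<longleftrightarrow>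
     parallel b b' A1 A2 \<and> parallel c c' B1 B2 \<and> is_path P b c \<and> is_path Q b' c' \<and>
     verts (A1 \<squnion> A2) \<inter> verts (B1 \<squnion> B2) = {} \<and> verts P \<inter> verts Q = {} \<and>
     verts (A1 \<squnion> A2) \<inter> verts P = {b} \<and> verts P \<inter> verts (B1 \<squnion> B2) = {c} \<and>
     verts (B1 \<squnion> B2) \<inter> verts Q = {c'} \<and> verts (A1 \<squnion> A2) \<inter> verts Q = {b'}"

lemma graph_Union_simps:
  "graph_Union [P, Q, R] = P \<squnion> Q \<squnion> R"
  "graph_Union [P, Q, R, S] = P \<squnion> Q \<squnion> R \<squnion> S"
  by (simp_all add: graph_un_def graph_Union_def Un_assoc)

lemma is_theta_iff: "is_theta G \<longleftrightarrow> (\<exists>a b P Q R. theta_segments a b P Q R \<and> G = P \<squnion> Q \<squnion> R)"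
proof -
  have eq: "theta_segments a b P Q R \<and> G = P \<squnion> Q \<squnion> R \<longleftrightarrow>
    a \<noteq> b \<and> is_path P a b \<and> is_path Q a b \<and> is_path R a b \<and> P \<noteq> Q \<and> P \<noteq> R \<and> Q \<noteq> R \<and>
    verts P \<inter> verts Q = {a, b} \<and> verts P \<inter> verts R = {a, b} \<and> verts Q \<inter> verts R = {a, b} \<and>
    G = P \<squnion> Q \<squnion> R" for a b P Q R
    unfolding theta_segments_def parallel_def by (rule iffI; elim conjE; intro conjI; assumption)
  show ?thesis
    unfolding is_theta_def graph_Union_simps eq by (rule refl)
qed

text \<open>Among three indices any two are cyclically adjacent, so every pair of links meets in one
  vertex. With four links the opposite pairs are disjoint.\<close>

lemma links3:
  "cycle_graph_with_links G [X, Y, Z] \<longleftrightarrow>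
     connected_graph G \<and> is_graph X \<and> is_graph Y \<and> is_graph Z \<and> G = X \<squnion> Y \<squnion> Z \<and>
     (\<exists>x. verts X \<inter> verts Y = {x}) \<and> (\<exists>x. verts Y \<inter> verts Z = {x}) \<and>
     (\<exists>x. verts X \<inter> verts Z = {x})"
  unfolding cycle_graph_with_links_def graph_Union_simps
  by (simp add: All_less_Suc cyclically_adjacent_def Int_commute cong: conj_cong)
    (rule iffI; elim conjE; intro conjI; assumption)

lemma links4:
  "cycle_graph_with_links G [X, Y, Z, W] \<longleftrightarrow>
     connected_graph G \<and> is_graph X \<and> is_graph Y \<and> is_graph Z \<and> is_graph W \<and>
     G = X \<squnion> Y \<squnion> Z \<squnion> W \<and>
     (\<exists>x. verts X \<inter> verts Y = {x}) \<and> (\<exists>x. verts Y \<inter> verts Z = {x}) \<and>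
     (\<exists>x. verts Z \<inter> verts W = {x}) \<and> (\<exists>x. verts X \<inter> verts W = {x}) \<and>
     verts X \<inter> verts Z = {} \<and> verts Y \<inter> verts W = {}"
  unfolding cycle_graph_with_links_def graph_Union_simps
  by (simp add: All_less_Suc cyclically_adjacent_def Int_commute cong: conj_cong)
    (rule iffI; elim conjE; intro conjI; assumption)

text \<open>The links meet in a vertex without a name; this identifies it with the known end of the
  arc.\<close>

lemma Int_singletonI: "\<exists>x. A \<inter> B = {x} \<Longrightarrow> b \<in> A \<Longrightarrow> b \<in> B \<Longrightarrow> A \<inter> B = {b}"
  by (metis IntI singletonD)

lemma is_happy_face_iff:
  "is_happy_face G \<longleftrightarrow> (\<exists>a b c A1 A2 B1 B2 P. happy_segments a b c A1 A2 B1 B2 P \<and>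
     G = (A1 \<squnion> A2) \<squnion> P \<squnion> (B1 \<squnion> B2))" (is "?L \<longleftrightarrow> ?R")
proof
  assume ?L
  then obtain C1 C2 P a b c where C: "is_cycle C1" "is_cycle C2" "verts C1 \<inter> verts C2 = {a}"
    "is_path P b c" "b \<in> verts C1 - {a}" "c \<in> verts C2 - {a}" "cycle_graph_with_links G [C1, P, C2]"
    by (auto simp: is_happy_face_def)
  have a: "a \<in> verts C1" "a \<in> verts C2" using C by auto
  obtain A1 A2 where A: "parallel a b A1 A2" "C1 = A1 \<squnion> A2"
    using cycle_split[OF C(1) a(1), of b] C(5) by auto
  obtain B1 B2 where B: "parallel a c B1 B2" "C2 = B1 \<squnion> B2"
    using cycle_split[OF C(2) a(2), of c] C(6) by auto
  have L: "\<exists>x. verts C1 \<inter> verts P = {x}" "\<exists>x. verts P \<inter> verts C2 = {x}" "G = C1 \<squnion> P \<squnion> C2"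
    using C(7) unfolding links3 by simp_all
  have "verts C1 \<inter> verts P = {b}" "verts P \<inter> verts C2 = {c}"
    using Int_singletonI[OF L(1)] Int_singletonI[OF L(2)] C(5,6) is_path_ends[OF C(4)]
    unfolding Diff_iff by metis+
  then have "happy_segments a b c A1 A2 B1 B2 P" "G = (A1 \<squnion> A2) \<squnion> P \<squnion> (B1 \<squnion> B2)"
    unfolding happy_segments_def using A B C L(3) by auto
  then show ?R by blast
next
  assume ?R
  then obtain a b c A1 A2 B1 B2 P
    where H: "happy_segments a b c A1 A2 B1 B2 P" "G = (A1 \<squnion> A2) \<squnion> P \<squnion> (B1 \<squnion> B2)"
    by blast
  let ?A = "A1 \<squnion> A2" and ?B = "B1 \<squnion> B2"
  have h: "parallel a b A1 A2" "parallel a c B1 B2" "is_path P b c" "verts ?A \<inter> verts ?B = {a}"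
    "verts ?A \<inter> verts P = {b}" "verts P \<inter> verts ?B = {c}"
    using H(1) unfolding happy_segments_def by auto
  have m: "b \<in> verts ?A" "b \<in> verts P" "c \<in> verts P" "c \<in> verts ?B" "a \<noteq> b" "a \<noteq> c"
    using h(5,6) parallelD(1)[OF h(1)] parallelD(1)[OF h(2)] by auto
  have g: "is_graph ?A" "is_graph P" "is_graph ?B"
    using h is_path_is_graph parallel_is_graph by metis+
  have "connected_graph (?A \<squnion> P)"
    using connected_un parallel_connected[OF h(1)] connected_path[OF h(3)] g m by metis
  then have "connected_graph (?A \<squnion> P \<squnion> ?B)"
    using connected_un parallel_connected[OF h(2)] is_graph_un g m verts_un by (metis UnI2)
  then have "cycle_graph_with_links G [?A, P, ?B]"
    unfolding links3 using h g H(2) by blast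
  then show ?L
    unfolding is_happy_face_def using cycle_join[OF h(1)] cycle_join[OF h(2)] h m
    by (metis Diff_iff singletonD)
qed

lemma is_baguette_iff:
  "is_baguette G \<longleftrightarrow> (\<exists>b b' c c' A1 A2 B1 B2 P Q. baguette_segments b b' c c' A1 A2 B1 B2 P Q \<and>
     G = (A1 \<squnion> A2) \<squnion> P \<squnion> (B1 \<squnion> B2) \<squnion> Q)" (is "?L \<longleftrightarrow> ?R")
proof
  assume ?L
  then obtain C1 C2 P Q b c b' c' where C: "is_cycle C1" "is_cycle C2"
    "is_path P b c" "b \<in> verts C1" "c \<in> verts C2" "is_path Q b' c'" "b' \<in> verts C1" "c' \<in> verts C2"
    "cycle_graph_with_links G [C1, P, C2, Q]"
    by (auto simp: is_baguette_def)
  have L: "\<exists>x. verts C1 \<inter> verts P = {x}" "\<exists>x. verts P \<inter> verts C2 = {x}"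
    "\<exists>x. verts C2 \<inter> verts Q = {x}" "\<exists>x. verts C1 \<inter> verts Q = {x}"
    "verts C1 \<inter> verts C2 = {}" "verts P \<inter> verts Q = {}" "G = C1 \<squnion> P \<squnion> C2 \<squnion> Q"
    using C(9) unfolding links4 by simp_all
  have l: "verts C1 \<inter> verts P = {b}" "verts P \<inter> verts C2 = {c}" "verts C2 \<inter> verts Q = {c'}"
    "verts C1 \<inter> verts Q = {b'}"
    using L(1-4)[THEN Int_singletonI] C(4,5,7,8) is_path_ends[OF C(3)] is_path_ends[OF C(6)]
    by metis+
  \<comment> \<open>A common end of the two arcs would contradict their disjointness. Hence each
    circle can be cut at two vertices.\<close>
  with L(6) have n: "b \<noteq> b'" "c \<noteq> c'"
    by (metis Int_iff empty_iff insertI1)+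
  obtain A1 A2 where A: "parallel b b' A1 A2" "C1 = A1 \<squnion> A2"
    using cycle_split[OF C(1,4,7) n(1)] .
  obtain B1 B2 where B: "parallel c c' B1 B2" "C2 = B1 \<squnion> B2"
    using cycle_split[OF C(2,5,8) n(2)] .
  have "baguette_segments b b' c c' A1 A2 B1 B2 P Q"
    unfolding baguette_segments_def using A B C(3,6) l L(5,6) by simp
  then show ?R
    using L(7) A B by blast
next
  assume ?R
  then obtain b b' c c' A1 A2 B1 B2 P Q
    where H: "baguette_segments b b' c c' A1 A2 B1 B2 P Q"
      "G = (A1 \<squnion> A2) \<squnion> P \<squnion> (B1 \<squnion> B2) \<squnion> Q"
    by blast
  let ?A = "A1 \<squnion> A2" and ?B = "B1 \<squnion> B2"
  have h: "parallel b b' A1 A2" "parallel c c' B1 B2" "is_path P b c" "is_path Q b' c'"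
    "verts ?A \<inter> verts ?B = {}" "verts P \<inter> verts Q = {}" "verts ?A \<inter> verts P = {b}"
    "verts P \<inter> verts ?B = {c}" "verts ?B \<inter> verts Q = {c'}" "verts ?A \<inter> verts Q = {b'}"
    using H(1) unfolding baguette_segments_def by auto
  have m: "b \<in> verts ?A" "b \<in> verts P" "c \<in> verts P" "c \<in> verts ?B" "b' \<in> verts ?A" "b' \<in> verts Q"
    "c' \<in> verts ?B"
    using h(7-10) by auto
  have g: "is_graph ?A" "is_graph P" "is_graph ?B" "is_graph Q"
    using h is_path_is_graph parallel_is_graph by metis+
  have "connected_graph (?A \<squnion> P)"
    using connected_un parallel_connected[OF h(1)] connected_path[OF h(3)] g m by metis
  then have "connected_graph (?A \<squnion> P \<squnion> ?B)"
    using connected_un parallel_connected[OF h(2)] is_graph_un g m verts_un by (metis UnI2)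
  then have "connected_graph (?A \<squnion> P \<squnion> ?B \<squnion> Q)"
    using connected_un[OF _ connected_path[OF h(4)], of "?A \<squnion> P \<squnion> ?B" b'] is_graph_un g m by auto
  then have "cycle_graph_with_links G [?A, P, ?B, Q]"
    unfolding links4 using h g H(2) by blast
  then show ?L
    unfolding is_baguette_def using cycle_join[OF h(1)] cycle_join[OF h(2)] h m by blast
qed

section \<open>Finding basic 4-ac subgraphs\<close>

definition covered :: "'a ugraph \<Rightarrow> 'a set set \<Rightarrow> bool" where
  "covered G F \<longleftrightarrow> (\<exists>H. subgraph H G \<and> basic_4ac H \<and> F \<subseteq> edges H)"

lemma covered_cycle:
  assumes "is_graph G" "parallel a b P Q" "P \<sqsubseteq> G" "Q \<sqsubseteq> G" "F \<subseteq> edges P \<union> edges Q"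
  shows "covered G F"
  unfolding covered_def subgraph_iff basic_4ac_def
  using assms(1,3-) cycle_join[OF assms(2)] parallel_is_graph[OF assms(2)]
  by (intro exI[of _ "P \<squnion> Q"]) simp

lemma theta_is_graph: "theta_segments a b P Q R \<Longrightarrow> is_graph (P \<squnion> Q \<squnion> R)"
  unfolding theta_segments_def parallel_def
  by (elim conjE, intro is_graph_un; erule is_path_is_graph)

lemma covered_theta:
  assumes "is_graph G" "theta_segments a b P Q R" "P \<sqsubseteq> G" "Q \<sqsubseteq> G" "R \<sqsubseteq> G"
    "F \<subseteq> edges P \<union> edges Q \<union> edges R"
  shows "covered G F"
proof -
  have "is_theta (P \<squnion> Q \<squnion> R)"
    using assms(2) is_theta_iff by metis
  then show ?thesis
    unfolding covered_def subgraph_iff basic_4ac_def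
    using assms theta_is_graph by (intro exI[of _ "P \<squnion> Q \<squnion> R"]) simp
qed

lemma covered_happy:
  assumes "is_graph G" "happy_segments a b c A1 A2 B1 B2 P"
    "A1 \<sqsubseteq> G" "A2 \<sqsubseteq> G" "B1 \<sqsubseteq> G" "B2 \<sqsubseteq> G" "P \<sqsubseteq> G"
    "F \<subseteq> edges ((A1 \<squnion> A2) \<squnion> P \<squnion> (B1 \<squnion> B2))"
  shows "covered G F"
proof -
  let ?H = "(A1 \<squnion> A2) \<squnion> P \<squnion> (B1 \<squnion> B2)"
  have "is_happy_face ?H"
    using assms(2) is_happy_face_iff by blast
  moreover have "is_graph ?H"
    using assms(2) unfolding happy_segments_def parallel_def
    by (auto intro!: is_graph_un dest: is_path_is_graph)
  ultimately show ?thesis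
    unfolding covered_def subgraph_iff basic_4ac_def
    using assms by (intro exI[of _ ?H]) simp
qed

lemma covered_baguette:
  assumes "is_graph G" "baguette_segments b b' c c' A1 A2 B1 B2 P Q"
    "A1 \<sqsubseteq> G" "A2 \<sqsubseteq> G" "B1 \<sqsubseteq> G" "B2 \<sqsubseteq> G" "P \<sqsubseteq> G" "Q \<sqsubseteq> G"
    "F \<subseteq> edges ((A1 \<squnion> A2) \<squnion> P \<squnion> (B1 \<squnion> B2) \<squnion> Q)"
  shows "covered G F"
proof -
  let ?H = "(A1 \<squnion> A2) \<squnion> P \<squnion> (B1 \<squnion> B2) \<squnion> Q"
  have "is_baguette ?H"
    using assms(2) is_baguette_iff by blast
  moreover have "is_graph ?H"
    using assms(2) unfolding baguette_segments_def parallel_def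
    by (auto intro!: is_graph_un dest: is_path_is_graph)
  ultimately show ?thesis
    unfolding covered_def subgraph_iff basic_4ac_def
    using assms by (intro exI[of _ ?H]) simp
qed

section \<open>Theta curves with an ear attached to one path\<close>

lemma parallelI:
  assumes "a \<noteq> b" "is_path P a b" "is_path Q a b" "P \<noteq> Q" "verts P \<inter> verts Q \<subseteq> {a, b}"
  shows "parallel a b P Q"
proof -
  have "{a, b} \<subseteq> verts P \<inter> verts Q"
    using is_path_ends[OF assms(2)] is_path_ends[OF assms(3)] by simp
  then show ?thesis
    unfolding parallel_def using assms by (simp only: set_eq_subset simp_thms)
qed

lemma is_path_join':
  assumes "is_path P a b" "is_path Q b c" "verts P \<inter> verts Q \<subseteq> {b}"
  shows "is_path (P \<squnion> Q) a c"
proof -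
  have "verts P \<inter> verts Q = {b}"
    using assms(3) is_path_ends(2)[OF assms(1)] is_path_ends(1)[OF assms(2)] by blast
  then show ?thesis
    by (rule is_path_join[OF assms(1,2)])
qed

lemma neq_verts: "x \<in> verts P \<Longrightarrow> x \<notin> verts Q \<Longrightarrow> P \<noteq> Q"
  by auto

lemma Int_eq_singletonI: "A \<inter> B \<subseteq> {a} \<Longrightarrow> a \<in> A \<Longrightarrow> a \<in> B \<Longrightarrow> A \<inter> B = {a}"
  by blast

lemma parallel_subset: "parallel a b P Q \<Longrightarrow> verts P \<inter> verts Q \<subseteq> {a, b}"
  by (simp add: parallel_def)

lemma parallel_mem:
  assumes "parallel a b P Q"
  shows "a \<in> verts P" "b \<in> verts P" "a \<in> verts Q" "b \<in> verts Q"
  using assms is_path_ends unfolding parallel_def by metis+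

text \<open>One end of the ear is the branch vertex \<open>a\<close>. The ear closes a circle with
  \<open>P2\<close>, which meets the circle formed by \<open>Q\<close> and \<open>R\<close> in
  \<open>a\<close>, and the remainder \<open>P3\<close> is the arc between the circles.\<close>

lemma theta_ear_happy:
  assumes PQR: "parallel a b (P2 \<squnion> P3) Q" "parallel a b (P2 \<squnion> P3) R" "parallel a b Q R"
    and P: "is_path P2 a q" "is_path P3 q b" "verts P2 \<inter> verts P3 \<subseteq> {q}"
    and E: "is_path E a q" "E \<noteq> P2" "a \<noteq> q" "q \<noteq> b"
      "verts E \<inter> verts (P2 \<squnion> P3 \<squnion> Q \<squnion> R) \<subseteq> {a, q}"
  shows "happy_segments a q b P2 E Q R P3"
proof -
  note m = is_path_ends[OF P(1)] is_path_ends[OF P(2)] parallel_mem[OF PQR(3)]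
  have n: "a \<notin> verts P3" "b \<notin> verts P2"
    using m(1,4) P(3) E(3,4) by blast+
  have PQ: "verts (P2 \<squnion> P3) \<inter> verts Q \<subseteq> {a, b}" "verts (P2 \<squnion> P3) \<inter> verts R \<subseteq> {a, b}"
    using parallel_subset[OF PQR(1)] parallel_subset[OF PQR(2)] .
  then have nq: "q \<notin> verts Q" "q \<notin> verts R"
    using m(2) E(3,4) by auto
  have p2: "verts P2 \<inter> verts Q \<subseteq> {a}" "verts P2 \<inter> verts R \<subseteq> {a}"
    using PQ n(2) by auto
  have p3: "verts P3 \<inter> verts Q \<subseteq> {b}" "verts P3 \<inter> verts R \<subseteq> {b}"
    using PQ n(1) by auto
  have e: "verts E \<inter> verts Q \<subseteq> {a}" "verts E \<inter> verts R \<subseteq> {a}" "verts E \<inter> verts P3 \<subseteq> {q}"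
    "verts E \<inter> verts P2 \<subseteq> {a, q}"
    using E(5) nq n(1) by auto
  show ?thesis
    unfolding happy_segments_def
  proof (intro conjI)
    show "parallel a q P2 E"
      by (rule parallelI) (use P(1) E(1-3) e(4) in \<open>simp_all add: Int_commute\<close>)
    show "verts (P2 \<squnion> E) \<inter> verts (Q \<squnion> R) = {a}"
      by (rule Int_eq_singletonI) (use m e p2 in \<open>simp_all add: Int_Un_distrib Int_Un_distrib2\<close>)
    show "verts (P2 \<squnion> E) \<inter> verts P3 = {q}"
      by (rule Int_eq_singletonI) (use m e P(3) in \<open>simp_all add: Int_Un_distrib2\<close>)
    show "verts P3 \<inter> verts (Q \<squnion> R) = {b}"
      by (rule Int_eq_singletonI) (use m p3 in \<open>simp_all add: Int_Un_distrib\<close>)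
  qed (rule PQR P)+
qed

text \<open>Neither end of the ear is a branch vertex. The circle formed by \<open>P2\<close> and
  \<open>E\<close> is disjoint from the one formed by \<open>Q\<close> and \<open>R\<close>, and
  \<open>P1\<close> and \<open>P3\<close> are the two arcs between them.\<close>

lemma theta_ear_baguette:
  assumes PQR: "parallel a b (P1 \<squnion> P2 \<squnion> P3) Q" "parallel a b (P1 \<squnion> P2 \<squnion> P3) R" "parallel a b Q R"
    and P: "is_path P1 a p" "is_path P2 p q" "is_path P3 q b" "verts P1 \<inter> verts P2 \<subseteq> {p}"
      "verts P2 \<inter> verts P3 \<subseteq> {q}" "verts P1 \<inter> verts P3 \<subseteq> {}"
    and E: "is_path E p q" "E \<noteq> P2" "p \<noteq> q" "a \<noteq> p" "q \<noteq> b"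
      "verts E \<inter> verts (P1 \<squnion> P2 \<squnion> P3 \<squnion> Q \<squnion> R) \<subseteq> {p, q}"
  shows "baguette_segments p q a b P2 E Q R P1 P3"
proof -
  note m = is_path_ends[OF P(1)] is_path_ends[OF P(2)] is_path_ends[OF P(3)] parallel_mem[OF PQR(3)]
  have n: "a \<notin> verts P2" "b \<notin> verts P2"
    using m(1,6) P(4,5) E(4,5) by blast+
  have n13: "a \<notin> verts P3" "p \<notin> verts P3" "q \<notin> verts P1" "b \<notin> verts P1"
    using m(1,2,5,6) P(6) by blast+
  have PQ: "verts (P1 \<squnion> P2 \<squnion> P3) \<inter> verts Q \<subseteq> {a, b}" "verts (P1 \<squnion> P2 \<squnion> P3) \<inter> verts R \<subseteq> {a, b}"
    using parallel_subset[OF PQR(1)] parallel_subset[OF PQR(2)] .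
  have ab: "a \<noteq> q" "p \<noteq> b"
    using m n by auto
  have nq: "q \<notin> verts Q" "q \<notin> verts R" "p \<notin> verts Q" "p \<notin> verts R"
    using PQ m(3,4) E(4,5) ab by auto
  have p1: "verts P1 \<inter> verts Q \<subseteq> {a}" "verts P1 \<inter> verts R \<subseteq> {a}"
    using PQ n13(4) by auto
  have p2: "verts P2 \<inter> verts Q \<subseteq> {}" "verts P2 \<inter> verts R \<subseteq> {}"
    using PQ n by auto
  have p3: "verts P3 \<inter> verts Q \<subseteq> {b}" "verts P3 \<inter> verts R \<subseteq> {b}"
    using PQ n13(1) by auto
  have e: "verts E \<inter> verts Q \<subseteq> {}" "verts E \<inter> verts R \<subseteq> {}" "verts E \<inter> verts P3 \<subseteq> {q}"
    "verts E \<inter> verts P1 \<subseteq> {p}" "verts E \<inter> verts P2 \<subseteq> {p, q}"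
    using E(6) nq n13(2,3) by auto
  show ?thesis
    unfolding baguette_segments_def
  proof (intro conjI)
    show "parallel p q P2 E"
      by (rule parallelI) (use P(2) E(1-3) e(5) in \<open>simp_all add: Int_commute\<close>)
    show "verts (P2 \<squnion> E) \<inter> verts (Q \<squnion> R) = {}"
      using p2 e by (simp add: Int_Un_distrib Int_Un_distrib2)
    show "verts P1 \<inter> verts P3 = {}"
      using P(6) by simp
    show "verts (P2 \<squnion> E) \<inter> verts P1 = {p}"
      by (rule Int_eq_singletonI) (use m e P(4) in \<open>simp_all add: Int_Un_distrib Int_Un_distrib2 Int_commute\<close>)
    show "verts P1 \<inter> verts (Q \<squnion> R) = {a}"
      by (rule Int_eq_singletonI) (use m p1 in \<open>simp_all add: Int_Un_distrib\<close>)
    show "verts (Q \<squnion> R) \<inter> verts P3 = {b}"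
      by (rule Int_eq_singletonI) (use m p3 in \<open>simp_all add: Int_Un_distrib Int_Un_distrib2 Int_commute\<close>)
    show "verts (P2 \<squnion> E) \<inter> verts P3 = {q}"
      by (rule Int_eq_singletonI) (use m e P(5) in \<open>simp_all add: Int_Un_distrib2\<close>)
  qed (rule PQR P is_path_rev[OF P(1)])+
qed

text \<open>A subdivided \<open>K4\<close> with branch vertices \<open>a\<close>, \<open>b\<close>,
  \<open>p\<close>, \<open>q\<close>. The segments \<open>R\<close> and \<open>E\<close> are
  opposite to each other; the other four form the circle through \<open>a\<close>, \<open>p\<close>,
  \<open>b\<close>, \<open>q\<close>.\<close>

definition K4_segments where
  "K4_segments a b p q P1 P2 Q1 Q2 R E \<longleftrightarrow>
     distinct [a, b, p, q] \<and> is_path P1 a p \<and> is_path P2 p b \<and> is_path Q1 a q \<and> is_path Q2 q b \<and>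
     is_path R a b \<and> is_path E p q \<and>
     verts P1 \<inter> verts P2 \<subseteq> {p} \<and> verts Q1 \<inter> verts Q2 \<subseteq> {q} \<and>
     verts P1 \<inter> verts Q1 \<subseteq> {a} \<and> verts P2 \<inter> verts Q2 \<subseteq> {b} \<and>
     verts P1 \<inter> verts Q2 \<subseteq> {} \<and> verts P2 \<inter> verts Q1 \<subseteq> {} \<and>
     verts P1 \<inter> verts R \<subseteq> {a} \<and> verts Q1 \<inter> verts R \<subseteq> {a} \<and>
     verts P2 \<inter> verts R \<subseteq> {b} \<and> verts Q2 \<inter> verts R \<subseteq> {b} \<and>
     verts E \<inter> verts P1 \<subseteq> {p} \<and> verts E \<inter> verts P2 \<subseteq> {p} \<and>
     verts E \<inter> verts Q1 \<subseteq> {q} \<and> verts E \<inter> verts Q2 \<subseteq> {q} \<and> verts E \<inter> verts R \<subseteq> {}"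

lemma K4_segmentsD:
  assumes "K4_segments a b p q P1 P2 Q1 Q2 R E"
  shows "a \<noteq> b" "a \<noteq> p" "a \<noteq> q" "b \<noteq> p" "b \<noteq> q" "p \<noteq> q"
    "is_path P1 a p" "is_path P2 p b" "is_path Q1 a q" "is_path Q2 q b" "is_path R a b" "is_path E p q"
    "verts P1 \<inter> verts P2 \<subseteq> {p}" "verts Q1 \<inter> verts Q2 \<subseteq> {q}"
    "verts P1 \<inter> verts Q1 \<subseteq> {a}" "verts P2 \<inter> verts Q2 \<subseteq> {b}"
    "verts P1 \<inter> verts Q2 \<subseteq> {}" "verts P2 \<inter> verts Q1 \<subseteq> {}"
    "verts P1 \<inter> verts R \<subseteq> {a}" "verts Q1 \<inter> verts R \<subseteq> {a}"
    "verts P2 \<inter> verts R \<subseteq> {b}" "verts Q2 \<inter> verts R \<subseteq> {b}"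
    "verts E \<inter> verts P1 \<subseteq> {p}" "verts E \<inter> verts P2 \<subseteq> {p}"
    "verts E \<inter> verts Q1 \<subseteq> {q}" "verts E \<inter> verts Q2 \<subseteq> {q}" "verts E \<inter> verts R \<subseteq> {}"
  using assms unfolding K4_segments_def by simp_all

lemma K4_mem:
  assumes "K4_segments a b p q P1 P2 Q1 Q2 R E"
  shows "a \<in> verts P1" "p \<in> verts P1" "p \<in> verts P2" "b \<in> verts P2" "a \<in> verts Q1" "q \<in> verts Q1"
    "q \<in> verts Q2" "b \<in> verts Q2" "a \<in> verts R" "b \<in> verts R" "p \<in> verts E" "q \<in> verts E"
  using K4_segmentsD(7-12)[OF assms] by (auto dest: is_path_ends)

text \<open>Together with \<open>K4_swap_sides\<close> this symmetry carries \<open>P1\<close> to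
  each of the four segments of the circle, so that deleting \<open>P1\<close> is the only deletion
  to be examined.\<close>

lemma K4_swap_ends:
  "K4_segments a b p q P1 P2 Q1 Q2 R E \<Longrightarrow> K4_segments b a p q P2 P1 Q2 Q1 R E"
  unfolding K4_segments_def by (simp add: is_path_rev Int_commute eq_commute)

lemma K4_swap_sides:
  "K4_segments a b p q P1 P2 Q1 Q2 R E \<Longrightarrow> K4_segments a b q p Q1 Q2 P1 P2 R E"
  unfolding K4_segments_def by (simp add: is_path_rev Int_commute eq_commute)

lemma K4_intro:
  assumes par: "parallel a b (P1 \<squnion> P2) (Q1 \<squnion> Q2)" "parallel a b (P1 \<squnion> P2) R" "parallel a b (Q1 \<squnion> Q2) R"
    and P: "is_path P1 a p" "is_path P2 p b" "verts P1 \<inter> verts P2 = {p}" "p \<notin> {a, b}"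
    and Q: "is_path Q1 a q" "is_path Q2 q b" "verts Q1 \<inter> verts Q2 = {q}" "q \<notin> {a, b}"
    and E: "is_path E p q"
      "verts E \<inter> verts (P1 \<squnion> P2) \<subseteq> {p}" "verts E \<inter> verts (Q1 \<squnion> Q2) \<subseteq> {q}" "verts E \<inter> verts R \<subseteq> {}"
  shows "K4_segments a b p q P1 P2 Q1 Q2 R E"
proof -
  have PQ: "verts (P1 \<squnion> P2) \<inter> verts (Q1 \<squnion> Q2) \<subseteq> {a, b}"
    and PR: "verts (P1 \<squnion> P2) \<inter> verts R \<subseteq> {a, b}"
    and QR: "verts (Q1 \<squnion> Q2) \<inter> verts R \<subseteq> {a, b}"
    using par[THEN parallel_subset] .
  note m = is_path_ends[OF P(1)] is_path_ends[OF P(2)] is_path_ends[OF Q(1)] is_path_ends[OF Q(2)]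
  have P12: "verts P1 \<inter> verts P2 \<subseteq> {p}" and Q12: "verts Q1 \<inter> verts Q2 \<subseteq> {q}"
    using P(3) Q(3) by simp_all
  have n: "a \<notin> verts P2" "b \<notin> verts P1"
    using m(1,4) P(4) P12 by blast+
  have n': "a \<notin> verts Q2" "b \<notin> verts Q1"
    using m(5,8) Q(4) Q12 by blast+
  have "p \<noteq> q"
    using m(2,6) PQ P(4) by auto
  then have "distinct [a, b, p, q]"
    using P(4) Q(4) parallelD(1)[OF par(1)] by auto
  moreover have "verts P1 \<inter> verts Q1 \<subseteq> {a}" "verts P2 \<inter> verts Q2 \<subseteq> {b}"
     "verts P1 \<inter> verts Q2 \<subseteq> {}" "verts P2 \<inter> verts Q1 \<subseteq> {}"
    using PQ n n' by auto
  moreover have "verts P1 \<inter> verts R \<subseteq> {a}" "verts P2 \<inter> verts R \<subseteq> {b}"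
    using PR n by auto
  moreover have "verts Q1 \<inter> verts R \<subseteq> {a}" "verts Q2 \<inter> verts R \<subseteq> {b}"
    using QR n' by auto
  moreover have "verts E \<inter> verts P1 \<subseteq> {p}" "verts E \<inter> verts P2 \<subseteq> {p}"
    using E(2) by auto
  moreover have "verts E \<inter> verts Q1 \<subseteq> {q}" "verts E \<inter> verts Q2 \<subseteq> {q}"
    using E(3) by auto
  ultimately show ?thesis
    unfolding K4_segments_def using P(1,2) Q(1,2) E(1,4) P12 Q12 parallelD(3)[OF par(2)]
    by (intro conjI)
qed

text \<open>Without \<open>P1\<close> the vertices \<open>a\<close> and \<open>p\<close> have degree
  two. They become inner vertices of \<open>Q1 \<squnion> R\<close> and
  \<open>E \<squnion> P2\<close>, and \<open>q\<close> and \<open>b\<close> remain as branch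
  vertices.\<close>

lemma K4_theta:
  assumes "K4_segments a b p q P1 P2 Q1 Q2 R E"
  shows "theta_segments q b (E \<squnion> P2) Q2 (Q1 \<squnion> R)"
proof -
  note K = K4_segmentsD[OF assms] and m = K4_mem[OF assms]
  have paths: "is_path (E \<squnion> P2) q b" "is_path (Q1 \<squnion> R) q b"
    using is_path_join'[OF is_path_rev[OF K(12)] K(8)] is_path_join'[OF is_path_rev[OF K(9)] K(11)]
      K(24,20) by simp_all
  have n: "p \<notin> verts Q2" "p \<notin> verts Q1" "p \<notin> verts R" "a \<notin> verts Q2"
    using K(2,17,18,19) m(1-3) by blast+
  have "verts (E \<squnion> P2) \<inter> verts Q2 \<subseteq> {q, b}"
    using K(16,26) by auto
  moreover have "verts (E \<squnion> P2) \<inter> verts (Q1 \<squnion> R) \<subseteq> {q, b}"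
    using K(18,21,25,27) by auto
  moreover have "verts Q2 \<inter> verts (Q1 \<squnion> R) \<subseteq> {q, b}"
    using K(14,22) by auto
  moreover have "E \<squnion> P2 \<noteq> Q2" "E \<squnion> P2 \<noteq> Q1 \<squnion> R" "Q2 \<noteq> Q1 \<squnion> R"
    using n m(3,5) neq_verts[of p "E \<squnion> P2"] neq_verts[of a "Q1 \<squnion> R" Q2] by auto
  ultimately show ?thesis
    unfolding theta_segments_def using K(5,10) paths by (intro conjI parallelI) simp_all
qed

text \<open>Two subdivided \<open>K4\<close> graphs that differ only in \<open>R\<close> and
  \<open>S\<close> describe four parallel paths, two of them joined by \<open>E\<close>. Deleting
  \<open>P2\<close> leaves a circle through \<open>Q1\<close>, \<open>E\<close>, \<open>P1\<close>,
  a circle through \<open>R\<close>, \<open>S\<close>, and the arc \<open>Q2\<close>.\<close>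

lemma K4_happy:
  assumes R: "K4_segments a b p q P1 P2 Q1 Q2 R E" and S: "K4_segments a b p q P1 P2 Q1 Q2 S E"
    and RS: "parallel a b R S"
  shows "happy_segments a q b Q1 (P1 \<squnion> E) R S Q2"
proof -
  note K = K4_segmentsD[OF R] and L = K4_segmentsD[OF S] and m = K4_mem[OF R]
  have P: "is_path (P1 \<squnion> E) a q"
    using is_path_join'[OF K(7) K(12)] K(23) by blast
  have n: "a \<notin> verts Q2" "p \<notin> verts Q1" "b \<notin> verts Q1"
    using K(5,14,17,18) m(1,3,8) by blast+
  show ?thesis
    unfolding happy_segments_def
  proof (intro conjI)
    show "parallel a q Q1 (P1 \<squnion> E)"
    proof (rule parallelI)
      show "Q1 \<noteq> P1 \<squnion> E"
        using n(2) m(2) by auto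
      show "verts Q1 \<inter> verts (P1 \<squnion> E) \<subseteq> {a, q}"
        using K(15,25) by auto
    qed (use K P in simp_all)
    show "verts (Q1 \<squnion> (P1 \<squnion> E)) \<inter> verts (R \<squnion> S) = {a}"
      by (rule Int_eq_singletonI)
        (use m K(19,20,27) L(19,20,27) in \<open>simp_all add: Int_Un_distrib Int_Un_distrib2\<close>)
    show "verts (Q1 \<squnion> (P1 \<squnion> E)) \<inter> verts Q2 = {q}"
      by (rule Int_eq_singletonI) (use m K(14,17,26) in \<open>simp_all add: Int_Un_distrib2\<close>)
    show "verts Q2 \<inter> verts (R \<squnion> S) = {b}"
      by (rule Int_eq_singletonI) (use m K(22) L(22) in \<open>simp_all add: Int_Un_distrib\<close>)
  qed (rule RS K)+
qed

section \<open>Pigeonhole for edge-disjoint pieces\<close>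

lemma disjoint_hits_le_card:
  assumes "sorted_wrt (\<lambda>A B. A \<inter> B = {}) As" "\<And>A. A \<in> set As \<Longrightarrow> F \<inter> A \<noteq> {}" "finite F"
  shows "length As \<le> card F"
  using assms
proof (induction As arbitrary: F)
  case (Cons A As)
  then obtain f where f: "f \<in> F" "f \<in> A"
    by (meson disjoint_iff list.set_intros(1))
  have "length As \<le> card (F - {f})"
  proof (rule Cons.IH)
    show "(F - {f}) \<inter> B \<noteq> {}" if "B \<in> set As" for B
    proof -
      have "f \<notin> B"
        using Cons.prems(1) that f by auto
      then show ?thesis
        using Cons.prems(2)[of B] that by auto
    qed
  qed (use Cons.prems in auto)
  moreover have "card F = Suc (card (F - {f}))"
    using f Cons.prems(3) by (metis card.remove)
  ultimately show ?case
    by simp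
qed simp

text \<open>A list instead of a set of sets: disjointness of explicitly listed pieces unfolds by
  \<open>simp\<close>, and trivial paths, whose edge sets are all empty, are still counted
  separately.\<close>

lemma exists_unhit:
  assumes "sorted_wrt (\<lambda>A B. A \<inter> B = {}) As" "finite F" "card F < length As"
  obtains A where "A \<in> set As" "F \<inter> A = {}"
  using disjoint_hits_le_card[of As F] assms by fastforce

lemma path_edges_disjoint:
  "is_path P a b \<Longrightarrow> is_path Q c d \<Longrightarrow> verts P \<inter> verts Q \<subseteq> {x} \<Longrightarrow> edges P \<inter> edges Q = {}"
  using edges_disjoint_single is_path_is_graph by metis

lemma covered_K4_unhit:
  assumes G: "is_graph G" and K: "K4_segments a b p q P1 P2 Q1 Q2 R E"
    and le: "P2 \<sqsubseteq> G" "Q1 \<sqsubseteq> G" "Q2 \<sqsubseteq> G" "R \<sqsubseteq> G" "E \<sqsubseteq> G"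
    and F: "F \<subseteq> edges (P1 \<squnion> P2 \<squnion> Q1 \<squnion> Q2 \<squnion> R \<squnion> E)" "F \<inter> edges P1 = {}"
  shows "covered G F"
  by (rule covered_theta[OF G K4_theta[OF K]]) (use le F in auto)

lemma covered_K4:
  assumes G: "is_graph G" and K: "K4_segments a b p q P1 P2 Q1 Q2 R E"
    and le: "P1 \<sqsubseteq> G" "P2 \<sqsubseteq> G" "Q1 \<sqsubseteq> G" "Q2 \<sqsubseteq> G" "R \<sqsubseteq> G" "E \<sqsubseteq> G"
    and F: "F \<subseteq> edges (P1 \<squnion> P2 \<squnion> Q1 \<squnion> Q2 \<squnion> R \<squnion> E)" "card F = 4" "F \<inter> edges E \<noteq> {}"
  shows "covered G F"
proof -
  note k = K4_segmentsD[OF K]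
  have "verts P1 \<inter> verts Q2 \<subseteq> {a}" "verts P2 \<inter> verts Q1 \<subseteq> {a}"
    using k(17,18) by auto
  \<comment> \<open>Five segments are enough against four edges. Since \<open>E\<close> is hit, the
    unhit one lies on the circle, where the symmetries turn it into \<open>P1\<close>.\<close>
  then have "sorted_wrt (\<lambda>A B. A \<inter> B = {}) [edges E, edges P1, edges P2, edges Q1, edges Q2]"
    using path_edges_disjoint[OF k(12) k(7) k(23)] path_edges_disjoint[OF k(12) k(8) k(24)]
      path_edges_disjoint[OF k(12) k(9) k(25)] path_edges_disjoint[OF k(12) k(10) k(26)]
      path_edges_disjoint[OF k(7) k(8) k(13)] path_edges_disjoint[OF k(9) k(10) k(14)]
      path_edges_disjoint[OF k(7) k(9) k(15)] path_edges_disjoint[OF k(8) k(10) k(16)]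
      path_edges_disjoint[OF k(7) k(10)] path_edges_disjoint[OF k(8) k(9)]
    by simp
  moreover have "finite F"
    using F(2) by (metis card.infinite zero_neq_numeral)
  ultimately obtain A
    where A: "A \<in> set [edges E, edges P1, edges P2, edges Q1, edges Q2]" "F \<inter> A = {}"
    by (rule exists_unhit[of _ F]) (simp add: F(2))
  then consider "F \<inter> edges P1 = {}" | "F \<inter> edges P2 = {}" | "F \<inter> edges Q1 = {}" | "F \<inter> edges Q2 = {}"
    using F(3) by auto
  then show ?thesis
  proof cases
    case 1
    show ?thesis
      by (rule covered_K4_unhit[OF G K]) (use le F 1 in auto)
  next
    case 2
    show ?thesis
      by (rule covered_K4_unhit[OF G K4_swap_ends[OF K]]) (use le F 2 in auto)
  next
    case 3
    show ?thesis
      by (rule covered_K4_unhit[OF G K4_swap_sides[OF K]]) (use le F 3 in auto)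
  next
    case 4
    show ?thesis
      by (rule covered_K4_unhit[OF G K4_swap_ends[OF K4_swap_sides[OF K]]]) (use le F 4 in auto)
  qed
qed

text \<open>The graph-theoretic content of condition (2): if no such \<open>W\<close> existed,
  removing \<open>a\<close> and \<open>b\<close> would put the four paths into four different
  components.\<close>

definition linked :: "'a ugraph \<Rightarrow> bool" where
  "linked G \<longleftrightarrow> (\<forall>a b P.
     (\<forall>i<4. \<forall>j<4. i \<noteq> j \<longrightarrow> parallel a b (P i) (P j)) \<and> (\<forall>i<(4::nat). P i \<sqsubseteq> G) \<longrightarrow>
     (\<exists>i<4. \<exists>j<4. i \<noteq> j \<and> (\<exists>W u w. is_path W u w \<and> W \<sqsubseteq> G \<and> a \<notin> verts W \<and> b \<notin> verts W \<and>
        u \<in> verts (P i) \<and> w \<in> verts (P j))))"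

lemma other_indices:
  assumes "i < (4::nat)" "j < 4" "i \<noteq> j"
  obtains k l where "{..<4} = {i, j, k, l}" "distinct [i, j, k, l]"
proof -
  have "card ({..<4} - {i, j}) = 2"
    using assms by (simp add: card_Diff_subset)
  then obtain k l where kl: "{..<4} - {i, j} = {k, l}" "k \<noteq> l"
    by (meson card_2_iff)
  then have "k \<in> {..<4} - {i, j}" "l \<in> {..<4} - {i, j}"
    by auto
  moreover have "{..<4} = {i, j, k, l}"
    using kl(1) assms by auto
  ultimately show thesis
    using that kl assms(3) by auto
qed

lemma covered_theta4:
  assumes G: "is_graph G" "linked G"
    and P: "\<And>i j. i < 4 \<Longrightarrow> j < 4 \<Longrightarrow> i \<noteq> j \<Longrightarrow> parallel a b (P i) (P j)"
      "\<And>i. i < (4::nat) \<Longrightarrow> P i \<sqsubseteq> G"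
    and F: "F \<subseteq> (\<Union>i<4. edges (P i))" "card F = 4"
  shows "covered G F"
proof (cases "\<exists>i<4. F \<inter> edges (P i) = {}")
  case True
  then obtain i where i: "i < 4" "F \<inter> edges (P i) = {}" by blast
  obtain j :: nat where "j < 4" "i \<noteq> j"
    by (rule that[of "if i = 0 then 1 else 0"]) auto
  with i obtain k l where ijkl: "{..<4} = {i, j, k, l}" "distinct [i, j, k, l]"
    using other_indices by metis
  have lt: "j < 4" "k < 4" "l < 4"
    using ijkl(1) by (metis insertI1 insertI2 lessThan_iff)+
  have "theta_segments a b (P j) (P k) (P l)"
    unfolding theta_segments_def using P(1) lt ijkl(2) by simp
  then show ?thesis
    by (rule covered_theta[OF G(1)]) (use P(2) lt i F(1) ijkl(1) in \<open>auto\<close>)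
next
  case False
  obtain i j W u w where ij: "i < 4" "j < 4" "i \<noteq> j"
    and W: "is_path W u w" "W \<sqsubseteq> G" "a \<notin> verts W" "b \<notin> verts W" "u \<in> verts (P i)" "w \<in> verts (P j)"
  proof -
    have "(\<forall>i<4. \<forall>j<4. i \<noteq> j \<longrightarrow> parallel a b (P i) (P j)) \<and> (\<forall>i<4. P i \<sqsubseteq> G)"
      using P by blast
    from G(2)[unfolded linked_def, THEN spec, THEN spec, THEN spec, THEN mp, OF this] show thesis
      using that by blast
  qed
  \<comment> \<open>The link may run into a third path before it reaches \<open>P j\<close>;
    therefore it is stopped at the union of all the other paths.\<close>
  let ?Y = "\<Union>j\<in>{..<4} - {i}. verts (P j)"
  have "verts (P i) \<inter> ?Y \<subseteq> {a, b}"
    using parallel_subset[OF P(1)] ij(1) by blast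
  then have "verts W \<inter> verts (P i) \<inter> ?Y = {}"
    using W(3,4) by blast
  moreover have "w \<in> ?Y"
    using ij W(6) by auto
  ultimately obtain E p q where E: "is_path E p q" "verts E \<inter> verts (P i) = {p}"
    "verts E \<inter> ?Y = {q}" "E \<sqsubseteq> W"
    using is_path_link[OF W(1,5)] by metis
  have ab: "a \<notin> verts E" "b \<notin> verts E" "E \<sqsubseteq> G"
    using W E(4) by (auto simp: graph_le_def)
  have pq: "p \<in> verts (P i)" "p \<notin> {a, b}" "q \<notin> {a, b}"
    using E(2) ab is_path_ends[OF E(1)] by auto
  have "q \<in> ?Y"
    using E(3) by blast
  \<comment> \<open>From here on \<open>j\<close> is the path on which the shortened link really
    ends, possibly not the one reached by \<open>W\<close>.\<close>
  then obtain j where j: "j < 4" "i \<noteq> j" "q \<in> verts (P j)"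
    by blast
  obtain k l where ijkl: "{..<4} = {i, j, k, l}" "distinct [i, j, k, l]"
    using other_indices[OF ij(1) j(1,2)] .
  have lt: "i < 4" "j < 4" "k < 4" "l < 4"
    using ijkl(1) by (metis insertI1 insertI2 lessThan_iff)+
  have par: "parallel a b (P i) (P j)" "parallel a b (P i) (P k)" "parallel a b (P j) (P k)"
    "parallel a b (P i) (P l)" "parallel a b (P j) (P l)" "parallel a b (P k) (P l)"
    using P(1) lt ijkl(2) by auto
  obtain P1 P2 where P12: "is_path P1 a p" "is_path P2 p b" "P i = P1 \<squnion> P2" "verts P1 \<inter> verts P2 = {p}"
    using is_path_split[OF parallelD(2)[OF par(1)] pq(1)] .
  obtain Q1 Q2 where Q12: "is_path Q1 a q" "is_path Q2 q b" "P j = Q1 \<squnion> Q2" "verts Q1 \<inter> verts Q2 = {q}"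
    using is_path_split[OF parallelD(3)[OF par(1)] j(3)] .
  have Eq: "verts E \<inter> verts (P n) \<subseteq> {q}" if "n < 4" "n \<noteq> i" for n
    using E(3) that by blast
  have Ek: "verts E \<inter> verts (P n) \<subseteq> {}" if "n < 4" "n \<noteq> i" "n \<noteq> j" for n
  proof -
    have "q \<notin> verts (P n)"
      using parallel_subset[OF P(1)[OF that(1) j(1) that(3)]] j(3) pq(3) by blast
    then show ?thesis
      using Eq[OF that(1,2)] by blast
  qed
  \<comment> \<open>Each of the two remaining paths can serve as the segment \<open>R\<close>;
    \<open>K4_happy\<close> combines both choices.\<close>
  have K: "K4_segments a b p q P1 P2 Q1 Q2 (P n) E" if "n \<in> {k, l}" for n
  proof (rule K4_intro[OF _ _ _ P12(1,2,4) pq(2) Q12(1,2,4) pq(3) E(1)])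
    show "parallel a b (P1 \<squnion> P2) (Q1 \<squnion> Q2)" "parallel a b (P1 \<squnion> P2) (P n)" "parallel a b (Q1 \<squnion> Q2) (P n)"
      using par that unfolding P12(3) Q12(3) by auto
    show "verts E \<inter> verts (P1 \<squnion> P2) \<subseteq> {p}"
      using E(2) P12(3) by simp
    show "verts E \<inter> verts (Q1 \<squnion> Q2) \<subseteq> {q}"
      using Eq[OF j(1)] j(2) Q12(3) by simp
    show "verts E \<inter> verts (P n) \<subseteq> {}"
      using that Ek lt ijkl(2) by auto
  qed
  have "edges P1 \<inter> edges P2 = {}"
    using path_edges_disjoint[OF P12(1,2)] P12(4) by blast
  \<comment> \<open>\<open>P i\<close> counts twice, by its halves. Since each of the four whole
    paths is hit, the piece missed by \<open>F\<close> is one of these halves.\<close>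
  then have "sorted_wrt (\<lambda>A B. A \<inter> B = {}) [edges P1, edges P2, edges (P j), edges (P k), edges (P l)]"
    using par[THEN parallel_edges] P12(3) by (auto simp: Int_Un_distrib2)
  moreover have "finite F"
    using F(2) by (metis card.infinite zero_neq_numeral)
  ultimately obtain A where "A \<in> set [edges P1, edges P2, edges (P j), edges (P k), edges (P l)]" "F \<inter> A = {}"
    by (rule exists_unhit[of _ F]) (simp add: F(2))
  then consider "F \<inter> edges P1 = {}" | "F \<inter> edges P2 = {}"
    using False lt by auto
  moreover have F': "F \<subseteq> edges P1 \<union> edges P2 \<union> edges Q1 \<union> edges Q2 \<union> edges (P k) \<union> edges (P l)"
    using F(1) P12(3) Q12(3) ijkl(1) by auto
  have le: "P1 \<sqsubseteq> G" "P2 \<sqsubseteq> G" "Q1 \<sqsubseteq> G" "Q2 \<sqsubseteq> G" "P k \<sqsubseteq> G" "P l \<sqsubseteq> G"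
    using P(2)[OF lt(1)] P(2)[OF lt(2)] P(2) lt P12(3) Q12(3) by auto
  ultimately show ?thesis
  proof cases
    case 1
    have "happy_segments b q a Q2 (P2 \<squnion> E) (P k) (P l) Q1"
      by (rule K4_happy[OF K4_swap_ends[OF K] K4_swap_ends[OF K] parallel_rev[OF par(6)]]) simp_all
    then show ?thesis
      by (rule covered_happy[OF G(1)]) (use le F' ab 1 in auto)
  next
    case 2
    have "happy_segments a q b Q1 (P1 \<squnion> E) (P k) (P l) Q2"
      by (rule K4_happy[OF K K par(6)]) simp_all
    then show ?thesis
      by (rule covered_happy[OF G(1)]) (use le F' ab 2 in auto)
  qed
qed

text \<open>The ends of the ear cut the first path into three pieces, of which \<open>P1\<close> and
  \<open>P3\<close> may be single vertices. What arises depends on how many ends are branch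
  vertices: four parallel paths for two, a happy-face curve for one, a baguette curve for
  none.\<close>

lemma covered_theta_ear_ordered:
  assumes G: "is_graph G" "linked G"
    and T: "theta_segments a b (P1 \<squnion> P2 \<squnion> P3) Q R"
    and P: "is_path P1 a p" "is_path P2 p q" "is_path P3 q b" "verts P1 \<inter> verts P2 \<subseteq> {p}"
      "verts P2 \<inter> verts P3 \<subseteq> {q}" "verts P1 \<inter> verts P3 \<subseteq> {}" "p \<noteq> q"
    and E: "is_path E p q" "E \<sqsubseteq> G" "verts E \<inter> verts (P1 \<squnion> P2 \<squnion> P3 \<squnion> Q \<squnion> R) \<subseteq> {p, q}"
    and e: "e \<in> edges E" "e \<notin> edges (P1 \<squnion> P2 \<squnion> P3 \<squnion> Q \<squnion> R)"
    and le: "P1 \<squnion> P2 \<squnion> P3 \<sqsubseteq> G" "Q \<sqsubseteq> G" "R \<sqsubseteq> G"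
    and F: "F \<subseteq> edges (P1 \<squnion> P2 \<squnion> P3 \<squnion> Q \<squnion> R \<squnion> E)" "card F = 4"
  shows "covered G F"
proof -
  let ?P = "P1 \<squnion> P2 \<squnion> P3"
  have par: "parallel a b ?P Q" "parallel a b ?P R" "parallel a b Q R"
    using T by (simp_all add: theta_segments_def)
  \<comment> \<open>The edge \<open>e\<close> outside the theta curve keeps the ear distinct from
    every old path, as \<open>parallel\<close> demands.\<close>
  have ne: "E \<noteq> P2" "E \<noteq> ?P" "E \<noteq> Q" "E \<noteq> R"
    using e by auto
  have P1: "?P = P2 \<squnion> P3" "edges P1 = {}" if "p = a"
    using is_path_same[of P1 a] P(1) is_path_ends(1)[OF P(2)] that by (auto intro!: graph_eqI)
  have P3: "?P = P2 \<squnion> P1" "edges P3 = {}" if "q = b"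
    using is_path_same[of P3 b] P(3) is_path_ends(2)[OF P(2)] that by (auto intro!: graph_eqI)
  consider "p = a" "q = b" | "p = a" "q \<noteq> b" | "p \<noteq> a" "q = b" | "p \<noteq> a" "q \<noteq> b"
    by blast
  then show ?thesis
  proof cases
    case 1
    let ?Ps = "\<lambda>i. [?P, Q, R, E] ! i"
    have "parallel a b E ?P" "parallel a b E Q" "parallel a b E R"
      using E 1 ne par by (auto intro!: parallelI dest: parallelD(1-3))
    note this = this this[THEN parallel_commute]
    then have "parallel a b (?Ps i) (?Ps j)" if "i < 4" "j < 4" "i \<noteq> j" for i j
      using that par par[THEN parallel_commute] by (auto simp: numeral_eq_Suc less_Suc_eq)
    moreover have "?Ps i \<sqsubseteq> G" if "i < 4" for i
      using that le E(2) by (auto simp: numeral_eq_Suc less_Suc_eq)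
    moreover have "F \<subseteq> (\<Union>i<4. edges (?Ps i))"
      using F(1) by (simp add: numeral_eq_Suc lessThan_Suc Un_ac)
    ultimately show ?thesis
      using covered_theta4[OF G, of a b ?Ps F] F(2) by blast
  next
    case 2
    have "happy_segments a q b P2 E Q R P3"
      by (rule theta_ear_happy) (use par P E ne 2 P1 in auto)
    then show ?thesis
      by (rule covered_happy[OF G(1)]) (use le E F P1 2 in auto)
  next
    case 3
    have "happy_segments b p a P2 E Q R P1"
      by (rule theta_ear_happy) (use par[THEN parallel_rev] P E ne 3 P3 is_path_rev in auto)
    then show ?thesis
      by (rule covered_happy[OF G(1)]) (use le E F P3 3 in auto)
  next
    case 4
    have "baguette_segments p q a b P2 E Q R P1 P3"
      by (rule theta_ear_baguette) (use par P E ne 4 in auto)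
    then show ?thesis
      by (rule covered_baguette[OF G(1)]) (use le E F in auto)
  qed
qed

section \<open>Ears in arbitrary position on a theta curve\<close>

lemma theta_segments_sym:
  assumes "theta_segments a b P Q R"
  shows "theta_segments a b Q P R" "theta_segments a b P R Q"
  using assms parallel_commute by (auto simp: theta_segments_def)

text \<open>Cutting \<open>P\<close> at \<open>p\<close> shows on which side \<open>q\<close> lies.
  This orders the ends along \<open>P\<close>; if \<open>q\<close> comes first, the ear is
  reversed.\<close>

lemma covered_theta_ear_same:
  assumes G: "is_graph G" "linked G"
    and T: "theta_segments a b P Q R" "P \<squnion> Q \<squnion> R \<sqsubseteq> G"
    and pq: "p \<in> verts P" "q \<in> verts P"
    and E: "ear G (P \<squnion> Q \<squnion> R) E p q" "e \<in> edges E" "e \<notin> edges (P \<squnion> Q \<squnion> R)"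
    and F: "F \<subseteq> edges (P \<squnion> Q \<squnion> R \<squnion> E)" "card F = 4"
  shows "covered G F"
proof -
  have ear: "p \<noteq> q" "is_path E p q" "E \<sqsubseteq> G" "verts E \<inter> verts (P \<squnion> Q \<squnion> R) \<subseteq> {p, q}"
    using E(1) by (auto simp: ear_def)
  have P: "is_path P a b"
    using T(1) parallelD(2) by (auto simp: theta_segments_def)
  obtain A B where AB: "is_path A a p" "is_path B p b" "P = A \<squnion> B" "verts A \<inter> verts B = {p}"
    using is_path_split[OF P pq(1)] .
  note m = is_path_ends[OF AB(1)] is_path_ends[OF AB(2)]
  consider "q \<in> verts A" | "q \<in> verts B"
    using pq(2) AB(3) by auto
  then show ?thesis
  proof cases
    case 1
    obtain A1 A2 where A: "is_path A1 a q" "is_path A2 q p" "A = A1 \<squnion> A2" "verts A1 \<inter> verts A2 = {q}"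
      using is_path_split[OF AB(1) 1] .
    have "p \<notin> verts A1"
      using A(4) is_path_ends(2)[OF A(2)] ear(1) by (metis IntI singletonD)
    then have i: "verts A1 \<inter> verts A2 \<subseteq> {q}" "verts A2 \<inter> verts B \<subseteq> {p}" "verts A1 \<inter> verts B \<subseteq> {}"
      using A(3,4) AB(4) by auto
    have eq: "P = A1 \<squnion> A2 \<squnion> B"
      using A(3) AB(3) by simp
    show ?thesis
      by (rule covered_theta_ear_ordered[OF G T(1)[unfolded eq] A(1,2) AB(2) i ear(1)[symmetric]
            is_path_rev[OF ear(2)] ear(3) _ E(2) E(3)[unfolded eq] _ _ _ F(1)[unfolded eq] F(2)])
        (use ear(4) T(2) eq in \<open>auto simp: insert_commute\<close>)
  next
    case 2
    obtain B1 B2 where B: "is_path B1 p q" "is_path B2 q b" "B = B1 \<squnion> B2" "verts B1 \<inter> verts B2 = {q}"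
      using is_path_split[OF AB(2) 2] .
    have "p \<notin> verts B2"
      using B(4) is_path_ends(1)[OF B(1)] ear(1) by (metis IntI singletonD)
    then have i: "verts A \<inter> verts B1 \<subseteq> {p}" "verts B1 \<inter> verts B2 \<subseteq> {q}" "verts A \<inter> verts B2 \<subseteq> {}"
      using B(3,4) AB(4) by auto
    have eq: "P = A \<squnion> B1 \<squnion> B2"
      using B(3) AB(3) by (simp add: graph_un_def Un_assoc)
    show ?thesis
      by (rule covered_theta_ear_ordered[OF G T(1)[unfolded eq] AB(1) B(1,2) i ear(1)
            ear(2) ear(3) _ E(2) E(3)[unfolded eq] _ _ _ F(1)[unfolded eq] F(2)])
        (use ear(4) T(2) eq in auto)
  qed
qed

text \<open>Since \<open>a\<close> and \<open>b\<close> lie on both \<open>P\<close> and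
  \<open>Q\<close>, the hypotheses make \<open>p\<close> and \<open>q\<close> inner vertices of
  different paths; these are the four branch vertices of a subdivided \<open>K4\<close>.\<close>

lemma covered_theta_ear_diff:
  assumes G: "is_graph G"
    and T: "theta_segments a b P Q R" "P \<squnion> Q \<squnion> R \<sqsubseteq> G"
    and pq: "p \<in> verts P" "p \<notin> verts Q" "q \<in> verts Q" "q \<notin> verts P"
    and E: "ear G (P \<squnion> Q \<squnion> R) E p q" "e \<in> F" "e \<in> edges E"
    and F: "F \<subseteq> edges (P \<squnion> Q \<squnion> R \<squnion> E)" "card F = 4"
  shows "covered G F"
proof -
  have ear: "p \<noteq> q" "is_path E p q" "E \<sqsubseteq> G" "verts E \<inter> verts (P \<squnion> Q \<squnion> R) \<subseteq> {p, q}"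
    using E(1) by (auto simp: ear_def)
  have par: "parallel a b P Q" "parallel a b P R" "parallel a b Q R"
    using T(1) by (auto simp: theta_segments_def)
  have n: "p \<notin> {a, b}" "q \<notin> {a, b}"
    using pq parallel_mem[OF par(1)] by auto
  then have R: "p \<notin> verts R" "q \<notin> verts R"
    using parallel_subset[OF par(2)] parallel_subset[OF par(3)] pq by auto
  obtain P1 P2 where P12: "is_path P1 a p" "is_path P2 p b" "P = P1 \<squnion> P2" "verts P1 \<inter> verts P2 = {p}"
    using is_path_split[OF parallelD(2)[OF par(1)] pq(1)] .
  obtain Q1 Q2 where Q12: "is_path Q1 a q" "is_path Q2 q b" "Q = Q1 \<squnion> Q2" "verts Q1 \<inter> verts Q2 = {q}"
    using is_path_split[OF parallelD(3)[OF par(1)] pq(3)] .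
  have Ei: "verts E \<inter> verts P \<subseteq> {p}" "verts E \<inter> verts Q \<subseteq> {q}" "verts E \<inter> verts R \<subseteq> {}"
    using ear(4) R pq by auto
  have "K4_segments a b p q P1 P2 Q1 Q2 R E"
    by (rule K4_intro[OF par[unfolded P12(3) Q12(3)] P12(1,2,4) n(1) Q12(1,2,4) n(2) ear(2)
      Ei[unfolded P12(3) Q12(3)]])
  then show ?thesis
    by (rule covered_K4[OF G]) (use T(2) ear(3) F E(2,3) P12(3) Q12(3) in auto)
qed

lemma covered_theta_ear:
  assumes G: "is_graph G" "linked G"
    and T: "theta_segments a b P Q R" "P \<squnion> Q \<squnion> R \<sqsubseteq> G"
    and E: "ear G (P \<squnion> Q \<squnion> R) E p q" "e \<in> F" "e \<in> edges E" "e \<notin> edges (P \<squnion> Q \<squnion> R)"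
    and F: "F \<subseteq> edges (P \<squnion> Q \<squnion> R \<squnion> E)" "card F = 4"
  shows "covered G F"
proof -
  have perm: "P \<squnion> Q \<squnion> R = Q \<squnion> P \<squnion> R" "P \<squnion> Q \<squnion> R = R \<squnion> P \<squnion> Q" "P \<squnion> Q \<squnion> R = P \<squnion> R \<squnion> Q"
    "P \<squnion> Q \<squnion> R = R \<squnion> Q \<squnion> P" "P \<squnion> Q \<squnion> R = Q \<squnion> R \<squnion> P"
    by (simp_all add: graph_un_def Un_ac)
  note S = theta_segments_sym(1)[OF T(1)] theta_segments_sym(1)[OF theta_segments_sym(2)[OF T(1)]]
    theta_segments_sym(2)[OF T(1)]
  note S' = S(1)[THEN theta_segments_sym(2)] S(2)[THEN theta_segments_sym(2)]
  note E' = ear_rev[OF E(1)]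
  note same = covered_theta_ear_same[OF G] and diff = covered_theta_ear_diff[OF G(1)]
  have pq: "p \<in> verts P \<union> verts Q \<union> verts R" "q \<in> verts P \<union> verts Q \<union> verts R"
    using E(1) by (auto simp: ear_def)
  \<comment> \<open>Either some path contains both ends, as happens whenever one end is a branch
    vertex, or the ends are inner vertices of two different paths, in one of six ordered
    ways.\<close>
  then consider "p \<in> verts P" "q \<in> verts P" | "p \<in> verts Q" "q \<in> verts Q" | "p \<in> verts R" "q \<in> verts R"
    | "p \<in> verts P" "p \<notin> verts Q" "q \<in> verts Q" "q \<notin> verts P"
    | "q \<in> verts P" "q \<notin> verts Q" "p \<in> verts Q" "p \<notin> verts P"
    | "p \<in> verts P" "p \<notin> verts R" "q \<in> verts R" "q \<notin> verts P"
    | "q \<in> verts P" "q \<notin> verts R" "p \<in> verts R" "p \<notin> verts P"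
    | "p \<in> verts Q" "p \<notin> verts R" "q \<in> verts R" "q \<notin> verts Q"
    | "q \<in> verts Q" "q \<notin> verts R" "p \<in> verts R" "p \<notin> verts Q"
    by blast
  then show ?thesis
  proof cases
    case 1
    show ?thesis using same[OF T 1 E(1,3,4) F] .
  next
    case 2
    show ?thesis
      using same[OF S(1) T(2)[unfolded perm(1)] 2 E(1)[unfolded perm(1)] E(3) E(4)[unfolded perm(1)]
          F(1)[unfolded perm(1)] F(2)] .
  next
    case 3
    show ?thesis
      using same[OF S(2) T(2)[unfolded perm(2)] 3 E(1)[unfolded perm(2)] E(3) E(4)[unfolded perm(2)]
          F(1)[unfolded perm(2)] F(2)] .
  next
    case 4
    show ?thesis using diff[OF T 4 E(1-3) F] .
  next
    case 5
    show ?thesis using diff[OF T 5 E' E(2,3) F] .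
  next
    case 6
    show ?thesis
      using diff[OF S(3) T(2)[unfolded perm(3)] 6 E(1)[unfolded perm(3)] E(2,3) F(1)[unfolded perm(3)] F(2)] .
  next
    case 7
    show ?thesis
      using diff[OF S(3) T(2)[unfolded perm(3)] 7 E'[unfolded perm(3)] E(2,3) F(1)[unfolded perm(3)] F(2)] .
  next
    case 8
    show ?thesis
      using diff[OF S'(1) T(2)[unfolded perm(5)] 8 E(1)[unfolded perm(5)] E(2,3) F(1)[unfolded perm(5)] F(2)] .
  next
    case 9
    show ?thesis
      using diff[OF S'(1) T(2)[unfolded perm(5)] 9 E'[unfolded perm(5)] E(2,3) F(1)[unfolded perm(5)] F(2)] .
  qed
qed

section \<open>Cycles and theta curves through given edges\<close>

lemma theta_through_edge:
  assumes G: "is_graph G" "cyclically_connected G"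
    and C: "parallel a b A B" "A \<squnion> B \<sqsubseteq> G"
    and e: "e \<in> edges G" "e \<notin> edges (A \<squnion> B)"
  obtains p q P Q E where "theta_segments p q P Q E" "P \<squnion> Q = A \<squnion> B" "E \<sqsubseteq> G" "e \<in> edges E"
proof -
  have "a \<in> verts (A \<squnion> B)" "b \<in> verts (A \<squnion> B)"
    using parallel_mem[OF C(1)] by auto
  from ear_exists[OF G(2,1) C(2) this parallelD(1)[OF C(1)] e(1)]
  obtain E p q where E: "ear G (A \<squnion> B) E p q" "e \<in> edges E" .
  have ear: "p \<noteq> q" "is_path E p q" "E \<sqsubseteq> G" "verts E \<inter> verts (A \<squnion> B) = {p, q}"
    using E(1) by (auto simp: ear_def)
  then have "p \<in> verts (A \<squnion> B)" "q \<in> verts (A \<squnion> B)"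
    by blast+
  \<comment> \<open>The cycle is cut anew at the ends of the ear, so \<open>P\<close> and
    \<open>Q\<close> are in general not \<open>A\<close> and \<open>B\<close>.\<close>
  from cycle_split[OF cycle_join[OF C(1)] this ear(1)] obtain P Q where PQ: "parallel p q P Q" "A \<squnion> B = P \<squnion> Q" .
  have "parallel p q P E" "parallel p q Q E"
    using parallelI[OF ear(1) parallelD(2)[OF PQ(1)] ear(2)] parallelI[OF ear(1) parallelD(3)[OF PQ(1)] ear(2)]
      e(2) E(2) ear(4) PQ(2) by auto
  then have "theta_segments p q P Q E"
    using PQ(1) by (simp add: theta_segments_def)
  then show thesis
    using that PQ(2) ear(3) E(2) by metis
qed

text \<open>A cycle through both ends of \<open>e\<close> offers two different paths between them.
  At least one is not \<open>e\<close> itself, and \<open>e\<close> closes it to a cycle.\<close>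

lemma cycle_through_edge:
  assumes "is_graph G" "cyclically_connected G" "e \<in> edges G"
  obtains a b A B where "parallel a b A B" "A \<squnion> B \<sqsubseteq> G" "e \<in> edges (A \<squnion> B)"
proof -
  obtain x y where xy: "e = {x, y}" "x \<noteq> y" "x \<in> verts G" "y \<in> verts G"
    using edge_cases assms(1,3) by metis
  let ?E = "path_graph [x, y]"
  obtain P Q where PQ: "parallel x y P Q" "P \<sqsubseteq> G" "Q \<sqsubseteq> G"
    using cyclically_connected_cycle[OF assms(2) xy(3,4,2)] .
  then obtain R where R: "is_path R x y" "R \<sqsubseteq> G" "?E \<noteq> R"
    unfolding parallel_def by metis
  have "parallel x y ?E R"
    by (rule parallelI[OF xy(2) is_path_edge[OF xy(2)] R(1,3)]) auto
  moreover have "?E \<squnion> R \<sqsubseteq> G"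
    using R(2) edge_path_le assms(1,3) xy(1) by auto
  ultimately show thesis
    using that xy(1) by auto
qed

lemma cycle_through_two_edges:
  assumes G: "is_graph G" "cyclically_connected G" and e: "e \<in> edges G" "f \<in> edges G"
  obtains a b A B where "parallel a b A B" "A \<squnion> B \<sqsubseteq> G" "{e, f} \<subseteq> edges (A \<squnion> B)"
proof -
  obtain a b A B where C: "parallel a b A B" "A \<squnion> B \<sqsubseteq> G" "e \<in> edges (A \<squnion> B)"
    using cycle_through_edge[OF G e(1)] .
  show thesis
  proof (cases "f \<in> edges (A \<squnion> B)")
    case False
    obtain p q P Q E where T: "theta_segments p q P Q E" "P \<squnion> Q = A \<squnion> B" "E \<sqsubseteq> G" "f \<in> edges E"
      using theta_through_edge[OF G C(1,2) e(2) False] .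
    \<comment> \<open>The edge \<open>e\<close> stays on \<open>P\<close> or on \<open>Q\<close>,
      and either of them forms a cycle with the ear carrying \<open>f\<close>.\<close>
    then have "e \<in> edges P \<union> edges Q" "P \<sqsubseteq> G" "Q \<sqsubseteq> G"
      using C(2,3) by (metis edges_un, metis graph_un_le_iff, metis graph_un_le_iff)
    then show thesis
      using that[of p q P E] that[of p q Q E] T(1,3,4) by (auto simp: theta_segments_def)
  qed (use that C in auto)
qed

lemma four_edges_covered:
  assumes G: "is_graph G" "cyclically_connected G" "linked G" and F: "F \<subseteq> edges G" "card F = 4"
  shows "covered G F"
proof -
  obtain e1 e2 e3 e4 where e: "F = {e1, e2, e3, e4}"
    using F(2) by (auto simp: eval_nat_numeral card_Suc_eq)
  then have eG: "e1 \<in> edges G" "e2 \<in> edges G" "e3 \<in> edges G" "e4 \<in> edges G"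
    using F(1) by auto
  obtain a b A B where C: "parallel a b A B" "A \<squnion> B \<sqsubseteq> G" "{e1, e2} \<subseteq> edges (A \<squnion> B)"
    using cycle_through_two_edges[OF G(1,2) eG(1,2)] .
  \<comment> \<open>Here \<open>f\<close> is whichever of \<open>e3\<close>, \<open>e4\<close> lies
    off the first cycle; the other one, \<open>g\<close>, may or may not already lie on the theta
    curve.\<close>
  have theta: "covered G F"
    if fg: "f \<in> edges G" "g \<in> edges G" "f \<notin> edges (A \<squnion> B)" "F = {e1, e2, f, g}" for f g
  proof -
    obtain p q P Q R where T: "theta_segments p q P Q R" "P \<squnion> Q = A \<squnion> B" "R \<sqsubseteq> G" "f \<in> edges R"
      using theta_through_edge[OF G(1,2) C(1,2) fg(1,3)] .
    have le: "P \<squnion> Q \<squnion> R \<sqsubseteq> G"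
      using C(2) T(3) unfolding T(2)[symmetric] by simp
    have sub: "{e1, e2, f} \<subseteq> edges (P \<squnion> Q \<squnion> R)"
      using C(3) T(4) unfolding T(2)[symmetric] by simp
    show ?thesis
    proof (cases "g \<in> edges (P \<squnion> Q \<squnion> R)")
      case True
      show ?thesis
        by (rule covered_theta[OF G(1) T(1)]) (use le sub True fg(4) in auto)
    next
      case False
      have "p \<in> verts (P \<squnion> Q \<squnion> R)" "q \<in> verts (P \<squnion> Q \<squnion> R)" "p \<noteq> q"
        using T(1) parallel_mem(1,2)[of p q P Q] parallelD(1)[of p q P Q] by (auto simp: theta_segments_def)
      from ear_exists[OF G(2,1) le this fg(2)] obtain E u v
        where E: "ear G (P \<squnion> Q \<squnion> R) E u v" "g \<in> edges E" .
      show ?thesis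
        by (rule covered_theta_ear[OF G(1,3) T(1) le E(1) _ E(2) False _ F(2)])
          (use sub E(2) fg(4) in auto)
    qed
  qed
  consider "F \<subseteq> edges (A \<squnion> B)" | "e3 \<notin> edges (A \<squnion> B)" | "e4 \<notin> edges (A \<squnion> B)"
    using e C(3) by auto
  then show ?thesis
  proof cases
    case 1
    show ?thesis
      by (rule covered_cycle[OF G(1) C(1)]) (use C(2) 1 in auto)
  qed (use theta[of e3 e4] theta[of e4 e3] eG e in \<open>auto simp: insert_commute\<close>)
qed

section \<open>The topology of the 1-complex\<close>

lemma ends_edge:
  assumes "is_graph G" "e \<in> edges G"
  shows "e = {fst (ends e), snd (ends e)}" "fst (ends e) \<noteq> snd (ends e)"
    "fst (ends e) \<in> verts G" "snd (ends e) \<in> verts G"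
proof -
  obtain x y where "e = {x, y}"
    using edge_cases[OF assms] by metis
  then have "\<exists>p. e = {fst p, snd p}"
    by (intro exI[of _ "(x, y)"]) simp
  then show e: "e = {fst (ends e), snd (ends e)}"
    unfolding ends_def by (rule someI_ex)
  have "card e = 2" "e \<subseteq> verts G"
    using assms by (auto simp: is_graph_def)
  then show "fst (ends e) \<noteq> snd (ends e)"
    using e by (metis card_2_iff doubleton_eq_iff)
  show "fst (ends e) \<in> verts G" "snd (ends e) \<in> verts G"
    using e \<open>e \<subseteq> verts G\<close> by (metis insertI1 insertI2 subsetD)+
qed

text \<open>For a subgraph \<open>H\<close> of \<open>G\<close> this is its subcomplex within the
  complex of \<open>G\<close>: the orientation \<open>ends\<close> depends on the edge alone, so
  inner points have the same coordinates in both.\<close>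

definition realization :: "'a ugraph \<Rightarrow> 'a point set" where
  "realization H = Vertex ` verts H \<union> {Inner e t | e t. e \<in> edges H \<and> 0 < t \<and> t < 1}"

lemma realization_iff [simp]:
  "Vertex v \<in> realization H \<longleftrightarrow> v \<in> verts H"
  "Inner e t \<in> realization H \<longleftrightarrow> e \<in> edges H \<and> 0 < t \<and> t < 1"
  by (auto simp: realization_def)

lemma realization_un [simp]: "realization (P \<squnion> Q) = realization P \<union> realization Q"
  by (auto simp: realization_def)

lemma realization_mono: "P \<sqsubseteq> Q \<Longrightarrow> realization P \<subseteq> realization Q"
  by (auto simp: realization_def graph_le_def)

lemma realization_Int:
  assumes "edges P \<inter> edges Q = {}"
  shows "realization P \<inter> realization Q = Vertex ` (verts P \<inter> verts Q)"
  using assms by (auto simp: realization_def)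

abbreviation edge_point :: "'a set \<Rightarrow> real \<Rightarrow> 'a point" where
  "edge_point e t \<equiv> glue (Inr e, t)"

lemma edge_point_simps [simp]:
  "edge_point e 0 = Vertex (fst (ends e))"
  "edge_point e 1 = Vertex (snd (ends e))"
  "0 < t \<Longrightarrow> t < 1 \<Longrightarrow> edge_point e t = Inner e t"
  by (auto simp: glue_def)

lemma edge_point_cases:
  assumes "t \<in> {0..1::real}"
  obtains "t = 0" | "t = 1" | "0 < t" "t < 1"
  using assms by fastforce

lemma topspace_pre_complex:
  "topspace (pre_complex G) = {(Inl v, 0) | v. v \<in> verts G} \<union> {(Inr e, t) | e t. e \<in> edges G \<and> t \<in> {0..1}}"
  by (auto simp: pre_complex_def)

lemma topspace_realization:
  assumes "is_graph G"
  shows "topspace (one_complex G) = realization G"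
proof
  show "topspace (one_complex G) \<subseteq> realization G"
  proof
    fix x assume "x \<in> topspace (one_complex G)"
    then consider v where "v \<in> verts G" "x = Vertex v" | e t where "e \<in> edges G" "t \<in> {0..1}" "x = edge_point e t"
      by (auto simp: topspace_one_complex topspace_pre_complex glue_def)
    then show "x \<in> realization G"
    proof cases
      case 2
      then show ?thesis
        by (cases rule: edge_point_cases[OF 2(2)]) (use 2 ends_edge[OF assms 2(1)] in auto)
    qed auto
  qed
  show "realization G \<subseteq> topspace (one_complex G)"
  proof
    fix x assume x: "x \<in> realization G"
    show "x \<in> topspace (one_complex G)"
    proof (cases x)
      case (Vertex v)
      then have "x = glue (Inl v, 0)" "v \<in> verts G"
        using x by (auto simp: glue_def)
      then show ?thesis
        unfolding topspace_one_complex topspace_pre_complex by blast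
    next
      case (Inner e t)
      then have "x = edge_point e t" "e \<in> edges G" "t \<in> {0..1}"
        using x by auto
      then show ?thesis
        unfolding topspace_one_complex topspace_pre_complex by blast
    qed
  qed
qed

text \<open>The summands of the vertices are single points, in which every subset is open; only the
  intervals impose a condition.\<close>

lemma openin_one_complex_iff:
  "openin (one_complex G) U \<longleftrightarrow> U \<subseteq> topspace (one_complex G) \<and>
     (\<forall>e\<in>edges G. openin (top_of_set {0..1}) {t \<in> {0..1}. edge_point e t \<in> U})"
proof -
  have pre: "openin (pre_complex G) {x \<in> topspace (pre_complex G). glue x \<in> U} \<longleftrightarrow>
     (\<forall>i\<in>verts G <+> edges G. openin (case i of Inl v \<Rightarrow> top_of_set {0} | Inr e \<Rightarrow> top_of_set {0..1})
       {t. (i, t) \<in> topspace (pre_complex G) \<and> glue (i, t) \<in> U})"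
    unfolding pre_complex_def openin_sum_topology by auto
  have Inl: "openin (top_of_set {0::real}) {t. (Inl v, t) \<in> topspace (pre_complex G) \<and> glue (Inl v, t) \<in> U}"
    if "v \<in> verts G" for v
  proof -
    have "{t. (Inl v, t) \<in> topspace (pre_complex G) \<and> glue (Inl v, t) \<in> U} = {} \<or>
        {t. (Inl v, t) \<in> topspace (pre_complex G) \<and> glue (Inl v, t) \<in> U} = {0}"
      by (auto simp: topspace_pre_complex)
    then show ?thesis
    proof
      assume eq: "{t. (Inl v, t) \<in> topspace (pre_complex G) \<and> glue (Inl v, t) \<in> U} = {0}"
      show ?thesis
        unfolding eq by (metis openin_topspace topspace_euclidean_subtopology)
    qed (simp only: openin_empty)
  qed
  have Inr: "{t. (Inr e, t) \<in> topspace (pre_complex G) \<and> glue (Inr e, t) \<in> U} = {t \<in> {0..1}. edge_point e t \<in> U}"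
    if "e \<in> edges G" for e
    using that by (auto simp: topspace_pre_complex)
  show ?thesis
    unfolding openin_one_complex topspace_one_complex pre by (simp add: Plus_def ball_Un Inl Inr)
qed

text \<open>On each edge the preimage is either empty or all of the interval except possibly end
  points, hence open. Sets that split no open edge are all that the separation arguments
  need.\<close>

lemma openin_saturated:
  assumes "is_graph G" "U \<subseteq> realization G"
    and "\<And>e. e \<in> edges G \<Longrightarrow> (\<forall>t. 0 < t \<and> t < 1 \<longrightarrow> Inner e t \<in> U) \<or>
      (\<forall>t. 0 < t \<and> t < 1 \<longrightarrow> Inner e t \<notin> U) \<and> (\<forall>v\<in>e. Vertex v \<notin> U)"
  shows "openin (one_complex G) U"
  unfolding openin_one_complex_iff topspace_realization[OF assms(1)]
proof (intro conjI ballI assms(2))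
  fix e assume e: "e \<in> edges G"
  let ?T = "{t \<in> {0..1}. edge_point e t \<in> U}"
  from assms(3)[OF e] show "openin (top_of_set {0..1}) ?T"
  proof
    assume inner: "\<forall>t. 0 < t \<and> t < 1 \<longrightarrow> Inner e t \<in> U"
    let ?D = "{t \<in> {0, 1}. edge_point e t \<notin> U}"
    have T: "?T = {0..1} - ?D"
    proof (intro set_eqI)
      fix t :: real
      show "t \<in> ?T \<longleftrightarrow> t \<in> {0..1} - ?D"
      proof (cases "t \<in> {0..1}")
        case True
        then show ?thesis
          by (cases rule: edge_point_cases[OF True]) (use inner in auto)
      qed auto
    qed
    have "closed ?D"
      by (rule finite_imp_closed) auto
    then show ?thesis
      unfolding T Diff_eq by (intro openin_open_Int open_Compl)
  next
    assume "(\<forall>t. 0 < t \<and> t < 1 \<longrightarrow> Inner e t \<notin> U) \<and> (\<forall>v\<in>e. Vertex v \<notin> U)"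
    moreover have "fst (ends e) \<in> e" "snd (ends e) \<in> e"
      using ends_edge(1)[OF assms(1) e] by (metis insertI1 insertI2)+
    ultimately have "edge_point e t \<notin> U" if "t \<in> {0..1}" for t
      by (cases rule: edge_point_cases[OF that]) auto
    then have "?T = {}"
      by blast
    then show ?thesis
      by (metis openin_empty)
  qed
qed

lemma continuous_map_one_complex:
  assumes eq: "\<And>e t. e \<in> edges G \<Longrightarrow> t \<in> {0..1} \<Longrightarrow> f (edge_point e t) = h e t"
    and cont: "\<And>e. e \<in> edges G \<Longrightarrow> continuous_on {0..1} (h e)"
  shows "continuous_map (one_complex G) (euclidean :: 'b::topological_space topology) f"
  unfolding continuous_map_def
proof (intro conjI allI impI)
  fix V :: "'b set" assume V: "openin euclidean V"
  have "openin (top_of_set {0..1}) {t \<in> {0..1}. edge_point e t \<in> {x \<in> topspace (one_complex G). f x \<in> V}}"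
    if e: "e \<in> edges G" for e
  proof -
    have "edge_point e t \<in> topspace (one_complex G)" if "t \<in> {0..1}" for t
      using e that unfolding topspace_one_complex topspace_pre_complex by blast
    then have "{t \<in> {0..1}. edge_point e t \<in> {x \<in> topspace (one_complex G). f x \<in> V}} =
       {0..1} \<inter> h e -` V"
      using eq[OF e] by auto
    then show ?thesis
      using continuous_openin_preimage_gen[OF cont[OF e], of V] V by simp
  qed
  then show "openin (one_complex G) {x \<in> topspace (one_complex G). f x \<in> V}"
    unfolding openin_one_complex_iff by auto
qed auto

lemma continuous_map_edge_point:
  assumes "e \<in> edges G"
  shows "continuous_map (top_of_set {0..1}) (one_complex G) (edge_point e)"
proof -
  have "edge_point e t \<in> topspace (one_complex G)" if "t \<in> {0..1}" for t
    using assms that unfolding topspace_one_complex topspace_pre_complex by blast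
  then show ?thesis
    using assms by (auto simp: continuous_map_def openin_one_complex_iff)
qed

text \<open>Points are separated by continuous real functions. The result turns injectively
  parametrized curves into arcs, in \<open>param_arc_is_arc_in\<close>.\<close>

lemma Hausdorff_one_complex:
  assumes G: "is_graph G"
  shows "Hausdorff_space (one_complex G)"
proof -
  have sep: "\<exists>U V. openin (one_complex G) U \<and> openin (one_complex G) V \<and> x \<in> U \<and> y \<in> V \<and> disjnt U V"
    if xy: "x \<in> realization G" "y \<in> realization G"
      "continuous_map (one_complex G) euclideanreal f" "f x \<noteq> f y" for x y f
  proof -
    obtain A B where "open A" "open B" "f x \<in> A" "f y \<in> B" "A \<inter> B = {}"
      using hausdorff[OF xy(4)] by auto
    moreover have "openin (one_complex G) {x \<in> topspace (one_complex G). f x \<in> A}"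
      "openin (one_complex G) {x \<in> topspace (one_complex G). f x \<in> B}"
      using xy(3) calculation(1,2) by (auto simp: continuous_map_def)
    moreover have "disjnt {x \<in> topspace (one_complex G). f x \<in> A} {x \<in> topspace (one_complex G). f x \<in> B}"
      using calculation(5) by (auto simp: disjnt_iff)
    ultimately show ?thesis
      using xy(1,2) topspace_realization[OF G] by (metis (no_types, lifting) mem_Collect_eq)
  qed
  have vertex: "\<exists>f. continuous_map (one_complex G) euclideanreal f \<and> f (Vertex v) \<noteq> f x"
    if "x \<in> realization G" "x \<noteq> Vertex v" for v x
  proof -
    \<comment> \<open>The hat function at \<open>v\<close>: it is 1 at \<open>v\<close> and falls
      linearly to 0 along each edge at \<open>v\<close>, so no other point has value 1.\<close>
    define f where "f = (\<lambda>x. case x of Vertex u \<Rightarrow> if u = v then 1 else 0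
       | Inner e t \<Rightarrow> if fst (ends e) = v then 1 - t else if snd (ends e) = v then t else (0::real))"
    have "f (edge_point e t) = (if fst (ends e) = v then 1 - t else if snd (ends e) = v then t else 0)"
      if "e \<in> edges G" "t \<in> {0..1}" for e t
      by (cases rule: edge_point_cases[OF that(2)]) (use ends_edge(2)[OF G that(1)] in \<open>auto simp: f_def\<close>)
    moreover have "continuous_on {0..1}
        (\<lambda>t::real. if fst (ends e) = v then 1 - t else if snd (ends e) = v then t else 0)" for e
      by (cases "fst (ends e) = v"; cases "snd (ends e) = v") (auto intro!: continuous_intros)
    ultimately have "continuous_map (one_complex G) euclideanreal f"
      by (rule continuous_map_one_complex)
    moreover have "f (Vertex v) \<noteq> f x"
      using that by (cases x) (auto simp: f_def)
    ultimately show ?thesis by blast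
  qed
  have inner: "\<exists>f. continuous_map (one_complex G) euclideanreal f \<and> f (Inner e s) \<noteq> f (Inner e' t)"
    if "Inner e s \<noteq> Inner e' t" "0 < t" "t < 1" for e s e' t
  proof -
    \<comment> \<open>A bump on \<open>e'\<close> that vanishes at both ends and thus extends by 0.
      If the two points share the edge, the factor \<open>r - s\<close> makes it vanish at the first
      point too.\<close>
    define f where "f = (\<lambda>x. case x of Vertex u \<Rightarrow> 0
       | Inner d r \<Rightarrow> if d = e' then (if e = e' then r - s else 1) * r * (1 - r) else (0::real))"
    have "f (edge_point d r) = (if d = e' then (if e = e' then r - s else 1) * r * (1 - r) else 0)"
      if "r \<in> {0..1}" for d r
      by (cases rule: edge_point_cases[OF that]) (auto simp: f_def)
    moreover have "continuous_on {0..1}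
        (\<lambda>r. if d = e' then (if e = e' then r - s else 1) * r * (1 - r) else 0)" for d
      by (cases "d = e'"; cases "e = e'") (auto intro!: continuous_intros)
    ultimately have "continuous_map (one_complex G) euclideanreal f"
      by (rule continuous_map_one_complex)
    moreover have "f (Inner e s) \<noteq> f (Inner e' t)"
      using that by (auto simp: f_def)
    ultimately show ?thesis by blast
  qed
  show ?thesis
    unfolding Hausdorff_space_def topspace_realization[OF G]
  proof (intro allI impI)
    fix x y assume xy: "x \<in> realization G \<and> y \<in> realization G \<and> x \<noteq> y"
    have "\<exists>f. continuous_map (one_complex G) euclideanreal f \<and> f x \<noteq> f y"
    proof (cases x)
      case (Vertex v)
      then show ?thesis
        using vertex[of y v] xy by auto
    next
      case x: (Inner e s)
      show ?thesis
      proof (cases y)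
        case (Vertex v)
        then show ?thesis
          using vertex[of x v] xy by metis
      next
        case (Inner e' t)
        then show ?thesis
          using inner[of e s e' t] x xy by auto
      qed
    qed
    then show "\<exists>U V. openin (one_complex G) U \<and> openin (one_complex G) V \<and> x \<in> U \<and> y \<in> V \<and> disjnt U V"
      using sep xy by blast
  qed
qed

section \<open>Arcs in the 1-complex\<close>

text \<open>Arcs are parametrized over \<open>[0, c]\<close>, where \<open>c = 0\<close> gives a single point; concatenation
  then needs no rescaling.\<close>

definition param_arc :: "'b topology \<Rightarrow> 'b set \<Rightarrow> 'b \<Rightarrow> 'b \<Rightarrow> bool" where
  "param_arc X A p q \<longleftrightarrow> (\<exists>c g. 0 \<le> c \<and> continuous_map (top_of_set {0..c::real}) X g \<and>
     inj_on g {0..c} \<and> g ` {0..c} = A \<and> g 0 = p \<and> g c = q)"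

lemma param_arc_point:
  assumes "p \<in> topspace X"
  shows "param_arc X {p} p p"
  unfolding param_arc_def using assms by (intro exI[of _ 0] exI[of _ "\<lambda>_. p"]) auto

lemma param_arc_rev:
  assumes "param_arc X A p q"
  shows "param_arc X A q p"
proof -
  obtain c g where g: "0 \<le> c" "continuous_map (top_of_set {0..c::real}) X g" "inj_on g {0..c}"
    "g ` {0..c} = A" "g 0 = p" "g c = q"
    using assms unfolding param_arc_def by blast
  have "continuous_map (top_of_set {0..c}) (top_of_set {0..c}) (\<lambda>t. c - t)"
    by (auto intro!: continuous_intros)
  from continuous_map_compose[OF this g(2)] have "continuous_map (top_of_set {0..c}) X (\<lambda>t. g (c - t))"
    by (simp add: o_def)
  moreover have "inj_on (\<lambda>t. g (c - t)) {0..c}"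
  proof (rule inj_onI)
    show "s = t" if "s \<in> {0..c}" "t \<in> {0..c}" "g (c - s) = g (c - t)" for s t
      using inj_onD[OF g(3), of "c - s" "c - t"] that by auto
  qed
  moreover have "(\<lambda>t. g (c - t)) ` {0..c} = A"
  proof -
    have "(\<lambda>t. c - t) ` {0..c} = {0..c}"
      by simp
    then show ?thesis
      using g(4) by (metis image_image)
  qed
  ultimately show ?thesis
    unfolding param_arc_def using g(1,5,6) by (intro exI[of _ c] exI[of _ "\<lambda>t. g (c - t)"]) auto
qed

lemma param_arc_join:
  assumes "param_arc X A p q" "param_arc X B q r" "A \<inter> B \<subseteq> {q}"
  shows "param_arc X (A \<union> B) p r"
proof -
  obtain c f where f: "0 \<le> c" "continuous_map (top_of_set {0..c::real}) X f" "inj_on f {0..c}"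
    "f ` {0..c} = A" "f 0 = p" "f c = q"
    using assms(1) unfolding param_arc_def by blast
  obtain d g where g: "0 \<le> d" "continuous_map (top_of_set {0..d::real}) X g" "inj_on g {0..d}"
    "g ` {0..d} = B" "g 0 = q" "g d = r"
    using assms(2) unfolding param_arc_def by blast
  let ?h = "\<lambda>t. if t \<le> c then f t else g (t - c)"
  have low: "{0..c + d} \<inter> {t \<in> topspace (top_of_set {0..c + d}). t \<le> c} = {0..c}"
    and high: "{0..c + d} \<inter> {t \<in> topspace (top_of_set {0..c + d}). c \<le> t} = {c..c + d}"
    using f(1) g(1) by auto
  have "continuous_map (top_of_set {c..c + d}) (top_of_set {0..d}) (\<lambda>t. t - c)"
    by (auto intro!: continuous_intros)
  from continuous_map_compose[OF this g(2)] have g': "continuous_map (top_of_set {c..c + d}) X (\<lambda>t. g (t - c))"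
    by (simp add: o_def)
  have "continuous_map (top_of_set {0..c + d}) X ?h"
  proof (rule continuous_map_cases_le)
    show "continuous_map (subtopology (top_of_set {0..c + d}) {x \<in> topspace (top_of_set {0..c + d}). x \<le> c}) X f"
      unfolding subtopology_subtopology low by (rule f(2))
    show "continuous_map (subtopology (top_of_set {0..c + d}) {x \<in> topspace (top_of_set {0..c + d}). c \<le> x}) X (\<lambda>t. g (t - c))"
      unfolding subtopology_subtopology high by (rule g')
  qed (use f(6) g(5) in auto)
  moreover have "?h ` {0..c + d} = A \<union> B"
  proof -
    have "{0..c + d} = {0..c} \<union> {c..c + d}"
      using f(1) g(1) by auto
    then have "?h ` {0..c + d} = ?h ` {0..c} \<union> ?h ` {c..c + d}"
      by (metis image_Un)
    also have "?h ` {0..c} = f ` {0..c}"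
      by (intro image_cong) auto
    also note f(4)
    also have "?h ` {c..c + d} = (\<lambda>t. g (t - c)) ` {c..c + d}"
      using f(6) g(5) by (intro image_cong) auto
    also have "\<dots> = B"
    proof -
      have "(\<lambda>t. t - c) ` {c..c + d} = {0..d}"
        by simp
      then show ?thesis
        using g(4) by (metis image_image)
    qed
    finally show ?thesis .
  qed
  moreover have "inj_on ?h {0..c + d}"
  proof -
    \<comment> \<open>The common point could only be \<open>q\<close>, which \<open>g\<close> takes
      at 0, whereas \<open>t - c\<close> is positive.\<close>
    have cross: False if "s \<in> {0..c}" "t \<in> {c<..c + d}" "f s = g (t - c)" for s t
    proof -
      have "f s \<in> A" "g (t - c) \<in> B"
        using that(1,2) f(4) g(4) by auto
      then have "g (t - c) = g 0"
        using assms(3) that(3) g(5) by auto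
      then have "t - c = 0"
        using g(3) that(2) by (intro inj_onD[OF g(3)]) auto
      then show False
        using that(2) by auto
    qed
    show ?thesis
    proof (rule inj_onI)
      fix s t assume st: "s \<in> {0..c + d}" "t \<in> {0..c + d}" "?h s = ?h t"
      consider "s \<le> c" "t \<le> c" | "s \<le> c" "c < t" | "c < s" "t \<le> c" | "c < s" "c < t"
        by linarith
      then show "s = t"
      proof cases
        case 1
        then show ?thesis
          using st inj_onD[OF f(3)] by auto
      next
        case 2
        then show ?thesis
          using st cross[of s t] by auto
      next
        case 3
        then show ?thesis
          using st cross[of t s] by auto
      next
        case 4
        then show ?thesis
          using st inj_onD[OF g(3), of "s - c" "t - c"] by auto
      qed
    qed
  qed
  moreover have "?h 0 = p" "?h (c + d) = r"
    using f g by auto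
  ultimately show ?thesis
    unfolding param_arc_def using f(1) g(1) by (intro exI[of _ "c + d"] exI[of _ ?h]) auto
qed

text \<open>Since \<open>S\<close> is finite, there is a last parameter before the end at which the
  arc meets \<open>S\<close>. Stopping there loses no point of \<open>S\<close> except possibly
  \<open>q\<close>.\<close>

lemma param_arc_truncate:
  assumes "param_arc X A p q" "p \<noteq> q" "finite S"
  obtains B r where "param_arc X B p r" "A \<inter> S \<subseteq> insert q B" "B \<subseteq> A - {q}"
proof -
  obtain c g where g: "0 \<le> c" "continuous_map (top_of_set {0..c::real}) X g" "inj_on g {0..c}"
    "g ` {0..c} = A" "g 0 = p" "g c = q"
    using assms(1) unfolding param_arc_def by blast
  have c: "0 < c"
    using assms(2) g by (cases "c = 0") auto
  \<comment> \<open>The parameter 0 is added so that the maximum exists even if \<open>S\<close> is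
    not met before the end; the truncated arc is then the point \<open>p\<close>.\<close>
  let ?T = "insert 0 {t \<in> {0..<c}. g t \<in> S}"
  have "inj_on g {t \<in> {0..<c}. g t \<in> S}"
    using g(3) by (rule inj_on_subset) auto
  moreover have "finite (g ` {t \<in> {0..<c}. g t \<in> S})"
    by (rule finite_subset[OF _ assms(3)]) auto
  ultimately have fin: "finite ?T"
    using finite_imageD by (metis finite.insertI)
  define m where "m = Max ?T"
  have "m \<in> ?T"
    unfolding m_def using fin by (intro Max_in) auto
  then have m: "0 \<le> m" "m < c"
    using c by auto
  have le: "t \<le> m" if "t \<in> {0..<c}" "g t \<in> S" for t
    unfolding m_def using fin that by (intro Max_ge) auto
  show thesis
  proof (rule that)
    have "continuous_map (top_of_set {0..m}) X g"
      using continuous_map_from_subtopology_mono[OF g(2)] m by auto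
    moreover have "inj_on g {0..m}"
      using g(3) by (rule inj_on_subset) (use m in auto)
    ultimately show "param_arc X (g ` {0..m}) p (g m)"
      unfolding param_arc_def using g(5) m by blast
    show "A \<inter> S \<subseteq> insert q (g ` {0..m})"
    proof
      fix x assume x: "x \<in> A \<inter> S"
      then obtain t where t: "t \<in> {0..c}" "x = g t"
        using g(4) by auto
      show "x \<in> insert q (g ` {0..m})"
      proof (cases "t = c")
        case False
        then show ?thesis
          using le[of t] x t by auto
      qed (use t g(6) in auto)
    qed
    have "g t \<noteq> q" if "t \<in> {0..m}" for t
      using inj_onD[OF g(3), of t c] that m g(6) by auto
    moreover have "g ` {0..m} \<subseteq> A"
      using m g(4) by auto
    ultimately show "g ` {0..m} \<subseteq> A - {q}"
      by blast
  qed
qed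

text \<open>Two distinct points exclude a parameter interval of length 0. A continuous injection
  from a compact interval into a Hausdorff space is then an embedding.\<close>

lemma param_arc_is_arc_in:
  assumes "Hausdorff_space X" "param_arc X A p q" "x \<in> A" "y \<in> A" "x \<noteq> y"
  shows "is_arc_in X A"
proof -
  obtain c g where g: "0 \<le> c" "continuous_map (top_of_set {0..c::real}) X g" "inj_on g {0..c}"
    "g ` {0..c} = A" "g 0 = p" "g c = q"
    using assms(2) unfolding param_arc_def by blast
  have c: "0 < c"
    using assms(3-5) g(1,4) by (cases "c = 0") auto
  let ?h = "\<lambda>t. g (c * t)"
  have img: "(\<lambda>t. c * t) ` {0..1} = {0..c}"
    using c by (simp add: image_mult_atLeastAtMost)
  have "continuous_map (top_of_set {0..1}) (top_of_set {0..c}) (\<lambda>t. c * t)"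
    using c by (auto intro!: continuous_intros simp: mult_left_le)
  from continuous_map_compose[OF this g(2)] have cont: "continuous_map (top_of_set {0..1}) X ?h"
    by (simp add: o_def)
  have hA: "?h ` {0..1} = A"
    using img g(4) by (metis image_image)
  have A: "A \<subseteq> topspace X"
    using g(2,4) by (metis continuous_map_image_subset_topspace topspace_euclidean_subtopology)
  have "homeomorphic_map (top_of_set {0..1}) (subtopology X A) ?h"
  proof (rule continuous_imp_homeomorphic_map)
    show "continuous_map (top_of_set {0..1}) (subtopology X A) ?h"
      using cont hA by (auto simp: continuous_map_in_subtopology)
    show "compact_space (top_of_set {0..1::real})"
      by (simp add: compact_space_subtopology)
    show "Hausdorff_space (subtopology X A)"
      using assms(1) by (rule Hausdorff_space_subtopology)
    show "?h ` topspace (top_of_set {0..1}) = topspace (subtopology X A)"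
      using hA A by auto
    have "inj_on ((*) c) {0..1}"
      using c by (auto simp: inj_on_def)
    then show "inj_on ?h (topspace (top_of_set {0..1}))"
      using comp_inj_on[of "(*) c" "{0..1}" g] g(3) img by (simp add: o_def)
  qed
  then show ?thesis
    unfolding is_arc_in_def using A homeomorphic_map_imp_homeomorphic_space homeomorphic_space_sym by blast
qed

lemma param_arc_edge:
  assumes G: "is_graph G" and e: "{x, y} \<in> edges G" "x \<noteq> y"
  shows "param_arc (one_complex G) (realization (path_graph [x, y])) (Vertex x) (Vertex y)"
proof -
  let ?e = "{x, y}"
  have img: "edge_point ?e ` {0..1} = realization (path_graph [x, y])"
  proof -
    have "{0..1::real} = {0, 1} \<union> {0<..<1}"
      by auto
    then have "edge_point ?e ` {0..1} = edge_point ?e ` {0, 1} \<union> edge_point ?e ` {0<..<1}"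
      by (metis image_Un)
    also have "edge_point ?e ` {0, 1} = Vertex ` {fst (ends ?e), snd (ends ?e)}"
      by simp
    also have "{fst (ends ?e), snd (ends ?e)} = {x, y}"
      using ends_edge(1)[OF G e(1)] by simp
    also have "edge_point ?e ` {0<..<1} = Inner ?e ` {0<..<1}"
      by (intro image_cong) auto
    finally show ?thesis
      by (auto simp: realization_def)
  qed
  have "inj_on (edge_point ?e) {0..1}"
  proof (rule inj_onI)
    fix s t assume st: "s \<in> {0..1::real}" "t \<in> {0..1}" "edge_point ?e s = edge_point ?e t"
    show "s = t"
      by (cases rule: edge_point_cases[OF st(1)]; cases rule: edge_point_cases[OF st(2)])
        (use st(3) ends_edge(2)[OF G e(1)] in auto)
  qed
  then have "param_arc (one_complex G) (realization (path_graph [x, y])) (edge_point ?e 0) (edge_point ?e 1)"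
    unfolding param_arc_def using img continuous_map_edge_point[OF e(1)]
    by (intro exI[of _ 1] exI[of _ "edge_point ?e"]) auto
  \<comment> \<open>The orientation by \<open>ends\<close> may run either way; if it starts at
    \<open>y\<close>, the arc is reversed.\<close>
  moreover have "{fst (ends ?e), snd (ends ?e)} = {x, y}"
    using ends_edge(1)[OF G e(1)] by simp
  ultimately show ?thesis
    using param_arc_rev by (auto simp: doubleton_eq_iff)
qed

lemma param_arc_path:
  assumes G: "is_graph G" and "is_path P a b" "P \<sqsubseteq> G"
  shows "param_arc (one_complex G) (realization P) (Vertex a) (Vertex b)"
proof -
  obtain vs where vs: "vs \<noteq> []" "distinct vs" "hd vs = a" "last vs = b" "P = path_graph vs"
    using assms(2) by (auto simp: is_path_def)
  have "param_arc (one_complex G) (realization (path_graph vs)) (Vertex (hd vs)) (Vertex (last vs))"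
    if "vs \<noteq> []" "distinct vs" "path_graph vs \<sqsubseteq> G" for vs
    using that
  proof (induction vs)
    case (Cons x xs)
    show ?case
    proof (cases xs)
      case Nil
      have "realization (path_graph [x]) = {Vertex x}"
        by (auto simp: realization_def)
      moreover have "Vertex x \<in> topspace (one_complex G)"
        using Cons.prems(3) topspace_realization[OF G] by (auto simp: graph_le_def)
      ultimately show ?thesis
        using Nil param_arc_point by simp
    next
      case xs: (Cons y ys)
      have eq: "path_graph (x # xs) = path_graph [x, y] \<squnion> path_graph xs"
        using xs by (auto intro!: graph_eqI)
      have le: "{x, y} \<in> edges G" "path_graph xs \<sqsubseteq> G"
        using Cons.prems(3) xs by (auto simp: graph_le_def)
      have xy: "x \<noteq> y" "distinct xs" "x \<notin> set xs"
        using Cons.prems(2) xs by auto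
      have "edges (path_graph [x, y]) \<inter> edges (path_graph xs) = {}"
        using xy(3) edges_path_graph_subset by fastforce
      then have "realization (path_graph [x, y]) \<inter> realization (path_graph xs) \<subseteq> {Vertex y}"
        using xy(3) by (auto simp: realization_Int)
      moreover have "param_arc (one_complex G) (realization (path_graph xs)) (Vertex y) (Vertex (last xs))"
        using Cons.IH xs xy(2) le(2) by auto
      ultimately show ?thesis
        unfolding eq realization_un using param_arc_join[OF param_arc_edge[OF G le(1) xy(1)]] xs by auto
    qed
  qed simp
  then show ?thesis
    using vs assms(3) by auto
qed

text \<open>The sets in the union are closed edges, that is, edges with their ends. The finite set
  \<open>S\<close> has no bound on its size: from here on only the number of edges matters.\<close>

definition arcs_through :: "'a ugraph \<Rightarrow> 'a set set \<Rightarrow> bool" where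
  "arcs_through G F \<longleftrightarrow> (\<forall>S. finite S \<and> S \<subseteq> (\<Union>e\<in>F. realization \<lparr>verts = e, edges = {e}\<rparr>) \<longrightarrow>
     (\<exists>A. is_arc_in (one_complex G) A \<and> S \<subseteq> A))"

lemma closed_edges_subset:
  assumes "is_graph K" "F \<subseteq> edges K"
  shows "(\<Union>e\<in>F. realization \<lparr>verts = e, edges = {e}\<rparr>) \<subseteq> realization K"
proof (rule UN_least)
  fix e assume "e \<in> F"
  then have "\<lparr>verts = e, edges = {e}\<rparr> \<sqsubseteq> K"
    using assms by (auto simp: graph_le_def is_graph_def)
  then show "realization \<lparr>verts = e, edges = {e}\<rparr> \<subseteq> realization K"
    by (rule realization_mono)
qed

text \<open>The end \<open>y\<close> is cut off because it will lie on the main path of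
  \<open>arcs_through_lasso\<close>. A path of one vertex is kept whole, which accounts for the
  alternative \<open>y = u\<close>.\<close>

lemma whisker:
  assumes G: "is_graph G" and Y: "is_path Y u y" "Y \<sqsubseteq> G" and S: "finite S"
  obtains B r where "param_arc (one_complex G) B (Vertex u) r" "B \<subseteq> realization Y"
    "realization Y \<inter> S \<subseteq> insert (Vertex y) B" "y = u \<or> Vertex y \<notin> B"
proof (cases "y = u")
  case True
  then show thesis
    using that[of "realization Y" "Vertex y"] param_arc_path[OF G Y] by blast
next
  case False
  then have "Vertex u \<noteq> Vertex y"
    by simp
  from param_arc_truncate[OF param_arc_path[OF G Y] this S] obtain B r where
    "param_arc (one_complex G) B (Vertex u) r" "realization Y \<inter> S \<subseteq> insert (Vertex y) B"
    "B \<subseteq> realization Y - {Vertex y}" .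
  then show thesis
    using that[of B r] by blast
qed

text \<open>The union of a path \<open>M\<close> and two paths leading from its ends back to \<open>M\<close> is an arc up to
  arbitrarily small open pieces just before the points where the two paths return.\<close>

lemma arcs_through_lasso:
  assumes G: "is_graph G"
    and M: "is_path M u v" "u \<noteq> v" "M \<sqsubseteq> G"
    and X: "is_path X v x" "X \<sqsubseteq> G" "verts X \<inter> verts M \<subseteq> {v, x}" "edges X \<inter> edges M = {}" "x \<in> verts M"
    and Y: "is_path Y u y" "Y \<sqsubseteq> G" "verts Y \<inter> verts M \<subseteq> {u, y}" "edges Y \<inter> edges M = {}" "y \<in> verts M"
    and XY: "edges X \<inter> edges Y = {}" "verts X \<inter> verts Y \<subseteq> verts M"
    and F: "F \<subseteq> edges (M \<squnion> X \<squnion> Y)"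
  shows "arcs_through G F"
  unfolding arcs_through_def
proof (intro allI impI, elim conjE)
  fix S assume S: "finite S" "S \<subseteq> (\<Union>e\<in>F. realization \<lparr>verts = e, edges = {e}\<rparr>)"
  let ?X = "one_complex G"
  have "is_graph (M \<squnion> X \<squnion> Y)"
    by (intro is_graph_un is_path_is_graph[OF M(1)] is_path_is_graph[OF X(1)] is_path_is_graph[OF Y(1)])
  from closed_edges_subset[OF this F] have SK: "S \<subseteq> realization M \<union> realization X \<union> realization Y"
    using S(2) by auto
  obtain B r where B: "param_arc ?X B (Vertex v) r" "B \<subseteq> realization X"
    "realization X \<inter> S \<subseteq> insert (Vertex x) B" "x = v \<or> Vertex x \<notin> B"
    using whisker[OF G X(1,2) S(1)] .
  obtain C s where C: "param_arc ?X C (Vertex u) s" "C \<subseteq> realization Y"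
    "realization Y \<inter> S \<subseteq> insert (Vertex y) C" "y = u \<or> Vertex y \<notin> C"
    using whisker[OF G Y(1,2) S(1)] .
  have MX: "realization X \<inter> realization M \<subseteq> {Vertex v, Vertex x}"
    unfolding realization_Int[OF X(4)] using X(3) by blast
  have MY: "realization Y \<inter> realization M \<subseteq> {Vertex u, Vertex y}"
    unfolding realization_Int[OF Y(4)] using Y(3) by blast
  have XYM: "realization X \<inter> realization Y \<subseteq> realization M"
    unfolding realization_Int[OF XY(1)] using XY(2) by (auto simp: realization_def)
  have MB: "realization M \<inter> B \<subseteq> {Vertex v}"
    using MX B(2,4) by blast
  have MC: "C \<inter> realization M \<subseteq> {Vertex u}"
    using MY C(2,4) by blast
  have "C \<inter> B \<subseteq> realization M"
    using XYM B(2) C(2) by blast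
  then have "C \<inter> (realization M \<union> B) \<subseteq> {Vertex u}"
    using MC by blast
  then have arc: "param_arc ?X (C \<union> (realization M \<union> B)) s r"
    using param_arc_join[OF param_arc_rev[OF C(1)] param_arc_join[OF param_arc_path[OF G M(1,3)] B(1) MB]]
    by blast
  have "is_arc_in ?X (C \<union> (realization M \<union> B))"
    by (rule param_arc_is_arc_in[OF Hausdorff_one_complex[OF G] arc, of "Vertex u" "Vertex v"])
      (use M is_path_ends in auto)
  \<comment> \<open>The truncations can lose no points of \<open>S\<close> other than
    \<open>x\<close> and \<open>y\<close>, and the main path contains both.\<close>
  moreover have "Vertex x \<in> realization M" "Vertex y \<in> realization M"
    using X(5) Y(5) by auto
  then have "S \<subseteq> C \<union> (realization M \<union> B)"
    using SK B(3) C(3) by blast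
  ultimately show "\<exists>A. is_arc_in ?X A \<and> S \<subseteq> A"
    by blast
qed

lemma arcs_through_theta:
  assumes G: "is_graph G" and T: "theta_segments a b P Q R" "P \<squnion> Q \<squnion> R \<sqsubseteq> G"
    and F: "F \<subseteq> edges (P \<squnion> Q \<squnion> R)"
  shows "arcs_through G F"
proof -
  have par: "parallel a b P Q" "parallel a b P R" "parallel a b Q R"
    using T(1) by (auto simp: theta_segments_def)
  show ?thesis
  proof (rule arcs_through_lasso[OF G])
    show "is_path P a b" "is_path Q b a" "is_path R a b" "a \<noteq> b"
      using par is_path_rev by (auto simp: parallel_def)
    show "verts Q \<inter> verts P \<subseteq> {b, a}" "verts R \<inter> verts P \<subseteq> {a, b}"
      using par[THEN parallel_subset] by auto
    show "verts Q \<inter> verts R \<subseteq> verts P"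
      using parallel_subset[OF par(3)] parallel_mem[OF par(1)] by blast
    show "edges Q \<inter> edges P = {}" "edges R \<inter> edges P = {}" "edges Q \<inter> edges R = {}"
      using par[THEN parallel_edges] by auto
  qed (use T F parallel_mem[OF par(1)] in auto)
qed

text \<open>One returning path suffices for a circle; the second one is the single vertex
  \<open>a\<close>.\<close>

lemma arcs_through_cycle:
  assumes G: "is_graph G" and C: "parallel a b P Q" "P \<squnion> Q \<sqsubseteq> G"
    and F: "F \<subseteq> edges (P \<squnion> Q)"
  shows "arcs_through G F"
proof (rule arcs_through_lasso[OF G])
  show "is_path P a b" "is_path Q b a" "is_path (path_graph [a]) a a" "a \<noteq> b"
    using C is_path_rev is_path_refl by (auto simp: parallel_def)
  show "verts Q \<inter> verts P \<subseteq> {b, a}"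
    using parallel_subset[OF C(1)] by auto
  show "edges Q \<inter> edges P = {}"
    using parallel_edges[OF C(1)] by auto
  show "path_graph [a] \<sqsubseteq> G"
    using parallel_mem[OF C(1)] C(2) by (auto simp: graph_le_def)
qed (use C F parallel_mem[OF C(1)] in auto)

section \<open>Arcs in happy-face curves\<close>

lemma happy_segments_sym:
  assumes "happy_segments a b c A1 A2 B1 B2 P"
  shows "happy_segments a b c A2 A1 B1 B2 P" "happy_segments a c b B1 B2 A1 A2 P"
  using assms parallel_commute[of a b A1 A2] is_path_rev[of P b c] unfolding happy_segments_def
  by (simp_all add: Int_commute Un_commute)

lemma happy_segmentsD:
  assumes "happy_segments a b c A1 A2 B1 B2 P"
  shows "parallel a b A1 A2" "parallel a c B1 B2" "is_path P b c"
    "verts A1 \<inter> verts B1 \<subseteq> {a}" "verts A1 \<inter> verts B2 \<subseteq> {a}" "verts A2 \<inter> verts B1 \<subseteq> {a}"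
    "verts A2 \<inter> verts B2 \<subseteq> {a}" "verts A1 \<inter> verts P \<subseteq> {b}" "verts A2 \<inter> verts P \<subseteq> {b}"
    "verts P \<inter> verts B1 \<subseteq> {c}" "verts P \<inter> verts B2 \<subseteq> {c}"
proof -
  have "verts (A1 \<squnion> A2) \<inter> verts (B1 \<squnion> B2) \<subseteq> {a}" "verts (A1 \<squnion> A2) \<inter> verts P \<subseteq> {b}"
    "verts P \<inter> verts (B1 \<squnion> B2) \<subseteq> {c}"
    using assms by (simp_all add: happy_segments_def)
  then show "verts A1 \<inter> verts B1 \<subseteq> {a}" "verts A1 \<inter> verts B2 \<subseteq> {a}" "verts A2 \<inter> verts B1 \<subseteq> {a}"
    "verts A2 \<inter> verts B2 \<subseteq> {a}" "verts A1 \<inter> verts P \<subseteq> {b}" "verts A2 \<inter> verts P \<subseteq> {b}"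
    "verts P \<inter> verts B1 \<subseteq> {c}" "verts P \<inter> verts B2 \<subseteq> {c}"
    by auto
qed (use assms in \<open>simp_all add: happy_segments_def\<close>)

lemma happy_edges_disjoint:
  assumes "happy_segments a b c A1 A2 B1 B2 P"
  shows "sorted_wrt (\<lambda>A B. A \<inter> B = {}) [edges A1, edges A2, edges B1, edges B2, edges P]"
proof -
  note h = happy_segmentsD[OF assms]
  note A = parallelD(2,3)[OF h(1)] and B = parallelD(2,3)[OF h(2)]
  show ?thesis
    using parallel_edges[OF h(1)] parallel_edges[OF h(2)]
      path_edges_disjoint[OF A(1) B(1) h(4)] path_edges_disjoint[OF A(1) B(2) h(5)]
      path_edges_disjoint[OF A(2) B(1) h(6)] path_edges_disjoint[OF A(2) B(2) h(7)]
      path_edges_disjoint[OF A(1) h(3) h(8)] path_edges_disjoint[OF A(2) h(3) h(9)]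
      path_edges_disjoint[OF h(3) B(1) h(10)] path_edges_disjoint[OF h(3) B(2) h(11)]
    by (simp add: Int_commute)
qed

text \<open>The main path runs from \<open>b\<close> through \<open>a\<close> to \<open>c\<close>
  along \<open>A1\<close> and \<open>B1\<close>, and \<open>B2\<close> leads from \<open>c\<close>
  back to \<open>a\<close>. Both \<open>A2\<close> and \<open>P\<close> start at \<open>b\<close>
  and return to the main path, but only one of them can be used; the other is the unhit one.\<close>

lemma arcs_through_happy_unhit:
  assumes G: "is_graph G" and H: "happy_segments a b c A1 A2 B1 B2 P"
    and le: "A1 \<squnion> A2 \<squnion> P \<squnion> (B1 \<squnion> B2) \<sqsubseteq> G" and F: "F \<subseteq> edges (A1 \<squnion> A2 \<squnion> P \<squnion> (B1 \<squnion> B2))"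
    and unhit: "F \<inter> edges A2 = {} \<or> F \<inter> edges P = {}"
  shows "arcs_through G F"
proof -
  note h = happy_segmentsD[OF H] and dis = happy_edges_disjoint[OF H]
  note A = parallelD(1-3)[OF h(1)] and B = parallelD(1-3)[OF h(2)]
  note mA = parallel_mem[OF h(1)] and mB = parallel_mem[OF h(2)]
  have bc: "b \<noteq> c"
    using h(4) mA mB A(1) by auto
  have M: "is_path (A1 \<squnion> B1) b c"
    using is_path_join'[OF is_path_rev[OF A(2)] B(2) h(4)] .
  have X: "verts B2 \<inter> verts (A1 \<squnion> B1) \<subseteq> {c, a}"
    using h(5) parallel_subset[OF h(2)] by auto
  from unhit show ?thesis
  proof
    assume F': "F \<inter> edges A2 = {}"
    show ?thesis
    proof (rule arcs_through_lasso[OF G M bc _ is_path_rev[OF B(3)] _ X _ _ h(3)])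
      show "verts P \<inter> verts (A1 \<squnion> B1) \<subseteq> {b, c}"
        using h(8,10) by auto
      show "verts B2 \<inter> verts P \<subseteq> verts (A1 \<squnion> B1)"
        using h(11) mB by auto
      show "edges B2 \<inter> edges (A1 \<squnion> B1) = {}" "edges P \<inter> edges (A1 \<squnion> B1) = {}" "edges B2 \<inter> edges P = {}"
        using dis by auto
    qed (use le F F' mA mB in auto)
  next
    assume F': "F \<inter> edges P = {}"
    show ?thesis
    proof (rule arcs_through_lasso[OF G M bc _ is_path_rev[OF B(3)] _ X _ _ is_path_rev[OF A(3)]])
      show "verts A2 \<inter> verts (A1 \<squnion> B1) \<subseteq> {b, a}"
        using h(6) parallel_subset[OF h(1)] by auto
      show "verts B2 \<inter> verts A2 \<subseteq> verts (A1 \<squnion> B1)"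
        using h(7) mA by auto
      show "edges B2 \<inter> edges (A1 \<squnion> B1) = {}" "edges A2 \<inter> edges (A1 \<squnion> B1) = {}" "edges B2 \<inter> edges A2 = {}"
        using dis by auto
    qed (use le F F' mA mB in auto)
  qed
qed

text \<open>Exchanging the halves of a circle, or the two circles, makes any unhit circle segment
  take the place of \<open>A2\<close>.\<close>

lemma arcs_through_happy:
  assumes G: "is_graph G" and H: "happy_segments a b c A1 A2 B1 B2 P"
    and le: "A1 \<squnion> A2 \<squnion> P \<squnion> (B1 \<squnion> B2) \<sqsubseteq> G" and F: "F \<subseteq> edges (A1 \<squnion> A2 \<squnion> P \<squnion> (B1 \<squnion> B2))" "card F = 4"
  shows "arcs_through G F"
proof -
  have "finite F"
    using F(2) by (metis card.infinite zero_neq_numeral)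
  with happy_edges_disjoint[OF H] obtain A
    where "A \<in> set [edges A1, edges A2, edges B1, edges B2, edges P]" "F \<inter> A = {}"
    by (rule exists_unhit[of _ F]) (simp add: F(2))
  then consider "F \<inter> edges A2 = {} \<or> F \<inter> edges P = {}" | "F \<inter> edges A1 = {}" | "F \<inter> edges B1 = {}"
    | "F \<inter> edges B2 = {}"
    by auto
  then show ?thesis
  proof cases
    case 1
    then show ?thesis
      using arcs_through_happy_unhit[OF G H le F(1)] by blast
  next
    case 2
    show ?thesis
      by (rule arcs_through_happy_unhit[OF G happy_segments_sym(1)[OF H]]) (use le F 2 in auto)
  next
    case 3
    show ?thesis
      by (rule arcs_through_happy_unhit[OF G happy_segments_sym(1)[OF happy_segments_sym(2)[OF H]]])
        (use le F 3 in auto)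
  next
    case 4
    show ?thesis
      by (rule arcs_through_happy_unhit[OF G happy_segments_sym(2)[OF H]]) (use le F 4 in auto)
  qed
qed

section \<open>Arcs in baguette curves\<close>

lemma baguette_segments_sym:
  assumes "baguette_segments b b' c c' A1 A2 B1 B2 P Q"
  shows "baguette_segments b b' c c' A2 A1 B1 B2 P Q" "baguette_segments c c' b b' B1 B2 A1 A2 P Q"
    "baguette_segments b' b c' c A1 A2 B1 B2 Q P"
  using assms parallel_commute[of b b' A1 A2] is_path_rev[of P b c] is_path_rev[of Q b' c']
    parallel_rev[of b b' A1 A2] parallel_rev[of c c' B1 B2]
  unfolding baguette_segments_def by (simp_all add: Int_commute Un_commute)

lemma baguette_segmentsD:
  assumes "baguette_segments b b' c c' A1 A2 B1 B2 P Q"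
  shows "parallel b b' A1 A2" "parallel c c' B1 B2" "is_path P b c" "is_path Q b' c'"
    "verts A1 \<inter> verts B1 \<subseteq> {}" "verts A1 \<inter> verts B2 \<subseteq> {}" "verts A2 \<inter> verts B1 \<subseteq> {}"
    "verts A2 \<inter> verts B2 \<subseteq> {}" "verts A1 \<inter> verts P \<subseteq> {b}" "verts A2 \<inter> verts P \<subseteq> {b}"
    "verts P \<inter> verts B1 \<subseteq> {c}" "verts P \<inter> verts B2 \<subseteq> {c}"
    "verts A1 \<inter> verts Q \<subseteq> {b'}" "verts A2 \<inter> verts Q \<subseteq> {b'}"
    "verts B1 \<inter> verts Q \<subseteq> {c'}" "verts B2 \<inter> verts Q \<subseteq> {c'}" "verts P \<inter> verts Q \<subseteq> {}"
proof -
  have "verts (A1 \<squnion> A2) \<inter> verts (B1 \<squnion> B2) \<subseteq> {}" "verts (A1 \<squnion> A2) \<inter> verts P \<subseteq> {b}"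
    "verts P \<inter> verts (B1 \<squnion> B2) \<subseteq> {c}" "verts (A1 \<squnion> A2) \<inter> verts Q \<subseteq> {b'}"
    "verts (B1 \<squnion> B2) \<inter> verts Q \<subseteq> {c'}"
    using assms by (simp_all add: baguette_segments_def)
  then show "verts A1 \<inter> verts B1 \<subseteq> {}" "verts A1 \<inter> verts B2 \<subseteq> {}" "verts A2 \<inter> verts B1 \<subseteq> {}"
    "verts A2 \<inter> verts B2 \<subseteq> {}" "verts A1 \<inter> verts P \<subseteq> {b}" "verts A2 \<inter> verts P \<subseteq> {b}"
    "verts P \<inter> verts B1 \<subseteq> {c}" "verts P \<inter> verts B2 \<subseteq> {c}"
    "verts A1 \<inter> verts Q \<subseteq> {b'}" "verts A2 \<inter> verts Q \<subseteq> {b'}"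
    "verts B1 \<inter> verts Q \<subseteq> {c'}" "verts B2 \<inter> verts Q \<subseteq> {c'}"
    by auto
qed (use assms in \<open>simp_all add: baguette_segments_def\<close>)

text \<open>The list for the count consists of five paths without \<open>P\<close>: the main path of
  \<open>arcs_through_baguette_unhit\<close> always runs along \<open>P\<close>, so the path to be
  deleted is sought among the other five.\<close>

lemma baguette_edges_disjoint:
  assumes "baguette_segments b b' c c' A1 A2 B1 B2 P Q"
  shows "sorted_wrt (\<lambda>A B. A \<inter> B = {}) [edges A1, edges A2, edges B1, edges B2, edges Q]"
    "edges P \<inter> edges Q = {}"
    "edges P \<inter> edges A1 = {}" "edges P \<inter> edges A2 = {}" "edges P \<inter> edges B1 = {}" "edges P \<inter> edges B2 = {}"
proof -
  note h = baguette_segmentsD[OF assms]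
  note A = parallelD(2,3)[OF h(1)] and B = parallelD(2,3)[OF h(2)]
  have AB: "verts A1 \<inter> verts B1 \<subseteq> {b}" "verts A1 \<inter> verts B2 \<subseteq> {b}" "verts A2 \<inter> verts B1 \<subseteq> {b}"
    "verts A2 \<inter> verts B2 \<subseteq> {b}"
    using h(5-8) by auto
  show "sorted_wrt (\<lambda>A B. A \<inter> B = {}) [edges A1, edges A2, edges B1, edges B2, edges Q]"
    using parallel_edges[OF h(1)] parallel_edges[OF h(2)]
      path_edges_disjoint[OF A(1) B(1) AB(1)] path_edges_disjoint[OF A(1) B(2) AB(2)]
      path_edges_disjoint[OF A(2) B(1) AB(3)] path_edges_disjoint[OF A(2) B(2) AB(4)]
      path_edges_disjoint[OF A(1) h(4) h(13)] path_edges_disjoint[OF A(2) h(4) h(14)]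
      path_edges_disjoint[OF B(1) h(4) h(15)] path_edges_disjoint[OF B(2) h(4) h(16)]
    by simp
  show "edges P \<inter> edges Q = {}"
    using path_edges_disjoint[OF h(3,4)] h(17) by blast
  show "edges P \<inter> edges A1 = {}" "edges P \<inter> edges A2 = {}" "edges P \<inter> edges B1 = {}" "edges P \<inter> edges B2 = {}"
    using path_edges_disjoint[OF A(1) h(3) h(9)] path_edges_disjoint[OF A(2) h(3) h(10)]
      path_edges_disjoint[OF h(3) B(1) h(11)] path_edges_disjoint[OF h(3) B(2) h(12)]
    by (simp_all add: Int_commute)
qed

text \<open>The main path runs from \<open>b'\<close> along \<open>A1\<close>, \<open>P\<close>,
  \<open>B1\<close> to \<open>c'\<close>, and \<open>B2\<close> leads from \<open>c'\<close> back to
  \<open>c\<close>. From \<open>b'\<close> one may return either along \<open>A2\<close> to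
  \<open>b\<close> or along \<open>Q\<close> to \<open>c'\<close>; the unhit one is left
  out.\<close>

lemma arcs_through_baguette_unhit:
  assumes G: "is_graph G" and H: "baguette_segments b b' c c' A1 A2 B1 B2 P Q"
    and le: "A1 \<squnion> A2 \<squnion> P \<squnion> (B1 \<squnion> B2) \<squnion> Q \<sqsubseteq> G" and F: "F \<subseteq> edges (A1 \<squnion> A2 \<squnion> P \<squnion> (B1 \<squnion> B2) \<squnion> Q)"
    and unhit: "F \<inter> edges A2 = {} \<or> F \<inter> edges Q = {}"
  shows "arcs_through G F"
proof -
  note h = baguette_segmentsD[OF H] and dis = baguette_edges_disjoint[OF H]
  note A = parallelD(1-3)[OF h(1)] and B = parallelD(1-3)[OF h(2)]
  note mA = parallel_mem[OF h(1)] and mB = parallel_mem[OF h(2)]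
  have bc: "b' \<noteq> c'"
    using h(5) mA mB by auto
  have "is_path (A1 \<squnion> P) b' c"
    using is_path_join'[OF is_path_rev[OF A(2)] h(3) h(9)] .
  moreover have "verts (A1 \<squnion> P) \<inter> verts B1 \<subseteq> {c}"
    using h(5,11) by auto
  ultimately have M: "is_path (A1 \<squnion> P \<squnion> B1) b' c'"
    using is_path_join' B(2) by metis
  have X: "verts B2 \<inter> verts (A1 \<squnion> P \<squnion> B1) \<subseteq> {c', c}"
    using h(6,12) parallel_subset[OF h(2)] by auto
  from unhit show ?thesis
  proof
    assume F': "F \<inter> edges A2 = {}"
    show ?thesis
    proof (rule arcs_through_lasso[OF G M bc _ is_path_rev[OF B(3)] _ X _ _ h(4)])
      show "verts Q \<inter> verts (A1 \<squnion> P \<squnion> B1) \<subseteq> {b', c'}"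
        using h(13,15,17) by auto
      show "verts B2 \<inter> verts Q \<subseteq> verts (A1 \<squnion> P \<squnion> B1)"
        using h(16) mB by auto
      show "edges B2 \<inter> edges (A1 \<squnion> P \<squnion> B1) = {}" "edges Q \<inter> edges (A1 \<squnion> P \<squnion> B1) = {}" "edges B2 \<inter> edges Q = {}"
        using dis by auto
    qed (use le F F' mA mB in auto)
  next
    assume F': "F \<inter> edges Q = {}"
    show ?thesis
    proof (rule arcs_through_lasso[OF G M bc _ is_path_rev[OF B(3)] _ X _ _ is_path_rev[OF A(3)]])
      show "verts A2 \<inter> verts (A1 \<squnion> P \<squnion> B1) \<subseteq> {b', b}"
        using h(7,10) parallel_subset[OF h(1)] by auto
      show "verts B2 \<inter> verts A2 \<subseteq> verts (A1 \<squnion> P \<squnion> B1)"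
        using h(8) mA by auto
      show "edges B2 \<inter> edges (A1 \<squnion> P \<squnion> B1) = {}" "edges A2 \<inter> edges (A1 \<squnion> P \<squnion> B1) = {}" "edges B2 \<inter> edges A2 = {}"
        using dis by auto
    qed (use le F F' mA mB in auto)
  qed
qed

lemma arcs_through_baguette:
  assumes G: "is_graph G" and H: "baguette_segments b b' c c' A1 A2 B1 B2 P Q"
    and le: "A1 \<squnion> A2 \<squnion> P \<squnion> (B1 \<squnion> B2) \<squnion> Q \<sqsubseteq> G"
    and F: "F \<subseteq> edges (A1 \<squnion> A2 \<squnion> P \<squnion> (B1 \<squnion> B2) \<squnion> Q)" "card F = 4"
  shows "arcs_through G F"
proof -
  have "finite F"
    using F(2) by (metis card.infinite zero_neq_numeral)
  with baguette_edges_disjoint(1)[OF H] obtain A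
    where "A \<in> set [edges A1, edges A2, edges B1, edges B2, edges Q]" "F \<inter> A = {}"
    by (rule exists_unhit[of _ F]) (simp add: F(2))
  then consider "F \<inter> edges A2 = {} \<or> F \<inter> edges Q = {}" | "F \<inter> edges A1 = {}" | "F \<inter> edges B1 = {}"
    | "F \<inter> edges B2 = {}"
    by auto
  then show ?thesis
  proof cases
    case 1
    then show ?thesis
      using arcs_through_baguette_unhit[OF G H le F(1)] by blast
  next
    case 2
    show ?thesis
      by (rule arcs_through_baguette_unhit[OF G baguette_segments_sym(1)[OF H]]) (use le F 2 in auto)
  next
    case 3
    show ?thesis
      by (rule arcs_through_baguette_unhit[OF G baguette_segments_sym(1)[OF baguette_segments_sym(2)[OF H]]])
        (use le F 3 in auto)
  next
    case 4
    show ?thesis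
      by (rule arcs_through_baguette_unhit[OF G baguette_segments_sym(2)[OF H]]) (use le F 4 in auto)
  qed
qed

lemma arcs_through_basic:
  assumes G: "is_graph G" and H: "basic_4ac H" "H \<sqsubseteq> G" and F: "F \<subseteq> edges H" "card F = 4"
  shows "arcs_through G F"
proof -
  consider "is_cycle H" | "is_theta H" | "is_happy_face H" | "is_baguette H"
    using H(1) by (auto simp: basic_4ac_def)
  then show ?thesis
  proof cases
    case 1
    then show ?thesis
      using arcs_through_cycle[OF G] H(2) F(1) unfolding is_cycle_iff_parallel by blast
  next
    case 2
    then show ?thesis
      using arcs_through_theta[OF G] H(2) F(1) unfolding is_theta_iff by blast
  next
    case 3
    then show ?thesis
      using arcs_through_happy[OF G] H(2) F unfolding is_happy_face_iff by blast
  next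
    case 4
    then show ?thesis
      using arcs_through_baguette[OF G] H(2) F unfolding is_baguette_iff by blast
  qed
qed

section \<open>From chosen points to chosen edges\<close>

lemma subset_of_three:
  assumes "card F \<le> 3" "finite F" "F \<subseteq> E" "x \<in> E"
  obtains a b c where "a \<in> E" "b \<in> E" "c \<in> E" "F \<subseteq> {a, b, c}"
proof -
  consider "card F = 0" | "card F = 1" | "card F = 2" | "card F = 3"
    using assms(1) by linarith
  then show thesis
  proof cases
    case 1
    then show thesis
      using that[of x x x] assms by auto
  next
    case 2
    then obtain a where "F = {a}"
      by (rule card_1_singletonE)
    then show thesis
      using that[of a a a] assms by auto
  next
    case 3
    then obtain a b where "F = {a, b}"
      by (auto simp: card_2_iff)
    then show thesis
      using that[of a b b] assms by auto
  next
    case 4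
    then obtain a b c where "F = {a, b, c}"
      by (auto simp: card_3_iff)
    then show thesis
      using that[of a b c] assms by auto
  qed
qed

text \<open>Condition (3) cannot be applied here, since \<open>G\<close> may have fewer than four
  edges. Cyclic connectivity alone puts three edges on a cycle or a theta curve.\<close>

lemma arcs_through_three_edges:
  assumes G: "is_graph G" "cyclically_connected G"
    and F: "card F \<le> 3" "finite F" "F \<subseteq> edges G" and x: "x \<in> edges G"
  shows "arcs_through G F"
proof -
  obtain d e f where def: "d \<in> edges G" "e \<in> edges G" "f \<in> edges G" "F \<subseteq> {d, e, f}"
    using subset_of_three[OF F x] .
  obtain a b A B where C: "parallel a b A B" "A \<squnion> B \<sqsubseteq> G" "{d, e} \<subseteq> edges (A \<squnion> B)"
    using cycle_through_two_edges[OF G def(1,2)] .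
  show ?thesis
  proof (cases "f \<in> edges (A \<squnion> B)")
    case True
    show ?thesis
      by (rule arcs_through_cycle[OF G(1) C(1,2)]) (use True C(3) def(4) in auto)
  next
    case False
    obtain p q P Q E where T: "theta_segments p q P Q E" "P \<squnion> Q = A \<squnion> B" "E \<sqsubseteq> G" "f \<in> edges E"
      using theta_through_edge[OF G C(1,2) def(3) False] .
    have "P \<squnion> Q \<squnion> E \<sqsubseteq> G" "F \<subseteq> edges (P \<squnion> Q \<squnion> E)"
      using C(2,3) T(3,4) def(4) unfolding T(2)[symmetric] by auto
    then show ?thesis
      using arcs_through_theta[OF G(1) T(1)] by blast
  qed
qed

lemma n_ac_4_if_covered:
  assumes G: "is_graph G" "cyclically_connected G" and vw: "v0 \<in> verts G" "w0 \<in> verts G" "v0 \<noteq> w0"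
    and cov: "\<And>F. F \<subseteq> edges G \<Longrightarrow> card F = 4 \<Longrightarrow> covered G F"
  shows "n_ac 4 G"
  unfolding n_ac_def
proof (intro allI impI, elim conjE)
  fix S assume S: "S \<subseteq> topspace (one_complex G)" "finite S" "card S \<le> 4"
  have edge_at: "\<exists>e\<in>edges G. v \<in> e" if v: "v \<in> verts G" for v
  proof -
    obtain w where w: "w \<in> verts G" "v \<noteq> w"
      using vw by metis
    obtain P Q where P: "parallel v w P Q" "P \<sqsubseteq> G"
      using cyclically_connected_cycle[OF G(2) v w] by metis
    from is_path_Cons_snoc[OF parallelD(2,1)[OF P(1)]] obtain ps
      where ps: "distinct (v # ps @ [w])" "P = path_graph (v # ps @ [w])" .
    obtain z zs where "ps @ [w] = z # zs"
      by (cases "ps @ [w]") auto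
    then have "{v, z} \<in> edges P"
      using ps(2) by simp
    then show ?thesis
      using P(2) by (auto simp: graph_le_def)
  qed
  have "\<exists>e\<in>edges G. x \<in> realization \<lparr>verts = e, edges = {e}\<rparr>" if "x \<in> S" for x
  proof (cases x)
    case (Vertex v)
    then have "v \<in> verts G"
      using that S(1) topspace_realization[OF G(1)] by auto
    then show ?thesis
      using edge_at Vertex by auto
  next
    case (Inner e t)
    then have "e \<in> edges G" "0 < t" "t < 1"
      using that S(1) topspace_realization[OF G(1)] by auto
    then show ?thesis
      using Inner by (intro bexI[of _ e]) auto
  qed
  then obtain h where h: "\<And>x. x \<in> S \<Longrightarrow> h x \<in> edges G \<and> x \<in> realization \<lparr>verts = h x, edges = {h x}\<rparr>"
    by metis
  let ?F = "h ` S"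
  have F: "?F \<subseteq> edges G" "finite ?F" "card ?F \<le> 4"
    using h S(2,3) card_image_le[OF S(2), of h] by auto
  have "arcs_through G ?F"
  \<comment> \<open>Several points may lie on the same chosen edge, so four points can yield fewer
    than four edges.\<close>
  proof (cases "card ?F = 4")
    case True
    then show ?thesis
      using cov[OF F(1)] arcs_through_basic[OF G(1)] unfolding covered_def subgraph_iff by blast
  next
    case False
    then have "card ?F \<le> 3"
      using F(3) by linarith
    moreover obtain e where "e \<in> edges G"
      using edge_at[OF vw(1)] by blast
    ultimately show ?thesis
      using arcs_through_three_edges[OF G _ F(2,1)] by blast
  qed
  moreover have "S \<subseteq> (\<Union>e\<in>?F. realization \<lparr>verts = e, edges = {e}\<rparr>)"
    using h by blast
  ultimately show "\<exists>A. is_arc_in (one_complex G) A \<and> S \<subseteq> A"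
    unfolding arcs_through_def using S(2) by blast
qed

section \<open>Removing two vertices\<close>

definition punctured :: "'a ugraph \<Rightarrow> 'a \<Rightarrow> 'a \<Rightarrow> 'a point topology" where
  "punctured G a b = subtopology (one_complex G) (topspace (one_complex G) - {Vertex a, Vertex b})"

lemma topspace_punctured: "is_graph G \<Longrightarrow> topspace (punctured G a b) = realization G - {Vertex a, Vertex b}"
  by (auto simp: punctured_def topspace_realization)

text \<open>\<open>K\<close> together with all open edges meeting it is clopen once \<open>a\<close>
  and \<open>b\<close> are removed: an edge with one end in \<open>K\<close> has its other end in
  \<open>K\<close> or among the removed vertices. So neither this set nor its complement splits an
  open edge, and \<open>openin_saturated\<close> applies to both.\<close>

lemma not_connected_component_punctured:
  assumes G: "is_graph G" and K: "K \<subseteq> verts G" "a \<notin> K" "b \<notin> K"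
    "\<And>y z. y \<in> K \<Longrightarrow> {y, z} \<in> edges G \<Longrightarrow> z \<noteq> a \<Longrightarrow> z \<noteq> b \<Longrightarrow> z \<in> K"
    and u: "u \<in> K"
    and x: "x \<notin> Vertex ` K" "\<And>e t. x = Inner e t \<Longrightarrow> e \<inter> K = {}"
  shows "\<not> connected_component_of (punctured G a b) (Vertex u) x"
proof
  let ?Z = "punctured G a b"
  define U where "U = Vertex ` K \<union> {Inner e t | e t. e \<in> edges G \<and> e \<inter> K \<noteq> {} \<and> 0 < t \<and> t < 1}"
  have sub: "U \<subseteq> realization G - {Vertex a, Vertex b}"
    using K by (auto simp: U_def)
  have "openin (one_complex G) U"
  proof (rule openin_saturated[OF G])
    show "U \<subseteq> realization G" using sub by blast
    show "(\<forall>t. 0 < t \<and> t < 1 \<longrightarrow> Inner e t \<in> U) \<or>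
      (\<forall>t. 0 < t \<and> t < 1 \<longrightarrow> Inner e t \<notin> U) \<and> (\<forall>v\<in>e. Vertex v \<notin> U)" if "e \<in> edges G" for e
      using that by (cases "e \<inter> K = {}") (auto simp: U_def)
  qed
  then have "openin ?Z (U \<inter> (topspace (one_complex G) - {Vertex a, Vertex b}))"
    unfolding punctured_def openin_subtopology by blast
  moreover have "U \<inter> (topspace (one_complex G) - {Vertex a, Vertex b}) = U"
    using sub topspace_realization[OF G] by blast
  ultimately have open_U: "openin ?Z U"
    by simp
  have "openin (one_complex G) (realization G - {Vertex a, Vertex b} - U)"
  proof (rule openin_saturated[OF G])
    let ?C = "realization G - {Vertex a, Vertex b} - U"
    show "(\<forall>t. 0 < t \<and> t < 1 \<longrightarrow> Inner e t \<in> ?C) \<or>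
      (\<forall>t. 0 < t \<and> t < 1 \<longrightarrow> Inner e t \<notin> ?C) \<and> (\<forall>v\<in>e. Vertex v \<notin> ?C)" if e: "e \<in> edges G" for e
    proof (cases "e \<inter> K = {}")
      case True
      then show ?thesis
        using e by (auto simp: U_def)
    next
      case False
      then obtain k where k: "k \<in> e" "k \<in> K" by blast
      have "v \<in> K \<or> v = a \<or> v = b" if "v \<in> e" for v
      proof (cases "v = k")
        case False
        then have "e = {k, v}"
          using ends_edge(1)[OF G e] k(1) that by (metis doubleton_eq_iff insertE singletonD)
        then show ?thesis
          using K(4)[OF k(2)] e by blast
      qed (use k in simp)
      then have "\<forall>v\<in>e. Vertex v \<notin> ?C"
        by (auto simp: U_def)
      moreover have "\<forall>t. 0 < t \<and> t < 1 \<longrightarrow> Inner e t \<notin> ?C"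
        using False e by (auto simp: U_def)
      ultimately show ?thesis by blast
    qed
  qed blast
  then have "openin ?Z ((realization G - {Vertex a, Vertex b} - U) \<inter> (topspace (one_complex G) - {Vertex a, Vertex b}))"
    unfolding punctured_def openin_subtopology by blast
  moreover have "(realization G - {Vertex a, Vertex b} - U) \<inter> (topspace (one_complex G) - {Vertex a, Vertex b})
      = topspace ?Z - U"
    unfolding topspace_punctured[OF G] topspace_realization[OF G] by blast
  ultimately have "closedin ?Z U"
    using sub topspace_punctured[OF G] by (simp add: closedin_def)
  moreover assume "connected_component_of ?Z (Vertex u) x"
  then obtain T where "connectedin ?Z T" "Vertex u \<in> T" "x \<in> T"
    unfolding connected_component_of_def by blast
  moreover have "Vertex u \<in> U" "x \<notin> U"
    using u x by (auto simp: U_def)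
  ultimately show False
    using connectedin_clopen_cases[OF _ _ open_U] by (meson disjnt_iff subsetD)
qed

text \<open>Without a link, one point chosen on each of the four paths would give four different
  components. A path that is just the edge \<open>{a, b}\<close> has no inner vertex, and its open
  edge is a component of its own.\<close>

lemma linked_if_few_components:
  assumes G: "is_graph G"
    and few: "\<And>v w. v \<in> verts G \<Longrightarrow> w \<in> verts G \<Longrightarrow> v \<noteq> w \<Longrightarrow>
      finite (complement_components G v w) \<and> card (complement_components G v w) \<le> 3"
  shows "linked G"
  unfolding linked_def
proof (intro allI impI, elim conjE)
  fix a b and P :: "nat \<Rightarrow> 'a ugraph"
  assume par: "\<forall>i<4. \<forall>j<4. i \<noteq> j \<longrightarrow> parallel a b (P i) (P j)" and le: "\<forall>i<4. P i \<sqsubseteq> G"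
  let ?Z = "punctured G a b"
  let ?avoid = "\<lambda>W. W \<sqsubseteq> G \<and> a \<notin> verts W \<and> b \<notin> verts W"
  show "\<exists>i<4. \<exists>j<4. i \<noteq> j \<and> (\<exists>W u w. is_path W u w \<and> W \<sqsubseteq> G \<and> a \<notin> verts W \<and> b \<notin> verts W \<and>
      u \<in> verts (P i) \<and> w \<in> verts (P j))"
  proof (rule ccontr)
    assume no_link: "\<not> ?thesis"
    have p01: "parallel a b (P 0) (P 1)"
      using par by simp
    have "P 0 \<sqsubseteq> G"
      using le by simp
    then have ab: "a \<in> verts G" "b \<in> verts G" "a \<noteq> b"
      using parallel_mem(1,2)[OF p01] parallelD(1)[OF p01] by (auto simp: graph_le_def)
    have path: "is_path (P i) a b" if "i < 4" for i
    proof -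
      obtain j :: nat where j: "j < 4" "i \<noteq> j"
        by (rule that[of "if i = 0 then 1 else 0"]) auto
      show ?thesis
        by (rule parallelD(2)[OF par[rule_format, OF that j]])
    qed
    \<comment> \<open>The vertices reachable from \<open>u\<close> in \<open>G\<close> without
      \<open>a\<close> and \<open>b\<close>; this is the set to which
      \<open>not_connected_component_punctured\<close> is applied.\<close>
    define K where "K u = {v. \<exists>W. is_path W u v \<and> ?avoid W}" for u
    have K: "K u \<subseteq> verts G" "a \<notin> K u" "b \<notin> K u" for u
      using is_path_ends(2) by (fastforce simp: K_def graph_le_def)+
    have Ku: "u \<in> K u" if "u \<in> verts G" "u \<noteq> a" "u \<noteq> b" for u
      using that is_path_refl[of u] by (auto simp: K_def graph_le_def intro!: exI[of _ "path_graph [u]"])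
    have Kclosed: "z \<in> K u" if yz: "y \<in> K u" "{y, z} \<in> edges G" "z \<noteq> a" "z \<noteq> b" for u y z
    proof -
      obtain W where W: "is_path W u y" "?avoid W"
        using yz(1) by (auto simp: K_def)
      have "y \<noteq> z" "y \<noteq> a" "y \<noteq> b"
        using G yz(1,2) K by (fastforce simp: is_graph_def)+
      then obtain R where R: "is_path R u z" "R \<sqsubseteq> W \<squnion> path_graph [y, z]"
        using is_path_trans[OF W(1) is_path_edge] by metis
      moreover have "?avoid R"
        using R(2) W(2) edge_path_le[OF G yz(2)] yz(3,4) \<open>y \<noteq> a\<close> \<open>y \<noteq> b\<close> by (auto simp: graph_le_def)
      ultimately show ?thesis
        unfolding K_def by blast
    qed
    \<comment> \<open>An inner vertex represents the path if there is one; otherwise the midpoint of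
      its only edge does.\<close>
    have point: "\<exists>x. x \<in> topspace ?Z \<and> ((\<exists>u\<in>verts (P i). u \<noteq> a \<and> u \<noteq> b \<and> x = Vertex u) \<or>
        P i = path_graph [a, b] \<and> x = Inner {a, b} (1/2))" if i: "i < 4" for i
    proof (cases "verts (P i) \<subseteq> {a, b}")
      case True
      obtain ps where ps: "distinct (a # ps @ [b])" "P i = path_graph (a # ps @ [b])"
        using is_path_Cons_snoc[OF path[OF i] ab(3)] .
      with True have "set ps = {}"
        by (simp add: subset_insert)
      then have eq: "P i = path_graph [a, b]"
        using ps(2) by simp
      then have "{a, b} \<in> edges G"
        using le i by (force simp: graph_le_def)
      then show ?thesis
        using eq topspace_punctured[OF G] by auto
    next
      case False
      then obtain u where u: "u \<in> verts (P i)" "u \<noteq> a" "u \<noteq> b"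
        by blast
      moreover have "u \<in> verts G"
        using le[rule_format, OF i] u(1) by (auto simp: graph_le_def)
      ultimately show ?thesis
        using topspace_punctured[OF G] by (intro exI[of _ "Vertex u"]) auto
    qed
    define x where "x i = (SOME x. x \<in> topspace ?Z \<and> ((\<exists>u\<in>verts (P i). u \<noteq> a \<and> u \<noteq> b \<and> x = Vertex u) \<or>
        P i = path_graph [a, b] \<and> x = Inner {a, b} (1/2)))" for i
    have x: "x i \<in> topspace ?Z" "(\<exists>u\<in>verts (P i). u \<noteq> a \<and> u \<noteq> b \<and> x i = Vertex u) \<or>
        P i = path_graph [a, b] \<and> x i = Inner {a, b} (1/2)" if "i < 4" for i
      using someI_ex[OF point[OF that]] unfolding x_def by blast+
    have sep: "\<not> connected_component_of ?Z (x i) (x j)"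
      if ij: "i < 4" "j < 4" "i \<noteq> j" and u: "u \<in> verts (P i)" "u \<noteq> a" "u \<noteq> b" "x i = Vertex u" for i j u
      unfolding u(4)
    proof (rule not_connected_component_punctured[where K = "K u", OF G K])
      show "z \<in> K u" if "y \<in> K u" "{y, z} \<in> edges G" "z \<noteq> a" "z \<noteq> b" for y z
        by (rule Kclosed[OF that])
      show "u \<in> K u"
        using Ku[OF _ u(2,3)] u(1) le[rule_format, OF ij(1)] by (auto simp: graph_le_def)
      show "x j \<notin> Vertex ` K u"
      proof
        assume "x j \<in> Vertex ` K u"
        then obtain w where w: "w \<in> K u" "w \<in> verts (P j)"
          using x(2)[OF ij(2)] by auto
        then obtain W where "is_path W u w" "?avoid W"
          by (auto simp: K_def)
        then show False
          using no_link ij u(1) w(2) by blast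
      qed
      show "e \<inter> K u = {}" if "x j = Inner e t" for e t
        using x(2)[OF ij(2)] that K by auto
    qed
    have "connected_component_of_set ?Z (x i) \<noteq> connected_component_of_set ?Z (x j)"
      if ij: "i < 4" "j < 4" "i \<noteq> j" for i j
    proof
      assume eq: "connected_component_of_set ?Z (x i) = connected_component_of_set ?Z (x j)"
      have cc: "connected_component_of ?Z (x i) (x j)" "connected_component_of ?Z (x j) (x i)"
        using eq x(1)[OF ij(1)] x(1)[OF ij(2)] connected_component_of_refl by (metis mem_Collect_eq)+
      have "P i \<noteq> P j"
        by (rule parallelD(4)[OF par[rule_format, OF ij]])
      \<comment> \<open>The bare edge can occur only once among different paths, so of any two paths
        at least one is represented by a vertex, as \<open>sep\<close> requires.\<close>
      then consider u where "u \<in> verts (P i)" "u \<noteq> a" "u \<noteq> b" "x i = Vertex u"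
        | u where "u \<in> verts (P j)" "u \<noteq> a" "u \<noteq> b" "x j = Vertex u"
        using x(2)[OF ij(1)] x(2)[OF ij(2)] by metis
      then show False
        using cc sep[OF ij] sep[OF ij(2,1) ij(3)[symmetric]] by cases blast+
    qed
    then have "inj_on (\<lambda>i. connected_component_of_set ?Z (x i)) {..<4}"
      by (auto simp: inj_on_def)
    moreover have "(\<lambda>i. connected_component_of_set ?Z (x i)) ` {..<4} \<subseteq> complement_components G a b"
      using x(1) unfolding complement_components_def punctured_def connected_components_of_def by auto
    ultimately have "card {..<4::nat} \<le> card (complement_components G a b)"
      using few[OF ab] by (intro card_inj_on_le) auto
    then show False
      using few[OF ab] by simp
  qed
qed

lemma few_components_if_n_ac:
  assumes G: "is_graph G" and ac: "n_ac 4 G" and vw: "v \<in> verts G" "w \<in> verts G"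
  shows "finite (complement_components G v w) \<and> card (complement_components G v w) \<le> 3"
proof (rule ccontr)
  let ?Z = "punctured G v w" and ?CC = "complement_components G v w"
  have CC: "?CC = connected_components_of ?Z"
    by (simp add: complement_components_def punctured_def)
  assume many: "\<not> ?thesis"
  \<comment> \<open>An infinite set has \<open>card\<close> 0, so the bound can fail by infinity or
    by size; four components exist either way.\<close>
  obtain \<C> where C: "\<C> \<subseteq> ?CC" "card \<C> = 4" "finite \<C>"
  proof (cases "finite ?CC")
    case True
    with many have "4 \<le> card ?CC"
      by simp
    then show thesis
      using that by (rule obtain_subset_with_card_n) blast
  next
    case False
    then show thesis
      using that infinite_arbitrarily_large by metis
  qed
  have "\<exists>x. x \<in> D" if "D \<in> \<C>" for D
    using C(1) that nonempty_connected_components_of unfolding CC by blast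
  then obtain f where f: "\<And>D. D \<in> \<C> \<Longrightarrow> f D \<in> D"
    by metis
  \<comment> \<open>A connected set containing two of the chosen points forces their components to
    coincide; a subarc will be such a set.\<close>
  have comp: "D = E" if "D \<in> \<C>" "E \<in> \<C>" "connectedin ?Z T" "f D \<in> T" "f E \<in> T" for D E T
  proof -
    have DE: "D \<in> connected_components_of ?Z" "E \<in> connected_components_of ?Z"
      using C(1) that unfolding CC by auto
    have "T \<subseteq> D"
      using connected_components_of_maximal[OF DE(1) that(3)] that(1,4) f by (auto simp: disjnt_iff)
    then have "D \<inter> E \<noteq> {}"
      using that f by blast
    then show ?thesis
      using connected_components_of_overlap[OF DE] by blast
  qed
  have top: "f D \<in> realization G - {Vertex v, Vertex w}" if "D \<in> \<C>" for D
    using C(1) that f[OF that] Union_connected_components_of[of ?Z] topspace_punctured[OF G]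
    unfolding CC by blast
  have "f ` \<C> \<subseteq> topspace (one_complex G)" "finite (f ` \<C>)" "card (f ` \<C>) \<le> 4"
    using top C card_image_le[OF C(3), of f] topspace_realization[OF G] by auto
  then obtain A where A: "is_arc_in (one_complex G) A" "f ` \<C> \<subseteq> A"
    using ac unfolding n_ac_def by blast
  then have "top_of_set {0..1::real} homeomorphic_space subtopology (one_complex G) A"
    unfolding is_arc_in_def using homeomorphic_space_sym by blast
  then obtain g where g: "homeomorphic_map (top_of_set {0..1::real}) (subtopology (one_complex G) A) g"
    unfolding homeomorphic_space by blast
  have cont: "continuous_map (top_of_set {0..1}) (one_complex G) g"
    using homeomorphic_imp_continuous_map[OF g] continuous_map_in_subtopology by blast
  have inj: "inj_on g {0..1}"
    using homeomorphic_imp_injective_map[OF g] by simp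
  have img: "g ` {0..1} = A"
    using homeomorphic_imp_surjective_map[OF g] A(1) by (auto simp: is_arc_in_def)
  define s where "s D = (SOME t. t \<in> {0..1} \<and> g t = f D)" for D
  have s: "s D \<in> {0..1}" "g (s D) = f D" if "D \<in> \<C>" for D
  proof -
    have "\<exists>t. t \<in> {0..1} \<and> g t = f D"
      using img A(2) that by (metis imageE image_subset_iff)
    from someI_ex[OF this] show "s D \<in> {0..1}" "g (s D) = f D"
      unfolding s_def by blast+
  qed
  let ?H = "{t \<in> {0..1}. g t \<in> {Vertex v, Vertex w}}"
  have H: "finite ?H" "card ?H \<le> 2"
  proof -
    have sub: "g ` ?H \<subseteq> {Vertex v, Vertex w}"
      by auto
    have injH: "inj_on g ?H"
      using inj by (rule inj_on_subset) auto
    show "finite ?H"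
      using finite_imageD[OF finite_subset[OF sub] injH] by simp
    have "card ?H \<le> card {Vertex v, Vertex w}"
      using card_inj_on_le[OF injH sub] by simp
    also have "\<dots> \<le> 2"
      by (simp add: card_insert_if)
    finally show "card ?H \<le> 2" .
  qed
  \<comment> \<open>\<open>k D\<close> tells in which piece of the arc the point \<open>f D\<close>
    lies, by counting the removed parameters before it. With at most two of these there are three
    values for four components, so two chosen points share a piece.\<close>
  define k where "k D = card {t \<in> ?H. t < s D}" for D
  have "k ` \<C> \<subseteq> {..2}"
  proof (rule image_subsetI)
    fix D
    have "k D \<le> card ?H"
      unfolding k_def using H(1) by (intro card_mono) auto
    then show "k D \<in> {..2}"
      using H(2) by simp
  qed
  then have "card (k ` \<C>) \<le> 3"
    using card_mono[of "{..2::nat}"] by fastforce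
  then have "\<not> inj_on k \<C>"
    using C(2) card_image[of k \<C>] by auto
  then obtain D E where DE: "D \<in> \<C>" "E \<in> \<C>" "D \<noteq> E" "k D = k E" "s D \<le> s E"
    unfolding inj_on_def by (metis linear)
  \<comment> \<open>Since \<open>s D \<le> s E\<close>, one set contains the other, and equal
    cardinality makes them equal: no removed parameter lies from \<open>s D\<close> up to, but
    excluding, \<open>s E\<close>.\<close>
  have H_eq: "{t \<in> ?H. t < s D} = {t \<in> ?H. t < s E}"
  proof (rule card_subset_eq)
    show "finite {t \<in> ?H. t < s E}"
      by (rule finite_subset[OF _ H(1)]) blast
    show "{t \<in> ?H. t < s D} \<subseteq> {t \<in> ?H. t < s E}"
      using DE(5) by auto
    show "card {t \<in> ?H. t < s D} = card {t \<in> ?H. t < s E}"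
      using DE(4) unfolding k_def .
  qed
  \<comment> \<open>This covers the remaining parameter \<open>s E\<close>: a chosen point is
    neither of the removed vertices.\<close>
  have sE: "s E \<notin> ?H"
    using s[OF DE(2)] top[OF DE(2)] by auto
  have no_hit: "t \<notin> ?H" if "s D \<le> t" "t \<le> s E" for t
  proof
    assume t: "t \<in> ?H"
    then have "t < s E"
      using sE that(2) by (metis less_eq_real_def)
    then have "t \<in> {t \<in> ?H. t < s D}"
      unfolding H_eq using t by blast
    then show False
      using that(1) by simp
  qed
  have I: "{s D..s E} \<subseteq> {0..1}"
    using s(1)[OF DE(1)] s(1)[OF DE(2)] by auto
  have "connectedin (top_of_set {0..1}) {s D..s E}"
    using I by (simp add: connectedin_subtopology)
  then have "connectedin (one_complex G) (g ` {s D..s E})"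
    by (rule connectedin_continuous_map_image[OF cont])
  moreover have "g ` {s D..s E} \<subseteq> topspace (one_complex G) - {Vertex v, Vertex w}"
  proof -
    have "g ` {s D..s E} \<subseteq> topspace (one_complex G)"
      using calculation connectedin_subset_topspace by blast
    moreover have "g t \<notin> {Vertex v, Vertex w}" if "t \<in> {s D..s E}" for t
      using no_hit[of t] that I by auto
    ultimately have "g t \<in> topspace (one_complex G) - {Vertex v, Vertex w}" if "t \<in> {s D..s E}" for t
      using that by blast
    then show ?thesis
      by (rule image_subsetI)
  qed
  ultimately have "connectedin ?Z (g ` {s D..s E})"
    unfolding punctured_def by (simp add: connectedin_subtopology)
  moreover have "f D \<in> g ` {s D..s E}" "f E \<in> g ` {s D..s E}"
    using s(2)[OF DE(1)] s(2)[OF DE(2)] DE(5) by (metis atLeastAtMost_iff image_eqI order_refl)+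
  ultimately show False
    using comp[OF DE(1,2)] DE(3) by blast
qed

theorem theorem3p2p1:
  fixes G :: "'a ugraph"
  assumes "is_graph G"
    and "\<exists>v\<in>verts G. \<exists>w\<in>verts G. v \<noteq> w"
    and "cyclically_connected G"
  shows "(n_ac 4 G \<longleftrightarrow>
            (\<forall>v\<in>verts G. \<forall>w\<in>verts G. v \<noteq> w \<longrightarrow>
               finite (complement_components G v w) \<and> card (complement_components G v w) \<le> 3)) \<and>
         (n_ac 4 G \<longleftrightarrow>
            (\<forall>F. F \<subseteq> edges G \<and> card F = 4 \<longrightarrow>
               (\<exists>H. subgraph H G \<and> basic_4ac H \<and> F \<subseteq> edges H)))"
    (is "(?ac \<longleftrightarrow> ?few) \<and> (?ac \<longleftrightarrow> ?cov)")
proof -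
  have "?few" if "?ac"
    using few_components_if_n_ac[OF assms(1) that] by blast
  moreover have "?cov" if few: "?few"
  proof -
    have "linked G"
      by (rule linked_if_few_components[OF assms(1)]) (simp_all add: few)
    then have "covered G F" if "F \<subseteq> edges G" "card F = 4" for F
      using four_edges_covered[OF assms(1,3) _ that] by simp
    then show ?cov
      by (simp add: covered_def)
  qed
  moreover have "?ac" if cov: "?cov"
  proof -
    obtain v w where vw: "v \<in> verts G" "w \<in> verts G" "v \<noteq> w"
      using assms(2) by blast
    show ?ac
      by (rule n_ac_4_if_covered[OF assms(1,3) vw]) (simp add: cov covered_def)
  qed
  ultimately show ?thesis
    by argo
qed

end
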